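(* There are finitely many minimal obstructions to list $k$-coloring $\{P_t,C_\ell\}$-free graphs (that is, finitely many minimal obstructions $(G,L)$ to list $k$-coloring with $G$ being $\{P_t,C_\ell\}$-free) in each of the following cases: (1) $k=3$, $t=7$, $\ell=3$; (2) $k=3$, $t=7$, $\ell=4$; (3) $k=4$, $t=6$, $\ell=3$; (4) $k=4$, $t=5$, $\ell=4$; (5) $k=5$, $t=5$, $\ell=3$. Moreover, let $\mathcal C$ be a hereditary class of graphs in which every sufficiently long path $v_1-\ldots-v_r$ contains, for some $i\in\{1,\dots,r-2\}$ and some $k>i+1$, two chords $v_iv_k$ and $v_{i+1}v_k$ (i.e. there is an integer $R$ such that this holds for every path on $r\ge R$ vertices that is a, not necessarily induced, subgraph of a graph in $\mathcal C$). Then there is a finite list of minimal obstructions to $3$-coloring the graphs in $\mathcal C$.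
   Context: All graphs are finite, simple, loopless and undirected. $P_t$ denotes the path on $t$ vertices and $C_\ell$ the cycle on $\ell$ vertices. For a set $\mathcal H$ of graphs, a graph is $\mathcal H$-free if no member of $\mathcal H$ is (isomorphic to) an induced subgraph of it. A class of graphs is hereditary if it is closed under taking induced subgraphs. A list $k$-coloring instance is a pair $(G,L)$ with $L(v)\subseteq\{1,\dots,k\}$ for each $v\in V(G)$; it is colorable if there is a function $f$ on $V(G)$ with $f(v)\in L(v)$ for all $v$ and $f(v)\ne f(w)$ for every edge $vw$. A list $k$-coloring instance $(G,L)$ is a minimal obstruction to list $k$-coloring if $(G,L)$ is not colorable but for every proper induced subgraph $H$ of $G$ the instance $(H,L|_{V(H)})$ is colorable, where $L|_{V(H)}$ is the restriction of $L$ to $V(H)$. A graph $G$ is a minimal obstruction to $k$-coloring if $G$ is not $k$-colorable but every proper induced subgraph of $G$ is $k$-colorable. Obstructions are counted up to isomorphism (preserving lists, in the list case). A chord of a path is an edge of the graph joining two vertices of the path that are not consecutive on the path; in particular the vertex $v_k$ is one of $v_1,\dots,v_r$. *)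

theory Defs
  imports
    "HOL-Library.FuncSet"
    "Graph_Theory.Graph_Theory"
begin

text \<open>
  A finite simple undirected graph is a \<^locale>\<open>pair_graph\<close>: a finite loopless digraph without
  parallel arcs whose arc relation is symmetric, so that an edge \<open>uv\<close> is the pair of arcs
  \<open>(u, v)\<close> and \<open>(v, u)\<close>. The null graph is allowed.
\<close>

definition path_graph :: "nat \<Rightarrow> nat pair_pre_digraph" where
  "path_graph t =
    \<lparr>pverts = {..<t}, parcs = {(i, j). i < t \<and> j < t \<and> (j = i + 1 \<or> i = j + 1)}\<rparr>"

text \<open>This is the cycle on \<open>l\<close> vertices for \<open>l \<ge> 3\<close>.\<close>

definition cycle_graph :: "nat \<Rightarrow> nat pair_pre_digraph" where
  "cycle_graph l =
    \<lparr>pverts = {..<l},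
     parcs = {(i, j). i < l \<and> j < l \<and> (j = (i + 1) mod l \<or> i = (j + 1) mod l)}\<rparr>"

lemma pair_graph_path_graph: "pair_graph (path_graph t)"
proof -
  have "parcs (path_graph t) \<subseteq> {..<t} \<times> {..<t}"
    by (auto simp: path_graph_def)
  then have "finite (parcs (path_graph t))"
    by (rule finite_subset) simp
  then show ?thesis
    by unfold_locales (auto simp: path_graph_def symmetric_def intro!: symI)
qed

lemma pair_graph_cycle_graph:
  assumes "l \<ge> 3"
  shows "pair_graph (cycle_graph l)"
proof -
  have "parcs (cycle_graph l) \<subseteq> {..<l} \<times> {..<l}"
    by (auto simp: cycle_graph_def)
  then have "finite (parcs (cycle_graph l))"
    by (rule finite_subset) simp
  moreover have "i \<noteq> Suc i mod l" and "Suc i mod l \<noteq> i" if "i < l" for i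
    using that assms by (cases "Suc i = l"; auto)+
  ultimately show ?thesis
    by unfold_locales (auto simp: cycle_graph_def symmetric_def intro!: symI)
qed

definition induced_free :: "nat pair_pre_digraph set \<Rightarrow> 'a pair_pre_digraph \<Rightarrow> bool" where
  "induced_free \<H> G \<longleftrightarrow>
    \<not> (\<exists>H\<in>\<H>. \<exists>S :: 'a pair_pre_digraph.
        induced_subgraph (with_proj S) (with_proj G) \<and> digraph_iso (with_proj H) (with_proj S))"

definition hereditary :: "'a pair_pre_digraph set \<Rightarrow> bool" where
  "hereditary \<C> \<longleftrightarrow>
    (\<forall>G\<in>\<C>. \<forall>H :: 'a pair_pre_digraph.
      induced_subgraph (with_proj H) (with_proj G) \<longrightarrow> H \<in> \<C>)"

definition colorable :: "nat \<Rightarrow> 'a pair_pre_digraph \<Rightarrow> bool" where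
  "colorable k G \<longleftrightarrow>
    (\<exists>f. (\<forall>v\<in>pverts G. f v \<in> {1..k}) \<and> (\<forall>(v, w)\<in>parcs G. f v \<noteq> f w))"

type_synonym 'a list_instance = "'a pair_pre_digraph \<times> ('a \<Rightarrow> nat set)"

definition list_coloring_instance :: "nat \<Rightarrow> 'a list_instance \<Rightarrow> bool" where
  "list_coloring_instance k = (\<lambda>(G, L).
    pair_graph G \<and> L \<in> PiE (pverts G) (\<lambda>_. Pow {1..k}))"

definition list_colorable :: "'a list_instance \<Rightarrow> bool" where
  "list_colorable = (\<lambda>(G, L).
    \<exists>f. (\<forall>v\<in>pverts G. f v \<in> L v) \<and> (\<forall>(v, w)\<in>parcs G. f v \<noteq> f w))"

definition minimal_list_obstruction :: "nat \<Rightarrow> 'a list_instance \<Rightarrow> bool" where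
  "minimal_list_obstruction k = (\<lambda>(G, L).
    list_coloring_instance k (G, L) \<and> \<not> list_colorable (G, L) \<and>
    (\<forall>H :: 'a pair_pre_digraph.
      induced_subgraph (with_proj H) (with_proj G) \<and> H \<noteq> G \<longrightarrow>
      list_colorable (H, restrict L (pverts H))))"

definition minimal_obstruction :: "nat \<Rightarrow> 'a pair_pre_digraph \<Rightarrow> bool" where
  "minimal_obstruction k G \<longleftrightarrow>
    pair_graph G \<and> \<not> colorable k G \<and>
    (\<forall>H :: 'a pair_pre_digraph.
      induced_subgraph (with_proj H) (with_proj G) \<and> H \<noteq> G \<longrightarrow> colorable k H)"

text \<open>The first two conjuncts unfold \<^const>\<open>digraph_iso\<close>, to name the isomorphism.\<close>

definition list_instance_iso :: "'a list_instance \<Rightarrow> 'b list_instance \<Rightarrow> bool" where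
  "list_instance_iso = (\<lambda>(G, L) (G', L').
    \<exists>h. pre_digraph.digraph_isomorphism (with_proj G) h \<and>
        with_proj G' = app_iso h (with_proj G) \<and>
        (\<forall>v\<in>pverts G. L' (iso_verts h v) = L v))"

definition graph_iso :: "'a pair_pre_digraph \<Rightarrow> 'b pair_pre_digraph \<Rightarrow> bool" where
  "graph_iso G H \<longleftrightarrow> digraph_iso (with_proj G) (with_proj H)"

definition finite_up_to :: "('x \<Rightarrow> 'x \<Rightarrow> bool) \<Rightarrow> 'x set \<Rightarrow> bool" where
  "finite_up_to R S \<longleftrightarrow> finite (S // {(x, y) \<in> S \<times> S. R x y})"

definition free_list_obstructions :: "nat \<Rightarrow> nat \<Rightarrow> nat \<Rightarrow> 'a list_instance set" where
  "free_list_obstructions k t l =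
    {(G, L). minimal_list_obstruction k (G, L) \<and> induced_free {path_graph t, cycle_graph l} G}"

text \<open>
  A path \<open>v\<^sub>1-\<dots>-v\<^sub>r\<close> is the list of its vertices, indexed from 0: the vertex \<open>v\<^sub>i\<close> is \<open>p ! (i - 1)\<close>.
  The predicate \<^const>\<open>vpath\<close> does not demand that the path be induced. Chords \<open>uv\<close> are given by the positions of \<open>u\<close> and \<open>v\<close> on the path.
\<close>

definition chord :: "'a pair_pre_digraph \<Rightarrow> 'a list \<Rightarrow> nat \<Rightarrow> nat \<Rightarrow> bool" where
  "chord G p i j \<longleftrightarrow>
    i < length p \<and> j < length p \<and> (p ! i, p ! j) \<in> parcs G \<and> j \<noteq> i + 1 \<and> i \<noteq> j + 1"

text \<open>
  The index \<open>i\<close> ranges over \<open>{1, \<dots>, r - 2}\<close> with vertices numbered from 1, which is \<open>i + 2 < r\<close>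
  with vertices numbered from 0.
\<close>

definition long_paths_have_chord_pair :: "'a pair_pre_digraph set \<Rightarrow> bool" where
  "long_paths_have_chord_pair \<C> \<longleftrightarrow>
    (\<exists>R. \<forall>G\<in>\<C>. \<forall>p. vpath p (with_proj G) \<and> length p \<ge> R \<longrightarrow>
      (\<exists>i j. i + 2 < length p \<and> j > i + 1 \<and> chord G p i j \<and> chord G p (i + 1) j))"

end

theory Submission
  imports Defs "HOL-Library.Ramsey"
begin

text \<open>
  Colour a vertex \<open>v\<close> of a minimal obstruction with a colour \<open>x\<close> of its list and delete \<open>x\<close> from
  the lists of its neighbours. The other vertices are then uncolourable, so they contain a minimal
  obstruction \<open>H\<^sub>x\<close> for the new lists, and \<open>H\<^sub>x\<close> has a vertex that lost \<open>x\<close>, as it would otherwise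
  be uncolourable for the old lists already. By minimality the whole obstruction consists of \<open>v\<close>
  and of the sets \<open>H\<^sub>x\<close>. Continuing in each \<open>H\<^sub>x\<close> at a vertex that lost \<open>x\<close>, one sees that the order
  of the obstruction is bounded in terms of \<open>k\<close> and of the length of the paths
  \<open>v\<^sub>1-\<dots>-v\<^sub>r\<close> with colours \<open>c\<^sub>1, \<dots>, c\<^sub>r\<close> that arise in this way (\<open>critical_card_le\<close>). Just before
  \<open>v\<^sub>j\<^sub>-\<^sub>1\<close> is coloured, the list of \<open>v\<^sub>j\<close> contains both \<open>c\<^sub>j\<^sub>-\<^sub>1\<close> and \<open>c\<^sub>j\<close>. Hence every chord \<open>v\<^sub>iv\<^sub>j\<close> with \<open>i < j - 1\<close>
  has \<open>c\<^sub>i \<noteq> c\<^sub>j\<^sub>-\<^sub>1\<close> and \<open>c\<^sub>i \<noteq> c\<^sub>j\<close>. If there are only three colours, this excludes two chords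
  \<open>v\<^sub>iv\<^sub>j\<close> and \<open>v\<^sub>i\<^sub>+\<^sub>1v\<^sub>j\<close> at once, which is the second claim of the theorem.

  For the first claim it remains to bound the length of such coloured paths in graphs with
  neither an induced \<open>P\<^sub>t\<close> nor an induced \<open>C\<^sub>l\<close>. If they were unbounded, there would be an infinite one by
  compactness (\<open>free_ray_exists\<close>), called a ray below. On a ray some vertex \<open>u\<close>, the hub, has
  infinitely many neighbours: otherwise jumping from each vertex to its last neighbour would give
  an infinite induced path (\<open>hub\<close>). By Ramsey's theorem there are infinitely many windows of a
  prescribed length around neighbours of \<open>u\<close> that all look alike and of which any two are joined
  to each other in the same way (\<open>blocks_exist\<close>). Whether this is possible is a finite question,
  about the edges inside a block, between two blocks, and between a block and \<open>u\<close>.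

  If induced 4-cycles are excluded, there are no edges at all between different blocks
  (\<open>cross_square_free\<close>), and two suitable paths from \<open>u\<close> into different blocks form the forbidden
  path. If triangles are excluded, a case distinction refutes every possible pattern. It is given as
  a search tree whose leaves name the forbidden subgraph that appears; a verified checker goes
  through the tree (\<open>check_sound\<close>). For four colours and \<open>P\<^sub>6\<close> the tree would be large, and it is
  only used to show that vertices of different blocks that lie close to a neighbour of \<open>u\<close> are not
  adjacent. Then \<open>u\<close> must be adjacent to every second vertex of a block, so the colour of \<open>u\<close> does
  not occur there, and arbitrarily long coloured paths with three colours remain. Those are
  excluded by the case of three colours and \<open>P\<^sub>7\<close>.
\<close>

section \<open>Coloured paths and compactness\<close>

text \<open>
  Vertices are the positions \<open>0, \<dots>, n - 1\<close> on the path. The last condition says that the vertex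
  \<open>j\<close> could also have received the colour of its predecessor, as far as the vertices before the
  predecessor are concerned.
\<close>

definition coloured_path :: "nat set \<Rightarrow> nat \<Rightarrow> (nat \<Rightarrow> nat \<Rightarrow> bool) \<Rightarrow> (nat \<Rightarrow> nat) \<Rightarrow> bool" where
  "coloured_path S n E c \<longleftrightarrow>
    (\<forall>i<n. c i \<in> S) \<and>
    (\<forall>i<n. \<forall>j<n. E i j \<longrightarrow> E j i \<and> c i \<noteq> c j) \<and>
    (\<forall>i. Suc i < n \<longrightarrow> E i (Suc i)) \<and>
    (\<forall>i j. Suc i < j \<and> j < n \<and> E i j \<longrightarrow> c i \<noteq> c (j - 1))"

text \<open>
  An induced copy of the graph \<open>H\<close> on \<open>{..<h}\<close> inside the graph \<open>E\<close> on \<open>{..<n}\<close>.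
\<close>

definition embeds :: "nat \<Rightarrow> (nat \<Rightarrow> nat \<Rightarrow> bool) \<Rightarrow> nat \<Rightarrow> (nat \<Rightarrow> nat \<Rightarrow> bool) \<Rightarrow> bool" where
  "embeds h H n E \<longleftrightarrow>
    (\<exists>f. inj_on f {..<h} \<and> f ` {..<h} \<subseteq> {..<n} \<and> (\<forall>i<h. \<forall>j<h. E (f i) (f j) \<longleftrightarrow> H i j))"

definition path_adj :: "nat \<Rightarrow> nat \<Rightarrow> bool" where
  "path_adj i j \<longleftrightarrow> j = i + 1 \<or> i = j + 1"

definition cycle_adj :: "nat \<Rightarrow> nat \<Rightarrow> nat \<Rightarrow> bool" where
  "cycle_adj l i j \<longleftrightarrow> j = (i + 1) mod l \<or> i = (j + 1) mod l"

definition free_path :: "nat set \<Rightarrow> nat \<Rightarrow> nat \<Rightarrow> nat \<Rightarrow> (nat \<Rightarrow> nat \<Rightarrow> bool) \<Rightarrow> (nat \<Rightarrow> nat) \<Rightarrow> bool" where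
  "free_path S t l n E c \<longleftrightarrow>
    coloured_path S n E c \<and> \<not> embeds t path_adj n E \<and> \<not> embeds l (cycle_adj l) n E"

definition free_ray :: "nat set \<Rightarrow> nat \<Rightarrow> nat \<Rightarrow> (nat \<Rightarrow> nat \<Rightarrow> bool) \<Rightarrow> (nat \<Rightarrow> nat) \<Rightarrow> bool" where
  "free_ray S t l E c \<longleftrightarrow> (\<forall>n. free_path S t l n E c)"

text \<open>
  The diagonal argument behind Koenig's lemma: a subsequence can be made constant in coordinate
  after coordinate, because each coordinate takes finitely many values.
\<close>

lemma diagonal_limit:
  fixes f :: "nat \<Rightarrow> nat \<Rightarrow> 'b"
  assumes fin: "\<And>j. finite (range (\<lambda>n. f n j))"
  shows "\<exists>g. \<forall>m. \<exists>n\<ge>m. \<forall>j<m. f n j = g j"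
proof -
  have refine: "\<exists>B\<subseteq>A. infinite B \<and> (\<exists>y. \<forall>n\<in>B. f n j = y)" if "infinite A" for A j
  proof -
    have "finite ((\<lambda>n. f n j) ` A)"
      using fin[of j] by (rule finite_subset[rotated]) auto
    from pigeonhole_infinite[OF that this] obtain a where "infinite {n \<in> A. f n j = f a j}"
      by blast
    then show ?thesis by (intro exI[of _ "{n \<in> A. f n j = f a j}"]) auto
  qed
  have "\<exists>B. infinite B \<and> B \<subseteq> A \<and> (\<exists>y. \<forall>n\<in>B. f n m = y)" if "infinite A" for A m
    using refine[OF that, of m] by metis
  from dependent_nat_choice[of "\<lambda>m A. infinite A"
      "\<lambda>m A B. B \<subseteq> A \<and> (\<exists>y. \<forall>n\<in>B. f n m = y)", OF exI[of infinite, OF infinite_UNIV_nat] this]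
  have "\<exists>A. \<forall>m. infinite (A m) \<and> (A (Suc m) \<subseteq> A m \<and> (\<exists>y. \<forall>n\<in>A (Suc m). f n m = y))" .
  then obtain A where A: "\<And>m. infinite (A m)" "\<And>m. A (Suc m) \<subseteq> A m"
    "\<And>m. \<exists>y. \<forall>n\<in>A (Suc m). f n m = y" by blast
  then obtain g where g: "\<And>m n. n \<in> A (Suc m) \<Longrightarrow> f n m = g m" by metis
  have mono: "A m \<subseteq> A j" if "j \<le> m" for j m
    using that A(2) lift_Suc_antimono_le[of A] by blast
  show ?thesis
  proof (rule exI[of _ g], rule allI)
    fix m
    obtain n where "n \<ge> m" "n \<in> A m"
      using A(1)[of m] unfolding infinite_nat_iff_unbounded_le by blast
    then show "\<exists>n\<ge>m. \<forall>j<m. f n j = g j"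
      using g mono by (meson Suc_leI subsetD)
  qed
qed

lemma embeds_mono: "embeds h H m E" if "embeds h H n E" "n \<le> m"
  using that unfolding embeds_def by (meson lessThan_subset_iff subset_trans)

lemma free_path_mono: "free_path S t l m E c" if "free_path S t l n E c" "m \<le> n"
  using that unfolding free_path_def coloured_path_def
  by (auto intro: embeds_mono) 

lemma free_path_cong:
  assumes "free_path S t l n E c" "\<And>i j. i < n \<Longrightarrow> j < n \<Longrightarrow> E' i j = E i j" "\<And>i. i < n \<Longrightarrow> c' i = c i"
  shows "free_path S t l n E' c'"
proof -
  have emb: "embeds h H n E' = embeds h H n E" for h H
    unfolding embeds_def by (intro ex_cong1) (auto simp: assms(2) image_subset_iff)
  have "coloured_path S n E' c'"
    using assms unfolding free_path_def coloured_path_def by (auto simp: Suc_lessD)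
  then show ?thesis using assms(1) emb unfolding free_path_def by simp
qed

text \<open>
  A coloured path of length \<open>n\<close> is recorded by giving, for each position, its colour and its set of
  earlier neighbours. These take finitely many values, so a limit exists, and each of its initial
  segments is an initial segment of one of the given paths.
\<close>

lemma free_ray_exists:
  assumes "finite S" and ex: "\<And>n. \<exists>E c. free_path S t l n E c"
  shows "\<exists>E c. free_ray S t l E c"
proof -
  obtain E c where Ec: "\<And>n. free_path S t l n (E n) (c n)" using ex by metis
  define f where "f n j = (if j < n then Some (c n j, {i. i < j \<and> E n i j}) else None)" for n j
  have "finite (range (\<lambda>n. f n j))" for j
  proof (rule finite_subset)
    show "range (\<lambda>n. f n j) \<subseteq> insert None (Some ` (S \<times> Pow {..<j}))"
      using Ec unfolding f_def free_path_def coloured_path_def by auto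
    show "finite (insert None (Some ` (S \<times> Pow {..<j})))" using assms(1) by simp
  qed
  then obtain g where g: "\<And>m. \<exists>n\<ge>m. \<forall>j<m. f n j = g j"
    using diagonal_limit[of f] by blast
  define c' where "c' j = fst (the (g j))" for j
  define E' where "E' i j = (i \<in> snd (the (g j)) \<or> j \<in> snd (the (g i)))" for i j
  have "free_path S t l m E' c'" for m
  proof -
    obtain n where n: "n \<ge> m" "\<And>j. j < m \<Longrightarrow> f n j = g j" using g by blast
    have gj: "g j = Some (c n j, {i. i < j \<and> E n i j})" if "j < m" for j
      using n that unfolding f_def by (metis order_less_le_trans)
    have Em: "free_path S t l m (E n) (c n)" using Ec n(1) free_path_mono by blast
    show ?thesis
    proof (rule free_path_cong[OF Em])
      fix i j assume ij: "i < m" "j < m"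
      have "E n i j \<longleftrightarrow> E n j i" "\<not> E n i i"
        using Em ij unfolding free_path_def coloured_path_def by blast+
      then show "E' i j = E n i j"
        using gj[OF ij(1)] gj[OF ij(2)] unfolding E'_def
        by (cases i j rule: linorder_cases) auto
    next
      fix i assume "i < m" then show "c' i = c n i" using gj unfolding c'_def by simp
    qed
  qed
  then show ?thesis unfolding free_ray_def by blast
qed

lemma free_path_bound:
  assumes "finite S" and no: "\<And>E c. \<not> free_ray S t l E c"
  shows "\<exists>R. \<forall>n E c. free_path S t l n E c \<longrightarrow> n < R"
  using free_ray_exists[OF assms(1), of t l] free_path_mono no by (meson not_less)

section \<open>Infinite coloured paths\<close>

locale ray =
  fixes S :: "nat set" and t l :: nat and E :: "nat \<Rightarrow> nat \<Rightarrow> bool" and c :: "nat \<Rightarrow> nat"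
  assumes free: "free_ray S t l E c" and fin: "finite S"
begin

lemma colour: "c i \<in> S"
  using free unfolding free_ray_def free_path_def coloured_path_def by blast

lemma sym: "E i j \<Longrightarrow> E j i"
  using free[unfolded free_ray_def free_path_def coloured_path_def, rule_format, of "Suc (max i j)"]
  by (simp add: less_Suc_eq_le)

lemma sym_iff: "E i j \<longleftrightarrow> E j i" using sym by blast

lemma proper: "E i j \<Longrightarrow> c i \<noteq> c j"
  using free[unfolded free_ray_def free_path_def coloured_path_def, rule_format, of "Suc (max i j)"]
  by (simp add: less_Suc_eq_le)

lemma irrefl [simp]: "\<not> E i i" using proper by blast

lemma step [simp]: "E i (Suc i)"
  using free[unfolded free_ray_def free_path_def coloured_path_def, rule_format, of "Suc (Suc i)"] by simp

lemma chord: "E i j \<Longrightarrow> Suc i < j \<Longrightarrow> c i \<noteq> c (j - 1)"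
  using free[unfolded free_ray_def free_path_def coloured_path_def, rule_format, of "Suc j"] by simp

lemma no_embedding:
  assumes "inj_on f {..<h}" "\<And>i j. i < h \<Longrightarrow> j < h \<Longrightarrow> E (f i) (f j) \<longleftrightarrow> H i j"
    "h = t \<and> H = path_adj \<or> h = l \<and> H = cycle_adj l"
  shows False
proof -
  obtain n where "f ` {..<h} \<subseteq> {..<n}"
    by (meson bounded_nat_set_is_finite finite_imageI finite_lessThan finite_nat_iff_bounded)
  then have "embeds h H n E" using assms(1,2) unfolding embeds_def by blast
  then show False using free assms(3) unfolding free_ray_def free_path_def by blast
qed

text \<open>
  If every vertex had finitely many neighbours, then jumping from each vertex to its last neighbour
  would trace an infinite induced path.
\<close>

lemma hub: "\<exists>u. infinite {n. E u n}"
proof (rule ccontr)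
  assume "\<not> ?thesis"
  then have finN: "finite {n. E u n}" for u by blast
  define p where "p = rec_nat 0 (\<lambda>_ x. Max {n. E x n})"
  have p: "p (Suc i) = Max {n. E (p i) n}" for i by (simp add: p_def)
  have le: "n \<le> p (Suc i)" if "E (p i) n" for n i using that finN p by simp
  have adj: "E (p i) (p (Suc i))" for i
    using Max_in[OF finN, of "p i"] step[of "p i"] unfolding p by blast
  have less: "p i < p (Suc i)" for i using le[OF step] by (simp add: Suc_le_eq)
  then have smono: "strict_mono p" by (simp add: strict_mono_Suc_iff)
  have far: "\<not> E (p i) (p j)" if "Suc i < j" for i j
    using le[of i "p j"] strict_monoD[OF smono that] by linarith
  show False
  proof (rule no_embedding[of p t path_adj])
    show "inj_on p {..<t}" using smono strict_mono_imp_inj_on inj_on_subset by blast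
    show "E (p i) (p j) \<longleftrightarrow> path_adj i j" for i j
      unfolding path_adj_def
      by (cases i j rule: linorder_cases) (metis Suc_eq_plus1 Suc_lessI adj far sym irrefl less_irrefl less_Suc_eq not_less_eq)+
  qed simp
qed

fun ind_path :: "nat list \<Rightarrow> bool" where
  "ind_path [] = True"
| "ind_path [p] = True"
| "ind_path (p # q # ps) \<longleftrightarrow> E p q \<and> p \<noteq> q \<and> (\<forall>x\<in>set ps. p \<noteq> x \<and> \<not> E p x) \<and> ind_path (q # ps)"

lemma ind_path_nth:
  assumes "ind_path ps" "i < j" "j < length ps"
  shows "ps ! i \<noteq> ps ! j \<and> (E (ps ! i) (ps ! j) \<longleftrightarrow> j = Suc i)"
  using assms
proof (induction ps arbitrary: i j rule: ind_path.induct)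
  case (3 p q ps)
  show ?case
  proof (cases i)
    case 0
    then show ?thesis using 3 by (cases "j = 1") (auto simp: nth_Cons' split: if_splits)
  next
    case (Suc i')
    then show ?thesis using 3(1)[of i' "j - 1"] 3(2-) by (cases j) auto
  qed
qed auto

lemma no_ind_path:
  assumes "ind_path ps" "length ps \<ge> t"
  shows False
proof (rule no_embedding[of "\<lambda>i. ps ! i" t path_adj])
  show "inj_on ((!) ps) {..<t}"
    using assms(2) ind_path_nth[OF assms(1)] by (intro linorder_inj_onI') fastforce
  fix i j assume ij: "i < t" "j < t"
  show "E (ps ! i) (ps ! j) \<longleftrightarrow> path_adj i j"
  proof (cases i j rule: linorder_cases)
    case less
    then show ?thesis using ind_path_nth[OF assms(1), of i j] ij assms(2) by (auto simp: path_adj_def)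
  next
    case equal
    then show ?thesis by (simp add: path_adj_def)
  next
    case greater
    then have "E (ps ! j) (ps ! i) \<longleftrightarrow> i = Suc j"
      using ind_path_nth[OF assms(1), of j i] ij assms(2) by simp
    then show ?thesis using greater sym by (auto simp: path_adj_def)
  qed
qed simp

lemma no_triangle:
  assumes "l = 3" "E p q" "E q r" "E p r"
  shows False
proof (rule no_embedding[of "\<lambda>i. [p, q, r] ! i" 3 "cycle_adj 3"])
  have ne: "p \<noteq> q" "q \<noteq> r" "p \<noteq> r" using assms by auto
  then show "inj_on ((!) [p, q, r]) {..<3}"
    by (auto simp: inj_on_def numeral_3_eq_3 less_Suc_eq)
  fix i j :: nat assume "i < 3" "j < 3"
  then have "i = 0 \<or> i = 1 \<or> i = 2" "j = 0 \<or> j = 1 \<or> j = 2" by linarith+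
  then show "E ([p, q, r] ! i) ([p, q, r] ! j) \<longleftrightarrow> cycle_adj 3 i j"
    using assms(2-4) assms(2-4)[THEN sym]
    by (elim disjE) (simp_all add: cycle_adj_def)
qed (simp add: assms)

lemma no_square:
  assumes "l = 4" "E p q" "E q r" "E r s" "E s p" "\<not> E p r" "\<not> E q s" "p \<noteq> r" "q \<noteq> s"
  shows False
proof (rule no_embedding[of "\<lambda>i. [p, q, r, s] ! i" 4 "cycle_adj 4"])
  have ne: "p \<noteq> q" "q \<noteq> r" "r \<noteq> s" "s \<noteq> p" using assms by auto
  have nsym: "\<not> E r p" "\<not> E s q" using assms(6,7) sym by blast+
  show "inj_on ((!) [p, q, r, s]) {..<4}"
    using ne assms(8,9) by (auto simp: inj_on_def eval_nat_numeral less_Suc_eq)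
  fix i j :: nat assume "i < 4" "j < 4"
  then have "i = 0 \<or> i = 1 \<or> i = 2 \<or> i = 3" "j = 0 \<or> j = 1 \<or> j = 2 \<or> j = 3" by linarith+
  then show "E ([p, q, r, s] ! i) ([p, q, r, s] ! j) \<longleftrightarrow> cycle_adj 4 i j"
    using assms(2-7) assms(2-5)[THEN sym] nsym
    by (elim disjE) (simp_all add: cycle_adj_def)
qed (simp add: assms)

text \<open>
  The block \<open>i\<close> is the window of length \<open>w\<close> that starts at \<open>s i\<close>, and \<open>a\<close> is the level of its vertex
  \<open>s i + a\<close>. All blocks come after \<open>u\<close>, with a vertex in between, so that an edge from \<open>u\<close> into a block
  is a chord; the gaps between the blocks make the edges between them chords as well. Colours,
  edges inside a block and edges to \<open>u\<close> depend on the levels only, and so do the edges between two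
  blocks as soon as it is known which of the two comes first.
\<close>

definition blocks :: "nat \<Rightarrow> (nat \<Rightarrow> nat) \<Rightarrow> nat \<Rightarrow> bool" where
  "blocks u s w \<longleftrightarrow>
    (\<forall>i. Suc u < s i) \<and> (\<forall>i. s i + w < s (Suc i)) \<and>
    (\<forall>a<w. \<forall>i. c (s i + a) = c (s 0 + a) \<and> (E u (s i + a) \<longleftrightarrow> E u (s 0 + a))) \<and>
    (\<forall>a<w. \<forall>b<w. \<forall>i. E (s i + a) (s i + b) \<longleftrightarrow> E (s 0 + a) (s 0 + b)) \<and>
    (\<forall>a<w. \<forall>b<w. \<forall>i j. i < j \<longrightarrow> (E (s i + a) (s j + b) \<longleftrightarrow> E (s 0 + a) (s 1 + b)))"

text \<open>
  Ramsey's theorem for pairs, applied to the function \<open>F\<close> that records all edges and colours of two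
  windows.
\<close>

lemma blocks_exist:
  assumes "infinite X"
  shows "\<exists>s. blocks u s w \<and> range s \<subseteq> X"
proof -
  define Z where "Z = {x \<in> X. Suc u < x}"
  have "X \<subseteq> Z \<union> {..Suc u}" unfolding Z_def by auto
  then have infZ: "infinite Z" using assms finite_subset by blast
  define unary where "unary x =
    (map c [x..<x + w], {a. a < w \<and> E u (x + a)}, {(a, b). a < w \<and> b < w \<and> E (x + a) (x + b)})" for x
  define F where "F x y = (unary x, x + w < y, {(a, b). a < w \<and> b < w \<and> E (x + a) (y + b)})" for x y
  define T where "T = ({xs. set xs \<subseteq> S \<and> length xs = w} \<times> Pow {..<w} \<times> Pow ({..<w} \<times> {..<w}))
    \<times> (UNIV :: bool set) \<times> Pow ({..<w} \<times> {..<w})"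
  have "finite T" unfolding T_def by (intro finite_cartesian_product finite_lists_length_eq fin) auto
  then obtain h where h: "bij_betw h T {0..<card T}" using ex_bij_betw_finite_nat by blast
  have FT: "F x y \<in> T" for x y
    unfolding F_def T_def unary_def using colour by auto
  define g where "g P = h (F (Min P) (Max P))" for P
  have "\<forall>x\<in>Z. \<forall>y\<in>Z. x \<noteq> y \<longrightarrow> g {x, y} < card T"
    using h FT unfolding g_def bij_betw_def by fastforce
  from Ramsey2[OF infZ this] obtain Y v where Y: "Y \<subseteq> Z" "infinite Y"
    "\<forall>x\<in>Y. \<forall>y\<in>Y. x \<noteq> y \<longrightarrow> g {x, y} = v" by blast
  have F_eq: "F x y = F x' y'" if "x \<in> Y" "y \<in> Y" "x' \<in> Y" "y' \<in> Y" "x < y" "x' < y'" for x y x' y'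
  proof -
    have "g {x, y} = g {x', y'}" using Y(3) that by auto
    then have "h (F x y) = h (F x' y')" using that unfolding g_def by (simp add: min_absorb1 max_absorb2)
    then show ?thesis using h FT unfolding bij_betw_def inj_on_def by blast
  qed
  define s where "s = enumerate Y"
  have sY: "s i \<in> Y" for i unfolding s_def using enumerate_in_set[OF Y(2)] .
  have smono: "s i < s j" if "i < j" for i j unfolding s_def using enumerate_mono[OF that Y(2)] .
  have F: "F (s i) (s j) = F (s 0) (s 1)" if "i < j" for i j
    using F_eq sY smono that by simp
  have una: "unary (s i) = unary (s 0)" for i
    using F[of i "Suc i"] unfolding F_def by simp
  have col: "c (s i + a) = c (s 0 + a)" if "a < w" for i a
  proof -
    have "map c [s i..<s i + w] ! a = map c [s 0..<s 0 + w] ! a"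
      using una[of i] unfolding unary_def by (simp only: prod.inject)
    then show ?thesis using that by simp
  qed
  have "{a. a < w \<and> E u (s i + a)} = {a. a < w \<and> E u (s 0 + a)}"
    "{(a, b). a < w \<and> b < w \<and> E (s i + a) (s i + b)} = {(a, b). a < w \<and> b < w \<and> E (s 0 + a) (s 0 + b)}" for i
    using una[of i] unfolding unary_def by (simp_all only: prod.inject)
  then have una': "a < w \<and> E u (s i + a) \<longleftrightarrow> a < w \<and> E u (s 0 + a)"
    "a < w \<and> b < w \<and> E (s i + a) (s i + b) \<longleftrightarrow> a < w \<and> b < w \<and> E (s 0 + a) (s 0 + b)" for i a b
    by (blast dest: equalityD1 equalityD2)+
  have cross: "a < w \<and> b < w \<and> E (s i + a) (s j + b) \<longleftrightarrow> a < w \<and> b < w \<and> E (s 0 + a) (s 1 + b)"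
    if "i < j" for i j a b
  proof -
    have "{(a, b). a < w \<and> b < w \<and> E (s i + a) (s j + b)} = {(a, b). a < w \<and> b < w \<and> E (s 0 + a) (s 1 + b)}"
      using F[OF that] unfolding F_def by (simp only: prod.inject)
    then show ?thesis by blast
  qed
  \<comment> \<open>Whether two windows are far apart is part of \<open>F\<close>, and some pairs of \<open>Y\<close> are far apart.\<close>
  have gap: "s i + w < s (Suc i)" for i
  proof -
    obtain y where "y \<in> Y" "s i + w < y"
      using Y(2) unfolding infinite_nat_iff_unbounded by blast
    then have "F (s i) (s (Suc i)) = F (s i) y" using F_eq[of "s i" "s (Suc i)" "s i" y] sY smono by simp
    then show ?thesis using \<open>s i + w < y\<close> unfolding F_def by simp
  qed
  have "Suc u < s i" for i using sY[of i] Y(1) unfolding Z_def by blast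
  then have "blocks u s w"
    unfolding blocks_def using gap
  proof (intro conjI allI impI)
    fix a i assume a: "a < w"
    show "c (s i + a) = c (s 0 + a)" by (rule col[OF a])
    show "E u (s i + a) \<longleftrightarrow> E u (s 0 + a)" using una'(1)[where a = a and i = i] a by blast
    fix b assume b: "b < w"
    show "E (s i + a) (s i + b) \<longleftrightarrow> E (s 0 + a) (s 0 + b)"
      using una'(2)[where a = a and b = b and i = i] a b by blast
    fix j assume "i < j"
    from cross[OF this, where a = a and b = b]
    show "E (s i + a) (s j + b) \<longleftrightarrow> E (s 0 + a) (s 1 + b)" using a b by blast
  qed
  moreover have "range s \<subseteq> X" using sY Y(1) unfolding Z_def by blast
  ultimately show ?thesis by blast
qed

lemma
  assumes "blocks u s w"
  shows blocks_above: "Suc u < s i"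
    and blocks_gap: "s i + w < s (Suc i)"
    and blocks_colour: "a < w \<Longrightarrow> c (s i + a) = c (s 0 + a)"
    and blocks_spoke: "a < w \<Longrightarrow> E u (s i + a) \<longleftrightarrow> E u (s 0 + a)"
    and blocks_inner: "a < w \<Longrightarrow> b < w \<Longrightarrow> E (s i + a) (s i + b) \<longleftrightarrow> E (s 0 + a) (s 0 + b)"
    and blocks_cross: "a < w \<Longrightarrow> b < w \<Longrightarrow> i < j \<Longrightarrow>
      E (s i + a) (s j + b) \<longleftrightarrow> E (s 0 + a) (s 1 + b)"
proof -
  note b = assms[unfolded blocks_def]
  show "Suc u < s i" "s i + w < s (Suc i)" using b by blast+
  show "c (s i + a) = c (s 0 + a)" "E u (s i + a) \<longleftrightarrow> E u (s 0 + a)" if "a < w"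
    using b[THEN conjunct2, THEN conjunct2, THEN conjunct1] that by blast+
  show "E (s i + a) (s i + b) \<longleftrightarrow> E (s 0 + a) (s 0 + b)" if "a < w" "b < w"
    using b[THEN conjunct2, THEN conjunct2, THEN conjunct2, THEN conjunct1] that by blast
  show "E (s i + a) (s j + b) \<longleftrightarrow> E (s 0 + a) (s 1 + b)" if "a < w" "b < w" "i < j"
    using b[THEN conjunct2, THEN conjunct2, THEN conjunct2, THEN conjunct2] that by blast
qed

lemma blocks_separate:
  assumes "blocks u s w" "i < j"
  shows "s i + w < s j"
  using assms(2)
proof (induction j)
  case (Suc j)
  then show ?case using blocks_gap[OF assms(1), of j] by (cases "i = j") auto
qed simp

text \<open>
  Subwindows allow the same argument to be started at any other level that \<open>u\<close> is adjacent to.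
\<close>

lemma blocks_shift:
  assumes b: "blocks u s w" and dw: "d + w' \<le> w"
  shows "blocks u (\<lambda>i. s i + d) w'"
proof -
  have small: "d + a < w" if "a < w'" for a using that dw by simp
  show ?thesis
    unfolding blocks_def
  proof (intro conjI allI impI)
    show "Suc u < s i + d" for i using blocks_above[OF b, of i] by linarith
    show "s i + d + w' < s (Suc i) + d" for i using blocks_gap[OF b, of i] dw by linarith
    fix a i assume a: "a < w'"
    show "c (s i + d + a) = c (s 0 + d + a)"
      unfolding add.assoc by (rule blocks_colour[OF b small[OF a]])
    show "E u (s i + d + a) \<longleftrightarrow> E u (s 0 + d + a)"
      unfolding add.assoc by (rule blocks_spoke[OF b small[OF a]])
    fix a' assume a': "a' < w'"
    show "E (s i + d + a) (s i + d + a') \<longleftrightarrow> E (s 0 + d + a) (s 0 + d + a')"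
      unfolding add.assoc by (rule blocks_inner[OF b small[OF a] small[OF a']])
    fix j assume "i < j"
    then show "E (s i + d + a) (s j + d + a') \<longleftrightarrow> E (s 0 + d + a) (s 1 + d + a')"
      unfolding add.assoc by (rule blocks_cross[OF b small[OF a] small[OF a']])
  qed
qed

end

section \<open>Case distinctions in a homogeneous family of blocks\<close>

text \<open>
  The vertices and edges that matter for a family of blocks: \<open>Pt i a\<close> is the vertex on level \<open>a\<close> of
  block \<open>i\<close>. A link is a class of edges that are all present or all absent: from the hub to level
  \<open>a\<close>, between the levels \<open>a\<close> and \<open>b\<close> of a block, or from level \<open>a\<close> of a block to level \<open>b\<close> of a later
  block.
  
  A certificate is a search tree for a contradiction. It branches over whether a link is present,
  or over the colour of a level, and each leaf names an induced path, a triangle, or an edge that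
  contradicts the colours.
\<close>

datatype vertex = Hub | Pt nat nat
datatype link = Spoke nat | Inner nat nat | Cross nat nat
datatype cert =
  Split link cert cert
| Colour nat "cert list"
| Path "vertex list"
| Triangle vertex vertex vertex
| Clash vertex vertex

fun link_of :: "vertex \<Rightarrow> vertex \<Rightarrow> link option" where
  "link_of Hub Hub = None"
| "link_of Hub (Pt i a) = Some (Spoke a)"
| "link_of (Pt i a) Hub = Some (Spoke a)"
| "link_of (Pt i a) (Pt j b) = Some (if i = j then (if a \<le> b then Inner a b else Inner b a)
     else if i < j then Cross a b else Cross b a)"

text \<open>
  The list \<open>cs\<close> contains the colours of levels that are fixed so far. Two levels whose colours are
  not fixed can still be known to have the same colour when they are the same level.
\<close>

definition same_colour :: "(nat \<times> nat) list \<Rightarrow> nat \<Rightarrow> nat \<Rightarrow> bool" where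
  "same_colour cs a b \<longleftrightarrow> a = b \<or> (case map_of cs a of None \<Rightarrow> False | Some x \<Rightarrow> map_of cs b = Some x)"

text \<open>
  The links that a coloured path forbids because of the colours. The colour of the hub has the
  number 0. An edge from \<open>a\<close> to \<open>b\<close> that is a chord excludes the colours of \<open>b\<close> and of its predecessor
  \<open>b - 1\<close> for \<open>a\<close>.
\<close>

fun conflict :: "(nat \<times> nat) list \<Rightarrow> link \<Rightarrow> bool" where
  "conflict cs (Spoke a) \<longleftrightarrow> map_of cs a = Some 0 \<or> 0 < a \<and> map_of cs (a - 1) = Some 0"
| "conflict cs (Inner a b) \<longleftrightarrow> same_colour cs a b \<or> a + 1 < b \<and> same_colour cs a (b - 1)"
| "conflict cs (Cross a b) \<longleftrightarrow> same_colour cs a b \<or> 0 < b \<and> same_colour cs a (b - 1)"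

fun known_link :: "(link \<times> bool) list \<Rightarrow> link \<Rightarrow> bool" where
  "known_link ls (Inner a b) \<longleftrightarrow> b = a + 1 \<or> map_of ls (Inner a b) = Some True"
| "known_link ls e \<longleftrightarrow> map_of ls e = Some True"

definition joined :: "(link \<times> bool) list \<Rightarrow> vertex \<Rightarrow> vertex \<Rightarrow> bool" where
  "joined ls p q \<longleftrightarrow> (case link_of p q of None \<Rightarrow> False | Some e \<Rightarrow> known_link ls e)"

definition apart :: "(link \<times> bool) list \<Rightarrow> (nat \<times> nat) list \<Rightarrow> vertex \<Rightarrow> vertex \<Rightarrow> bool" where
  "apart ls cs p q \<longleftrightarrow> p \<noteq> q \<and>
    (case link_of p q of None \<Rightarrow> False | Some e \<Rightarrow> map_of ls e = Some False \<or> conflict cs e)"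

fun path_known :: "(link \<times> bool) list \<Rightarrow> (nat \<times> nat) list \<Rightarrow> vertex list \<Rightarrow> bool" where
  "path_known ls cs [] = True"
| "path_known ls cs [p] = True"
| "path_known ls cs (p # q # ps) \<longleftrightarrow> joined ls p q \<and> list_all (apart ls cs p) ps \<and> path_known ls cs (q # ps)"

fun in_window :: "nat \<Rightarrow> vertex \<Rightarrow> bool" where
  "in_window w Hub = True"
| "in_window w (Pt i a) \<longleftrightarrow> a < w"

fun check :: "nat \<Rightarrow> nat \<Rightarrow> nat \<Rightarrow> (link \<times> bool) list \<Rightarrow> (nat \<times> nat) list \<Rightarrow> cert \<Rightarrow> bool"
  and check_colours :: "nat \<Rightarrow> nat \<Rightarrow> nat \<Rightarrow> (link \<times> bool) list \<Rightarrow> (nat \<times> nat) list \<Rightarrow> nat \<Rightarrow> nat \<Rightarrow> cert list \<Rightarrow> bool" where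
  "check k t w ls cs (Split e x y) \<longleftrightarrow> check k t w ((e, True) # ls) cs x \<and> check k t w ((e, False) # ls) cs y"
| "check k t w ls cs (Colour a xs) \<longleftrightarrow> check_colours k t w ls cs a 0 xs"
| "check k t w ls cs (Path ps) \<longleftrightarrow> length ps = t \<and> list_all (in_window w) ps \<and> path_known ls cs ps"
| "check k t w ls cs (Triangle p q r) \<longleftrightarrow> list_all (in_window w) [p, q, r] \<and>
     joined ls p q \<and> joined ls q r \<and> joined ls p r"
| "check k t w ls cs (Clash p q) \<longleftrightarrow> in_window w p \<and> in_window w q \<and> joined ls p q \<and>
     (case link_of p q of None \<Rightarrow> False | Some e \<Rightarrow> conflict cs e)"
| "check_colours k t w ls cs a i [] \<longleftrightarrow> k \<le> i"
| "check_colours k t w ls cs a i (x # xs) \<longleftrightarrow> check k t w ls ((a, i) # cs) x \<and> check_colours k t w ls cs a (Suc i) xs"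

lemma check_colours_nth:
  assumes "check_colours k t w ls cs a i xs" "i \<le> j" "j < k"
  shows "\<exists>x\<in>set xs. check k t w ls ((a, j) # cs) x"
  using assms
proof (induction xs arbitrary: i)
  case (Cons x xs)
  then show ?case using Cons.IH[of "Suc i"] by (cases "i = j") auto
qed simp

text \<open>
  Certificates number the colours so that the hub and two consecutive levels get 0, 1 and 2, which
  saves most of the branching over colours.
\<close>

lemma colour_numbering:
  fixes x y z :: nat
  assumes "finite S" "card S \<le> k" "x \<in> S" "y \<in> S" "z \<in> S" "x \<noteq> y" "x \<noteq> z" "y \<noteq> z"
  shows "\<exists>\<rho>. \<rho> (0 :: nat) = x \<and> \<rho> 1 = y \<and> \<rho> 2 = z \<and> S \<subseteq> \<rho> ` {..<k}"
proof -
  have three: "card {x, y, z} = 3" using assms(6-8) by simp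
  have sub: "{x, y, z} \<subseteq> S" using assms(3-5) by blast
  have "3 \<le> card S" using card_mono[OF assms(1) sub] three by simp
  moreover have "card (S - {x, y, z}) = card S - 3"
    using card_Diff_subset[OF _ sub] three by simp
  ultimately have "3 \<le> card S" "card {3..<card S} = card (S - {x, y, z})" by simp_all
  then obtain f where f: "bij_betw f {3..<card S} (S - {x, y, z})"
    using finite_same_card_bij[OF finite_atLeastLessThan finite_Diff[OF assms(1)]] by metis
  define \<rho> where "\<rho> i = (if i = 0 then x else if i = 1 then y else if i = 2 then z else f i)" for i :: nat
  have \<rho>: "\<rho> 0 = x" "\<rho> 1 = y" "\<rho> 2 = z" "\<And>i. 3 \<le> i \<Longrightarrow> \<rho> i = f i" by (simp_all add: \<rho>_def)
  have "v \<in> \<rho> ` {..<k}" if "v \<in> S" for v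
  proof -
    have "\<exists>i<card S. v = \<rho> i"
    proof (cases "v \<in> {x, y, z}")
      case True
      then have "v = \<rho> 0 \<or> v = \<rho> 1 \<or> v = \<rho> 2" using \<rho>(1-3) by blast
      moreover have "0 < card S" "1 < card S" "2 < card S" using \<open>3 \<le> card S\<close> by simp_all
      ultimately show ?thesis by metis
    next
      case False
      then have "v \<in> f ` {3..<card S}" using bij_betw_imp_surj_on[OF f] that by simp
      then obtain i where "i \<in> {3..<card S}" "v = f i" by (rule imageE)
      then show ?thesis using \<rho>(4)[of i] by auto
    qed
    then show ?thesis using assms(2) by auto
  qed
  then show ?thesis using \<rho>(1-3) by (intro exI[of _ \<rho>] conjI subsetI)
qed

context ray begin

fun pos :: "nat \<Rightarrow> (nat \<Rightarrow> nat) \<Rightarrow> vertex \<Rightarrow> nat" where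
  "pos u s Hub = u"
| "pos u s (Pt i a) = s i + a"

fun holds :: "nat \<Rightarrow> (nat \<Rightarrow> nat) \<Rightarrow> link \<Rightarrow> bool" where
  "holds u s (Spoke a) \<longleftrightarrow> E u (s 0 + a)"
| "holds u s (Inner a b) \<longleftrightarrow> E (s 0 + a) (s 0 + b)"
| "holds u s (Cross a b) \<longleftrightarrow> E (s 0 + a) (s 1 + b)"

definition agrees ::
  "nat \<Rightarrow> (nat \<Rightarrow> nat) \<Rightarrow> (nat \<Rightarrow> nat) \<Rightarrow> (link \<times> bool) list \<Rightarrow> (nat \<times> nat) list \<Rightarrow> bool" where
  "agrees u s \<rho> ls cs \<longleftrightarrow>
    (\<forall>(e, v) \<in> set ls. holds u s e = v) \<and> (\<forall>(a, x) \<in> set cs. c (s 0 + a) = \<rho> x)"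

context
  fixes u s w \<rho>
  assumes blk: "blocks u s w" and hub0: "\<rho> (0 :: nat) = c u"
begin

lemma link_of_holds:
  assumes "in_window w p" "in_window w q" "link_of p q = Some e"
  shows "E (pos u s p) (pos u s q) \<longleftrightarrow> holds u s e"
proof (cases p; cases q)
  fix i a j b assume pq: "p = Pt i a" "q = Pt j b"
  then have ab: "a < w" "b < w" using assms by auto
  have cr: "E (s i + a) (s j + b) \<longleftrightarrow> E (s 0 + a) (s 1 + b)" if "i < j"
    using blocks_cross[OF blk ab that] .
  have cr': "E (s j + b) (s i + a) \<longleftrightarrow> E (s 0 + b) (s 1 + a)" if "j < i"
    using blocks_cross[OF blk ab(2,1) that] .
  have inn: "E (s i + a) (s i + b) \<longleftrightarrow> E (s 0 + a) (s 0 + b)" using blocks_inner[OF blk ab] .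
  show ?thesis
  proof (cases i j rule: linorder_cases)
    case less then show ?thesis using assms(3) pq cr by auto
  next
    case equal then show ?thesis using assms(3) pq inn sym[of "s 0 + a" "s 0 + b"] sym[of "s 0 + b" "s 0 + a"]
      by (auto split: if_splits)
  next
    case greater then show ?thesis using assms(3) pq cr' sym[of "s i + a" "s j + b"] sym[of "s j + b" "s i + a"]
      by auto
  qed
next
  fix i a assume "p = Hub" "q = Pt i a"
  then show ?thesis using assms blocks_spoke[OF blk, of a i] by auto
next
  fix i a assume "p = Pt i a" "q = Hub"
  then show ?thesis using assms blocks_spoke[OF blk, of a i] sym_iff[of "s i + a" u] by auto
qed (use assms in auto)

lemma
  assumes "agrees u s \<rho> ls cs"
  shows agrees_link: "map_of ls e = Some v \<Longrightarrow> holds u s e = v"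
    and agrees_colour: "map_of cs a = Some x \<Longrightarrow> c (s 0 + a) = \<rho> x"
  using assms unfolding agrees_def by (blast dest: map_of_SomeD)+

lemma same_colour_sound:
  assumes "agrees u s \<rho> ls cs" "same_colour cs a b"
  shows "c (s 0 + a) = c (s 0 + b)"
proof (cases "a = b")
  case False
  then obtain x where "map_of cs a = Some x" "map_of cs b = Some x"
    using assms(2) unfolding same_colour_def by (auto split: option.splits)
  then show ?thesis using agrees_colour[OF assms(1)] by metis
qed simp

lemma conflict_sound:
  assumes ag: "agrees u s \<rho> ls cs" and con: "conflict cs e" and le: "link_of p q = Some e"
    and win: "in_window w p" "in_window w q"
  shows "\<not> holds u s e"
proof
  assume h: "holds u s e"
  show False
  proof (cases e)
    case (Spoke a)
    then have E: "E u (s 0 + a)" using h by simp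
    have "Suc u < s 0" using blocks_above[OF blk] .
    then have "c u \<noteq> c (s 0 + a)" "c u \<noteq> c (s 0 + a - 1)" using proper[OF E] chord[OF E] by auto
    moreover have "map_of cs a = Some 0 \<or> 0 < a \<and> map_of cs (a - 1) = Some 0"
      using con unfolding Spoke by simp
    ultimately show False
      using agrees_colour[OF ag, of a 0] agrees_colour[OF ag, of "a - 1" 0] hub0 by auto
  next
    case (Inner a b)
    then have E: "E (s 0 + a) (s 0 + b)" using h by simp
    have "c (s 0 + a) \<noteq> c (s 0 + b)" using proper[OF E] .
    moreover have "c (s 0 + a) \<noteq> c (s 0 + (b - 1))" if "a + 1 < b"
      using chord[OF E] that by simp
    ultimately show False
      using con same_colour_sound[OF ag, of a b] same_colour_sound[OF ag, of a "b - 1"]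
      unfolding Inner by auto
  next
    case (Cross a b)
    then have E: "E (s 0 + a) (s 1 + b)" using h by simp
    have "b < w" using le win unfolding Cross by (cases p; cases q) (auto split: if_splits)
    then have cb: "c (s 1 + b) = c (s 0 + b)" "c (s 1 + (b - 1)) = c (s 0 + (b - 1))"
      using blocks_colour[OF blk] by (meson less_imp_diff_less)+
    have "a < w" using le win unfolding Cross by (cases p; cases q) (auto split: if_splits)
    then have "Suc (s 0 + a) < s 1 + b" using blocks_gap[OF blk, of 0] by simp
    then have "c (s 0 + a) \<noteq> c (s 0 + b)" "0 < b \<Longrightarrow> c (s 0 + a) \<noteq> c (s 0 + (b - 1))"
      using proper[OF E] chord[OF E] cb by (simp_all add: Suc_le_eq)
    then show False
      using con same_colour_sound[OF ag, of a b] same_colour_sound[OF ag, of a "b - 1"]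
      unfolding Cross by auto
  qed
qed

lemma joined_sound:
  assumes "agrees u s \<rho> ls cs" "joined ls p q" "in_window w p" "in_window w q"
  shows "E (pos u s p) (pos u s q)"
proof -
  obtain e where e: "link_of p q = Some e" "known_link ls e"
    using assms(2) unfolding joined_def by (auto split: option.splits)
  have "holds u s e"
    using e(2) agrees_link[OF assms(1), of e True] by (cases e) auto
  then show ?thesis using link_of_holds[OF assms(3,4) e(1)] by simp
qed

lemma pos_inj:
  assumes "in_window w p" "in_window w q" "p \<noteq> q"
  shows "pos u s p \<noteq> pos u s q"
proof (cases p; cases q)
  fix i a j b assume pq: "p = Pt i a" "q = Pt j b"
  then show ?thesis using assms blocks_separate[OF blk, of i j] blocks_separate[OF blk, of j i]
    by (cases i j rule: linorder_cases) auto
next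
  fix i a assume "p = Hub" "q = Pt i a" then show ?thesis using blocks_above[OF blk, of i] by simp
next
  fix i a assume "p = Pt i a" "q = Hub" then show ?thesis using blocks_above[OF blk, of i] by simp
qed (use assms in auto)

lemma apart_sound:
  assumes "agrees u s \<rho> ls cs" "apart ls cs p q" "in_window w p" "in_window w q"
  shows "pos u s p \<noteq> pos u s q" "\<not> E (pos u s p) (pos u s q)"
proof -
  show "pos u s p \<noteq> pos u s q" using pos_inj assms unfolding apart_def by blast
  obtain e where e: "link_of p q = Some e" "map_of ls e = Some False \<or> conflict cs e"
    using assms(2) unfolding apart_def by (auto split: option.splits)
  have "\<not> holds u s e"
    using e(2) conflict_sound[OF assms(1) _ e(1) assms(3,4)] agrees_link[OF assms(1), of e False]
    by blast
  then show "\<not> E (pos u s p) (pos u s q)" using link_of_holds[OF assms(3,4) e(1)] by simp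
qed

lemma path_known_sound:
  assumes "agrees u s \<rho> ls cs" "path_known ls cs ps" "list_all (in_window w) ps"
  shows "ind_path (map (pos u s) ps)"
  using assms(2,3)
proof (induction ps rule: induct_list012)
  case (3 p q ps)
  then show ?case using joined_sound[OF assms(1), of p q] apart_sound[OF assms(1)]
    by (auto simp: list_all_iff)
qed auto

text \<open>
  At each node of the certificate one child agrees with the family of blocks, so that the family
  leads to some leaf, where it would contain a subgraph that the ray lacks.
\<close>

lemma check_sound:
  assumes "l = 3" "S \<subseteq> \<rho> ` {..<k}"
  shows "check k t w ls cs x \<Longrightarrow> agrees u s \<rho> ls cs \<Longrightarrow> False"
proof (induction x arbitrary: ls cs)
  case (Split e x y)
  show ?case
  proof (cases "holds u s e")
    case True
    then have "agrees u s \<rho> ((e, True) # ls) cs" using Split.prems(2) unfolding agrees_def by simp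
    then show ?thesis using Split.IH(1)[of "(e, True) # ls" cs] Split.prems(1) by simp
  next
    case False
    then have "agrees u s \<rho> ((e, False) # ls) cs" using Split.prems(2) unfolding agrees_def by simp
    then show ?thesis using Split.IH(2)[of "(e, False) # ls" cs] Split.prems(1) by simp
  qed
next
  case (Colour a xs)
  obtain i where i: "i < k" "c (s 0 + a) = \<rho> i" using assms(2) colour[of "s 0 + a"] by blast
  then obtain x where "x \<in> set xs" "check k t w ls ((a, i) # cs) x"
    using check_colours_nth[of k t w ls cs a 0 xs i] Colour.prems(1) by auto
  moreover have "agrees u s \<rho> ls ((a, i) # cs)" using Colour.prems(2) i(2) unfolding agrees_def by simp
  ultimately show ?case using Colour.IH by blast
next
  case (Path ps)
  then have "ind_path (map (pos u s) ps)" "length (map (pos u s) ps) = t"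
    using path_known_sound by auto
  then show ?case using no_ind_path by blast
next
  case (Triangle p q r)
  then have w: "in_window w p" "in_window w q" "in_window w r"
    and jo: "joined ls p q" "joined ls q r" "joined ls p r" by auto
  show ?case
    using no_triangle[OF assms(1) joined_sound[OF Triangle.prems(2) jo(1) w(1,2)]
      joined_sound[OF Triangle.prems(2) jo(2) w(2,3)] joined_sound[OF Triangle.prems(2) jo(3) w(1,3)]] .
next
  case (Clash p q)
  then obtain e where e: "link_of p q = Some e" "conflict cs e" and w: "in_window w p" "in_window w q"
    and jo: "joined ls p q" by (auto split: option.splits)
  show ?case
    using conflict_sound[OF Clash.prems(2) e(2,1) w] joined_sound[OF Clash.prems(2) jo w]
      link_of_holds[OF w e(1)] by blast
qed

end

text \<open>
  The hub \<open>u\<close>, its neighbour on level \<open>b\<close> and the predecessor of that neighbour have three different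
  colours, so they can be numbered 0, 1 and 2.
\<close>

lemma refuted:
  assumes "l = 3" and blk: "blocks u s w" and b: "E u (s 0 + b)" "b = Suc b'" and S: "card S \<le> k"
    and ls: "\<forall>(e, v) \<in> set ls. holds u s e = v"
    and chk: "check k t w ((Spoke b, True) # ls) [(b, 1), (b', 2)] x"
  shows False
proof -
  have "Suc u < s 0" using blocks_above[OF blk] .
  then have "c u \<noteq> c (s 0 + b)" "c u \<noteq> c (s 0 + b')"
    using proper[OF b(1)] chord[OF b(1)] b(2) by auto
  moreover have "c (s 0 + b) \<noteq> c (s 0 + b')"
    using proper[OF step[of "s 0 + b'"]] b(2) by simp
  ultimately obtain \<rho> where r: "\<rho> 0 = c u" "\<rho> 1 = c (s 0 + b)" "\<rho> 2 = c (s 0 + b')"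
    and S\<rho>: "S \<subseteq> \<rho> ` {..<k}"
    using colour_numbering[OF fin S colour[of u] colour[of "s 0 + b"] colour[of "s 0 + b'"]] by blast
  have "agrees u s \<rho> ((Spoke b, True) # ls) [(b, 1), (b', 2)]"
    unfolding agrees_def using ls r b by simp
  then show False using check_sound[of u s w \<rho>, OF blk r(1) assms(1) S\<rho> chk] by blast
qed

end

section \<open>The case distinctions for triangle-free rays\<close>

text \<open>
  The trees come from a computer search over the patterns on a window around a neighbour of the hub,
  which is extended by a level to the left or to the right, whichever leaves fewer patterns. They
  contain only the branchings that a leaf below depends on. The neighbour of the hub is on level 1
  of 3 for \<open>P\<^sub>5\<close>, on level 2 of 6 for \<open>P\<^sub>6\<close>, and on level 7 of 13 for \<open>P\<^sub>7\<close>, counted from 0.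
\<close>

definition cert_5_3 :: cert where
  "cert_5_3 =
     Split (Spoke 0) (Triangle Hub (Pt 1 0) (Pt 1 1)) (Split (Cross 1 0) (Split (Spoke 2) (Triangle Hub
     (Pt 1 2) (Pt 1 1)) (Split (Inner 0 2) (Triangle (Pt 1 0) (Pt 1 2) (Pt 1 1)) (Split (Cross 2 1) (Path
     [Pt 2 1, Pt 1 2, Pt 1 1, Pt 1 0, Pt 0 1]) (Path [Pt 0 2, Pt 0 1, Hub, Pt 1 1, Pt 1 2])))) (Path
     [Pt 0 0, Pt 0 1, Hub, Pt 1 1, Pt 1 0]))"

lemma check_5_3: "check 5 5 3 [(Spoke 1, True)] [(1, 1), (0, 2)] cert_5_3"
  by code_simp

text \<open>
  For \<open>P\<^sub>6\<close> and a neighbour of the hub on level 2, the trees exclude in turn the four kinds of edges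
  between the levels 2, 3 and 4 of different blocks that the colours alone permit; each tree may
  use that the earlier kinds are absent.
\<close>

definition cert_6_3_1 :: cert where
  "cert_6_3_1 =
     Split (Spoke 1) (Triangle Hub (Pt 1 1) (Pt 1 2)) (Split (Spoke 3) (Triangle Hub (Pt 1 3) (Pt 1 2))
     (Split (Inner 1 3) (Triangle (Pt 1 1) (Pt 1 3) (Pt 1 2)) (Split (Cross 1 3) (Path
     [Pt 1 2, Hub, Pt 2 2, Pt 2 3, Pt 0 1, Pt 3 3]) (Split (Inner 2 4) (Triangle (Pt 1 2) (Pt 1 4)
     (Pt 1 3)) (Split (Cross 4 2) (Triangle (Pt 1 4) (Pt 2 2) (Pt 1 3)) (Split (Cross 2 4) (Path
     [Pt 2 3, Pt 3 2, Pt 1 3, Pt 1 2, Pt 3 4, Pt 0 2]) (Split (Cross 1 4) (Path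
     [Pt 0 3, Pt 3 2, Pt 1 3, Pt 1 4, Pt 0 1, Pt 2 4]) (Path
     [Pt 1 4, Pt 1 3, Pt 1 2, Pt 0 3, Pt 0 2, Pt 0 1]))))))))"

definition cert_6_3_2 :: cert where
  "cert_6_3_2 =
     Split (Spoke 1) (Triangle Hub (Pt 1 1) (Pt 1 2)) (Colour 3 [ Split (Cross 4 2) (Triangle (Pt 1 4)
     (Pt 2 2) (Pt 2 3)) (Path [Pt 2 2, Hub, Pt 1 2, Pt 1 3, Pt 0 4, Pt 0 3]), Clash (Pt 0 2) (Pt 0 3),
     Split (Inner 2 4) (Triangle (Pt 1 2) (Pt 1 4) (Pt 1 3)) (Split (Cross 4 2) (Triangle (Pt 1 4)
     (Pt 2 2) (Pt 2 3)) (Path [Pt 1 2, Pt 1 3, Pt 0 4, Pt 0 3, Pt 0 2, Pt 0 1])), Split (Spoke 3)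
     (Triangle Hub (Pt 1 3) (Pt 1 2)) (Split (Inner 1 3) (Triangle (Pt 1 1) (Pt 1 3) (Pt 1 2)) (Split
     (Cross 1 3) (Path [Pt 1 3, Pt 0 1, Pt 2 3, Pt 2 2, Hub, Pt 3 2]) (Colour 4 [ Split (Cross 4 2)
     (Triangle (Pt 1 4) (Pt 2 2) (Pt 2 3)) (Path [Pt 2 2, Hub, Pt 1 2, Pt 1 3, Pt 0 4, Pt 0 3]), Clash
     (Pt 0 4) (Pt 1 3), Path [Pt 2 2, Pt 2 3, Pt 0 4, Pt 1 3, Pt 1 2, Pt 1 1], Clash (Pt 0 3) (Pt 0 4)
     ]))) ])"

definition cert_6_3_3 :: cert where
  "cert_6_3_3 =
     Split (Spoke 1) (Triangle Hub (Pt 1 1) (Pt 1 2)) (Split (Cross 2 1) (Split (Spoke 3) (Triangle Hub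
     (Pt 1 3) (Pt 1 2)) (Split (Cross 1 3) (Path [Pt 1 3, Pt 0 1, Pt 2 3, Pt 2 2, Hub, Pt 3 2]) (Split
     (Inner 2 4) (Triangle (Pt 1 2) (Pt 1 4) (Pt 1 3)) (Split (Inner 1 4) (Triangle (Pt 1 1) (Pt 1 4)
     (Pt 0 2)) (Split (Cross 4 2) (Path [Pt 2 3, Pt 2 2, Pt 1 4, Pt 0 2, Pt 1 1, Pt 1 2]) (Path
     [Pt 1 3, Pt 1 4, Pt 0 2, Pt 3 4, Pt 2 2, Pt 2 3])))))) (Colour 3 [ Split (Inner 1 3) (Triangle
     (Pt 1 1) (Pt 1 3) (Pt 1 2)) (Split (Cross 1 3) (Path [Pt 1 3, Pt 0 1, Pt 2 3, Pt 2 2, Hub, Pt 3 2])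
     (Split (Cross 3 1) (Path [Pt 3 2, Hub, Pt 2 2, Pt 2 1, Pt 0 3, Pt 1 1]) (Colour 4 [ Clash (Pt 0 3)
     (Pt 0 4), Clash (Pt 0 2) (Pt 1 4), Path [Pt 1 3, Pt 1 4, Pt 0 2, Pt 3 4, Pt 2 2, Pt 2 3], Split
     (Inner 2 4) (Triangle (Pt 1 2) (Pt 1 4) (Pt 1 3)) (Split (Cross 1 4) (Triangle (Pt 1 1) (Pt 2 4)
     (Pt 1 2)) (Split (Cross 4 2) (Split (Cross 4 1) (Triangle (Pt 1 4) (Pt 2 1) (Pt 2 2)) (Split
     (Inner 1 4) (Colour 0 [ Split (Inner 0 2) (Triangle (Pt 1 0) (Pt 1 2) (Pt 1 1)) (Split (Cross 2 0)
     (Path [Pt 0 3, Pt 0 2, Pt 1 0, Pt 1 1, Pt 1 2, Pt 1 3]) (Path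
     [Pt 1 0, Pt 1 1, Pt 1 4, Pt 0 2, Pt 2 4, Pt 2 3])), Split (Inner 0 4) (Triangle (Pt 1 0) (Pt 1 4)
     (Pt 1 1)) (Split (Cross 4 0) (Path [Pt 2 3, Pt 2 4, Pt 0 2, Pt 1 4, Pt 2 0, Pt 0 4]) (Path
     [Pt 1 0, Pt 1 1, Pt 1 2, Pt 0 4, Pt 2 2, Pt 2 1])), Clash (Pt 0 0) (Pt 0 1), Split (Inner 0 2)
     (Triangle (Pt 1 0) (Pt 1 2) (Pt 1 1)) (Split (Cross 2 0) (Split (Cross 0 2) (Colour 5 [ Split
     (Cross 2 5) (Triangle (Pt 1 2) (Pt 2 5) (Pt 2 4)) (Split (Inner 2 5) (Path
     [Pt 2 5, Pt 2 2, Pt 0 4, Pt 1 2, Pt 2 0, Pt 0 2]) (Path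
     [Pt 0 5, Pt 0 4, Pt 0 3, Pt 0 2, Pt 1 4, Pt 1 3])), Path
     [Pt 2 5, Pt 2 4, Pt 0 2, Pt 1 4, Pt 2 2, Pt 0 4], Split (Inner 2 5) (Path
     [Pt 0 5, Pt 0 2, Pt 0 1, Pt 0 0, Pt 1 2, Pt 1 1]) (Path
     [Pt 1 5, Pt 1 4, Pt 1 1, Pt 1 2, Pt 0 4, Pt 0 1]), Clash (Pt 0 4) (Pt 0 5) ]) (Path
     [Pt 0 0, Pt 0 1, Pt 0 4, Pt 2 2, Pt 1 4, Pt 1 1])) (Path
     [Pt 1 0, Pt 1 1, Pt 1 4, Pt 0 2, Pt 2 4, Pt 2 1])) ]) (Path
     [Pt 1 1, Pt 1 2, Pt 1 3, Pt 1 4, Pt 0 2, Pt 0 3]))) (Path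
     [Pt 1 3, Pt 1 4, Pt 0 2, Pt 3 4, Pt 2 2, Pt 2 3]))) ]))), Clash (Pt 0 2) (Pt 0 3), Split (Inner 2 4)
     (Triangle (Pt 1 2) (Pt 1 4) (Pt 1 3)) (Path [Pt 1 1, Pt 1 2, Pt 1 3, Pt 1 4, Pt 0 2, Pt 0 1]), Split
     (Spoke 3) (Triangle Hub (Pt 1 3) (Pt 1 2)) (Split (Inner 1 3) (Triangle (Pt 1 1) (Pt 1 3) (Pt 1 2))
     (Split (Cross 1 3) (Path [Pt 1 3, Pt 0 1, Pt 2 3, Pt 2 2, Hub, Pt 3 2]) (Split (Cross 3 1) (Path
     [Pt 3 2, Hub, Pt 2 2, Pt 2 1, Pt 0 3, Pt 1 1]) (Colour 4 [ Split (Inner 2 4) (Triangle (Pt 1 2)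
     (Pt 1 4) (Pt 1 3)) (Split (Cross 1 4) (Triangle (Pt 1 1) (Pt 2 4) (Pt 1 2)) (Split (Cross 4 2)
     (Split (Cross 4 1) (Triangle (Pt 1 4) (Pt 2 1) (Pt 2 2)) (Split (Inner 1 4) (Colour 0 [ Split
     (Inner 0 2) (Triangle (Pt 1 0) (Pt 1 2) (Pt 1 1)) (Split (Cross 2 0) (Split (Cross 0 2) (Colour 5 [
     Clash (Pt 0 4) (Pt 0 5), Path [Pt 2 5, Pt 2 4, Pt 0 2, Pt 1 4, Pt 2 2, Pt 0 4], Split (Inner 2 5)
     (Path [Pt 0 5, Pt 0 2, Pt 0 1, Pt 0 0, Pt 1 2, Pt 1 1]) (Path
     [Pt 1 5, Pt 1 4, Pt 1 1, Pt 1 2, Pt 0 4, Pt 0 1]), Split (Cross 2 5) (Triangle (Pt 1 2) (Pt 2 5)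
     (Pt 2 4)) (Split (Inner 2 5) (Path [Pt 2 5, Pt 2 2, Pt 0 4, Pt 1 2, Pt 2 0, Pt 0 2]) (Path
     [Pt 0 5, Pt 0 4, Pt 0 3, Pt 0 2, Pt 1 4, Pt 1 3])) ]) (Path
     [Pt 0 0, Pt 0 1, Pt 0 4, Pt 2 2, Pt 1 4, Pt 1 1])) (Path
     [Pt 1 0, Pt 1 1, Pt 1 4, Pt 0 2, Pt 2 4, Pt 2 1])), Split (Inner 0 4) (Triangle (Pt 1 0) (Pt 1 4)
     (Pt 1 1)) (Split (Cross 4 0) (Path [Pt 2 3, Pt 2 4, Pt 0 2, Pt 1 4, Pt 2 0, Pt 0 4]) (Path
     [Pt 1 0, Pt 1 1, Pt 1 2, Pt 0 4, Pt 2 2, Pt 2 1])), Clash (Pt 0 0) (Pt 0 1), Split (Inner 0 2)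
     (Triangle (Pt 1 0) (Pt 1 2) (Pt 1 1)) (Split (Cross 2 0) (Path
     [Pt 0 3, Pt 0 2, Pt 1 0, Pt 1 1, Pt 1 2, Pt 1 3]) (Path
     [Pt 1 0, Pt 1 1, Pt 1 4, Pt 0 2, Pt 2 4, Pt 2 3])) ]) (Path
     [Pt 1 1, Pt 1 2, Pt 1 3, Pt 1 4, Pt 0 2, Pt 0 3]))) (Path
     [Pt 1 3, Pt 1 4, Pt 0 2, Pt 3 4, Pt 2 2, Pt 2 3]))), Clash (Pt 0 2) (Pt 1 4), Path
     [Pt 1 3, Pt 1 4, Pt 0 2, Pt 3 4, Pt 2 2, Pt 2 3], Clash (Pt 0 3) (Pt 0 4) ])))) ]))"

definition cert_6_3_4 :: cert where
  "cert_6_3_4 =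
     Path [Pt 2 3, Pt 2 4, Pt 3 2, Pt 0 4, Pt 1 2, Pt 1 3]"

lemma check_6_3_1:
  "check 4 6 6 [(Spoke 2, True), (Cross 3 2, True)]
    [(2, 1), (1, 2)] cert_6_3_1"
  by code_simp

lemma check_6_3_2:
  "check 4 6 6 [(Spoke 2, True), (Cross 3 2, False), (Cross 4 3, True)]
    [(2, 1), (1, 2)] cert_6_3_2"
  by code_simp

lemma check_6_3_3:
  "check 4 6 6 [(Spoke 2, True), (Cross 3 2, False), (Cross 4 3, False), (Cross 2 4, True)]
    [(2, 1), (1, 2)] cert_6_3_3"
  by code_simp

lemma check_6_3_4:
  "check 4 6 6 [(Spoke 2, True), (Cross 3 2, False), (Cross 4 3, False), (Cross 2 4, False), (Cross 4 2, True)]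
    [(2, 1), (1, 2)] cert_6_3_4"
  by code_simp

definition cert_7_3 :: cert where
  "cert_7_3 =
     Split (Spoke 6) (Triangle Hub (Pt 1 6) (Pt 1 7)) (Split (Cross 7 6) (Colour 5 [ Split (Inner 5 7)
     (Triangle (Pt 1 5) (Pt 1 7) (Pt 1 6)) (Split (Cross 7 5) (Triangle (Pt 1 7) (Pt 2 5) (Pt 2 6))
     (Split (Cross 6 5) (Split (Cross 5 7) (Colour 4 [ Clash (Pt 0 4) (Pt 0 5), Split (Inner 4 6)
     (Triangle (Pt 1 4) (Pt 1 6) (Pt 1 5)) (Split (Cross 6 4) (Triangle (Pt 1 6) (Pt 2 4) (Pt 2 5))
     (Split (Cross 5 4) (Split (Cross 4 6) (Colour 3 [ Clash (Pt 0 5) (Pt 1 4), Clash (Pt 0 3) (Pt 0 4),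
     Split (Inner 3 5) (Triangle (Pt 1 3) (Pt 1 5) (Pt 1 4)) (Split (Cross 5 3) (Triangle (Pt 1 5)
     (Pt 2 3) (Pt 2 4)) (Split (Cross 4 3) (Path
     [Pt 3 3, Pt 1 4, Pt 0 5, Pt 3 7, Pt 2 5, Pt 1 6, Pt 3 5]) (Path
     [Pt 3 3, Pt 3 4, Pt 1 5, Pt 2 4, Pt 3 6, Pt 0 4, Pt 2 6]))) ]) (Path
     [Pt 0 4, Pt 0 5, Pt 3 7, Pt 1 5, Pt 1 6, Pt 0 7, Pt 2 6])) (Path
     [Pt 3 4, Pt 3 5, Pt 1 6, Pt 2 5, Pt 3 7, Pt 0 5, Pt 2 7]))), Clash (Pt 0 6) (Pt 1 5) ]) (Path
     [Pt 0 5, Pt 0 6, Pt 1 5, Pt 1 6, Pt 1 7, Pt 2 6, Pt 2 7])) (Split (Cross 5 7) (Colour 8 [ Split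
     (Inner 6 8) (Triangle (Pt 1 6) (Pt 1 8) (Pt 1 7)) (Split (Cross 6 8) (Path
     [Pt 2 8, Pt 0 6, Pt 3 8, Pt 2 6, Pt 1 7, Pt 3 6, Pt 3 5]) (Path
     [Pt 3 8, Pt 3 7, Pt 0 5, Pt 2 7, Pt 2 6, Pt 0 7, Pt 1 6])), Clash (Pt 0 7) (Pt 0 8), Split
     (Cross 5 8) (Triangle (Pt 1 5) (Pt 2 8) (Pt 2 7)) (Path
     [Pt 3 8, Pt 3 7, Pt 0 5, Pt 2 7, Pt 2 6, Pt 0 7, Pt 1 6]) ]) (Colour 8 [ Split (Inner 6 8) (Triangle
     (Pt 1 6) (Pt 1 8) (Pt 1 7)) (Split (Cross 8 7) (Path
     [Pt 3 7, Pt 1 8, Pt 2 7, Pt 2 6, Pt 0 7, Pt 1 6, Pt 1 5]) (Split (Cross 6 8) (Path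
     [Pt 2 7, Hub, Pt 1 7, Pt 1 6, Pt 3 8, Pt 0 6, Pt 0 5]) (Colour 4 [ Clash (Pt 0 4) (Pt 0 5), Split
     (Inner 4 6) (Triangle (Pt 1 4) (Pt 1 6) (Pt 1 5)) (Split (Spoke 4) (Split (Cross 6 4) (Path
     [Pt 2 8, Pt 2 7, Pt 2 6, Pt 1 7, Pt 1 6, Pt 2 4, Pt 0 6]) (Split (Cross 5 4) (Path
     [Pt 2 7, Pt 2 6, Pt 1 7, Pt 1 6, Pt 1 5, Pt 3 4, Pt 0 5]) (Split (Cross 4 6) (Split (Cross 8 4)
     (Path [Pt 1 8, Pt 2 4, Pt 0 8, Pt 0 7, Pt 2 6, Pt 2 7, Pt 2 8]) (Colour 3 [ Clash Hub (Pt 0 4),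
     Clash (Pt 0 3) (Pt 0 4), Split (Spoke 3) (Triangle Hub (Pt 1 3) (Pt 1 4)) (Split (Inner 3 5)
     (Triangle (Pt 1 3) (Pt 1 5) (Pt 1 4)) (Split (Cross 5 3) (Path
     [Pt 1 3, Pt 0 5, Pt 2 3, Pt 2 4, Pt 3 6, Pt 2 7, Pt 2 6]) (Split (Cross 4 3) (Split (Cross 3 5)
     (Path [Pt 3 7, Pt 3 6, Pt 2 7, Pt 2 6, Pt 2 5, Pt 0 3, Pt 1 5]) (Split (Cross 7 3) (Split
     (Cross 8 3) (Triangle (Pt 1 8) (Pt 2 3) (Pt 1 7)) (Split (Inner 3 8) (Colour 2 [ Split (Inner 2 4)
     (Triangle (Pt 1 2) (Pt 1 4) (Pt 1 3)) (Split (Cross 4 2) (Triangle (Pt 1 4) (Pt 2 2) (Pt 2 3))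
     (Split (Cross 3 2) (Path [Pt 2 5, Pt 2 6, Pt 1 4, Pt 1 3, Pt 1 2, Pt 0 3, Pt 0 8]) (Split
     (Cross 2 4) (Path [Pt 3 5, Pt 3 4, Pt 0 2, Pt 1 4, Pt 2 6, Pt 0 4, Pt 1 6]) (Split (Inner 2 7)
     (Split (Cross 2 7) (Path [Pt 3 7, Pt 0 2, Pt 2 7, Pt 2 6, Pt 0 4, Pt 1 6, Pt 1 5]) (Colour 1 [ Clash
     (Pt 0 1) (Pt 0 2), Split (Inner 1 3) (Triangle (Pt 1 1) (Pt 1 3) (Pt 1 2)) (Split (Spoke 1) (Path
     [Pt 0 8, Pt 0 3, Pt 0 2, Pt 0 1, Hub, Pt 1 4, Pt 1 5]) (Path
     [Pt 0 1, Pt 0 2, Pt 0 3, Pt 0 4, Hub, Pt 1 4, Pt 1 5])), Path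
     [Pt 0 1, Pt 0 2, Pt 0 3, Pt 0 4, Pt 1 3, Pt 1 2, Pt 1 7] ])) (Path
     [Pt 0 2, Pt 0 3, Pt 0 8, Pt 0 7, Pt 1 6, Pt 1 5, Pt 1 4]))))), Clash (Pt 0 4) (Pt 1 3), Clash
     (Pt 0 2) (Pt 0 3) ]) (Colour 2 [ Split (Inner 2 4) (Triangle (Pt 1 2) (Pt 1 4) (Pt 1 3)) (Split
     (Cross 4 2) (Triangle (Pt 1 4) (Pt 2 2) (Pt 2 3)) (Split (Cross 6 2) (Path
     [Pt 0 5, Pt 0 6, Pt 1 2, Pt 1 3, Pt 1 4, Pt 1 5, Pt 1 6]) (Split (Inner 2 7) (Path
     [Pt 1 8, Pt 1 7, Pt 1 2, Pt 1 3, Pt 0 4, Pt 0 5, Pt 0 6]) (Path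
     [Pt 0 2, Pt 0 3, Pt 0 4, Pt 0 5, Pt 0 6, Pt 0 7, Pt 0 8])))), Clash (Pt 0 4) (Pt 1 3), Clash
     (Pt 0 2) (Pt 0 3) ]))) (Path [Pt 2 3, Pt 2 4, Pt 2 5, Pt 2 6, Pt 0 7, Pt 1 6, Pt 1 5]))) (Path
     [Pt 1 3, Pt 1 4, Pt 1 5, Pt 1 6, Pt 0 4, Pt 0 5, Pt 0 6])))) ])) (Path
     [Pt 0 4, Pt 0 5, Pt 0 6, Pt 0 7, Pt 2 6, Pt 1 7, Pt 1 8])))) (Path
     [Pt 0 4, Pt 0 5, Pt 0 6, Pt 0 7, Hub, Pt 1 7, Pt 1 8])), Split (Cross 4 8) (Path
     [Pt 3 8, Pt 0 4, Pt 1 8, Pt 1 7, Pt 2 6, Pt 0 7, Pt 0 6]) (Path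
     [Pt 0 4, Pt 0 5, Pt 0 6, Pt 0 7, Pt 2 6, Pt 1 7, Pt 1 8]) ]))), Clash (Pt 0 7) (Pt 0 8), Split
     (Spoke 8) (Triangle Hub (Pt 1 8) (Pt 1 7)) (Split (Cross 5 8) (Path
     [Pt 1 8, Pt 0 5, Pt 3 8, Pt 3 7, Pt 3 6, Pt 2 7, Pt 2 6]) (Split (Inner 5 8) (Path
     [Pt 1 8, Pt 1 5, Pt 1 6, Pt 0 7, Pt 2 6, Pt 2 7, Pt 2 8]) (Split (Cross 8 5) (Path
     [Pt 0 8, Pt 3 5, Pt 2 8, Pt 2 7, Pt 2 6, Pt 1 7, Pt 1 6]) (Colour 4 [ Clash (Pt 0 4) (Pt 0 5), Split
     (Inner 4 6) (Triangle (Pt 1 4) (Pt 1 6) (Pt 1 5)) (Split (Spoke 4) (Split (Cross 6 4) (Path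
     [Pt 2 8, Pt 2 7, Pt 2 6, Pt 1 7, Pt 1 6, Pt 2 4, Pt 0 6]) (Split (Cross 5 4) (Path
     [Pt 2 7, Pt 2 6, Pt 1 7, Pt 1 6, Pt 1 5, Pt 3 4, Pt 0 5]) (Split (Cross 4 6) (Split (Cross 8 4)
     (Path [Pt 1 8, Pt 2 4, Pt 0 8, Pt 0 7, Pt 2 6, Pt 2 7, Pt 2 8]) (Colour 3 [ Clash Hub (Pt 0 4),
     Clash (Pt 0 3) (Pt 0 4), Split (Inner 3 5) (Triangle (Pt 1 3) (Pt 1 5) (Pt 1 4)) (Split (Cross 5 3)
     (Path [Pt 1 3, Pt 0 5, Pt 2 3, Pt 2 4, Pt 3 6, Pt 3 7, Pt 3 8]) (Split (Cross 4 3) (Split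
     (Cross 3 5) (Path [Pt 3 7, Pt 3 6, Pt 2 7, Pt 2 6, Pt 2 5, Pt 0 3, Pt 1 5]) (Colour 2 [ Split
     (Inner 2 4) (Triangle (Pt 1 2) (Pt 1 4) (Pt 1 3)) (Split (Cross 4 2) (Triangle (Pt 1 4) (Pt 2 2)
     (Pt 2 3)) (Split (Cross 2 4) (Path [Pt 3 5, Pt 3 4, Pt 0 2, Pt 1 4, Pt 2 6, Pt 0 4, Pt 1 6]) (Split
     (Cross 6 2) (Path [Pt 0 5, Pt 0 6, Pt 1 2, Pt 1 3, Pt 1 4, Pt 1 5, Pt 1 6]) (Split (Inner 2 8) (Path
     [Pt 0 8, Pt 0 2, Pt 0 3, Pt 0 4, Pt 2 6, Pt 1 4, Pt 1 5]) (Split (Inner 2 7) (Path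
     [Pt 1 8, Pt 1 7, Pt 1 2, Pt 1 3, Pt 0 4, Pt 0 5, Pt 0 6]) (Path
     [Pt 0 2, Pt 0 3, Pt 0 4, Pt 0 5, Pt 0 6, Pt 0 7, Pt 0 8])))))), Clash (Pt 0 4) (Pt 1 3), Clash
     (Pt 0 2) (Pt 0 3) ])) (Path [Pt 1 3, Pt 1 4, Pt 1 5, Pt 1 6, Pt 0 4, Pt 0 5, Pt 0 6]))) ])) (Path
     [Pt 0 4, Pt 0 5, Pt 0 6, Pt 0 7, Pt 1 6, Pt 1 7, Pt 1 8])))) (Path
     [Pt 0 4, Pt 0 5, Pt 0 6, Pt 0 7, Hub, Pt 1 7, Pt 1 8])), Path
     [Pt 0 4, Pt 0 5, Pt 0 6, Pt 0 7, Pt 1 6, Pt 1 7, Pt 1 8] ])))) ])))), Clash (Pt 0 7) (Pt 1 6), Clash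
     (Pt 0 5) (Pt 0 6) ]) (Colour 5 [ Split (Inner 5 7) (Triangle (Pt 1 5) (Pt 1 7) (Pt 1 6)) (Split
     (Cross 6 5) (Split (Cross 7 5) (Triangle (Pt 1 7) (Pt 2 5) (Pt 1 6)) (Split (Cross 5 7) (Path
     [Pt 0 7, Hub, Pt 2 7, Pt 1 5, Pt 1 6, Pt 3 5, Pt 3 6]) (Path
     [Pt 0 5, Pt 0 6, Pt 1 5, Pt 1 6, Pt 1 7, Hub, Pt 2 7]))) (Split (Cross 7 5) (Split (Cross 5 7)
     (Colour 4 [ Clash (Pt 0 4) (Pt 0 5), Clash (Pt 0 7) (Pt 1 5), Split (Cross 7 4) (Triangle (Pt 1 7)
     (Pt 2 4) (Pt 2 5)) (Split (Cross 5 4) (Path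
     [Pt 0 4, Pt 0 5, Pt 1 4, Pt 1 5, Pt 0 7, Pt 2 5, Pt 2 6]) (Path
     [Pt 0 4, Pt 0 5, Pt 1 7, Pt 2 5, Pt 0 7, Pt 1 5, Pt 1 4])) ]) (Colour 4 [ Clash (Pt 0 4) (Pt 0 5),
     Clash (Pt 0 7) (Pt 1 5), Path [Pt 0 4, Pt 0 5, Pt 0 6, Pt 0 7, Pt 1 5, Pt 1 6, Pt 1 7] ])) (Split
     (Cross 5 7) (Colour 4 [ Clash (Pt 0 4) (Pt 0 5), Split (Inner 4 6) (Triangle (Pt 1 4) (Pt 1 6)
     (Pt 1 5)) (Split (Spoke 4) (Split (Cross 5 4) (Split (Cross 6 4) (Triangle (Pt 1 6) (Pt 2 4)
     (Pt 1 5)) (Split (Cross 4 6) (Path [Pt 3 5, Pt 3 4, Pt 2 5, Pt 2 6, Pt 0 4, Pt 1 6, Pt 1 7]) (Colour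
     3 [ Clash Hub (Pt 0 4), Clash (Pt 0 3) (Pt 0 4), Split (Spoke 3) (Triangle Hub (Pt 1 3) (Pt 1 4))
     (Split (Inner 3 5) (Triangle (Pt 1 3) (Pt 1 5) (Pt 1 4)) (Split (Cross 5 3) (Triangle (Pt 1 5)
     (Pt 2 3) (Pt 2 4)) (Split (Cross 4 3) (Path
     [Pt 2 6, Pt 2 5, Pt 3 7, Pt 1 5, Pt 1 4, Pt 3 3, Pt 0 4]) (Split (Cross 3 5) (Path
     [Pt 0 3, Pt 1 5, Pt 1 6, Pt 1 7, Hub, Pt 0 7, Pt 0 6]) (Split (Cross 7 3) (Path
     [Pt 0 6, Pt 0 7, Pt 1 3, Pt 1 4, Pt 1 5, Pt 1 6, Pt 1 7]) (Colour 2 [ Split (Inner 2 4) (Triangle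
     (Pt 1 2) (Pt 1 4) (Pt 1 3)) (Split (Cross 2 4) (Split (Cross 6 2) (Path
     [Pt 1 6, Pt 2 2, Pt 0 6, Pt 0 5, Pt 2 4, Pt 2 5, Pt 2 6]) (Split (Cross 7 2) (Path
     [Pt 3 6, Pt 3 5, Pt 3 4, Pt 1 5, Pt 2 7, Pt 3 2, Pt 0 7]) (Split (Inner 2 7) (Colour 8 [ Split
     (Cross 6 8) (Path [Hub, Pt 1 7, Pt 1 8, Pt 0 6, Pt 3 8, Pt 2 6, Pt 2 5]) (Split (Cross 3 8) (Path
     [Pt 2 5, Pt 2 4, Pt 1 5, Pt 2 7, Pt 2 8, Pt 0 3, Pt 0 4]) (Split (Inner 3 8) (Colour 9 [ Clash
     (Pt 0 8) (Pt 0 9), Split (Inner 3 9) (Triangle (Pt 1 3) (Pt 1 9) (Pt 1 8)) (Split (Cross 6 9) (Path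
     [Pt 1 5, Pt 1 6, Pt 2 9, Pt 0 6, Pt 0 5, Pt 0 4, Hub]) (Path
     [Pt 1 9, Pt 1 8, Pt 1 3, Pt 1 4, Hub, Pt 0 7, Pt 0 6])), Split (Cross 9 8) (Path
     [Pt 3 8, Pt 0 9, Pt 2 8, Pt 2 7, Hub, Pt 1 7, Pt 1 6]) (Split (Cross 7 9) (Path
     [Pt 2 6, Pt 2 5, Pt 3 7, Pt 0 5, Pt 1 7, Pt 2 9, Pt 0 7]) (Split (Inner 4 9) (Path
     [Pt 0 9, Pt 0 4, Pt 0 3, Pt 0 2, Pt 1 4, Pt 1 3, Pt 1 8]) (Path
     [Pt 1 9, Pt 1 8, Pt 1 3, Pt 1 4, Hub, Pt 0 7, Pt 0 6]))) ]) (Colour 9 [ Clash (Pt 0 8) (Pt 0 9),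
     Split (Cross 6 9) (Path [Pt 1 6, Pt 2 9, Pt 0 6, Pt 0 7, Hub, Pt 3 7, Pt 2 5]) (Split (Inner 3 9)
     (Path [Pt 1 9, Pt 1 3, Pt 1 2, Pt 2 4, Hub, Pt 0 7, Pt 0 6]) (Path
     [Pt 0 9, Pt 0 8, Pt 0 7, Pt 0 2, Pt 0 3, Pt 0 4, Pt 0 5])), Split (Inner 7 9) (Triangle (Pt 1 7)
     (Pt 1 9) (Pt 1 8)) (Split (Cross 9 5) (Path [Pt 2 6, Pt 2 5, Pt 0 9, Pt 1 5, Pt 1 6, Pt 1 7, Hub])
     (Split (Inner 4 9) (Path [Pt 0 9, Pt 0 4, Pt 0 3, Pt 0 2, Pt 1 4, Pt 1 5, Pt 1 6]) (Path
     [Pt 0 9, Pt 0 8, Pt 0 7, Pt 0 2, Pt 0 3, Pt 0 4, Pt 0 5]))) ]))), Clash (Pt 0 7) (Pt 0 8), Split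
     (Spoke 8) (Triangle Hub (Pt 1 8) (Pt 1 7)) (Split (Cross 8 5) (Path
     [Pt 0 6, Pt 0 7, Pt 0 8, Pt 2 5, Pt 1 8, Pt 1 7, Pt 1 6]) (Split (Inner 5 8) (Colour 9 [ Split
     (Inner 7 9) (Triangle (Pt 1 7) (Pt 1 9) (Pt 1 8)) (Split (Cross 9 7) (Path
     [Pt 0 6, Pt 0 7, Pt 0 8, Pt 0 9, Pt 1 7, Pt 1 6, Pt 1 5]) (Path
     [Pt 0 9, Pt 0 8, Pt 0 7, Hub, Pt 1 7, Pt 1 6, Pt 1 5])), Split (Inner 5 9) (Triangle (Pt 1 5)
     (Pt 1 9) (Pt 1 8)) (Split (Spoke 9) (Path [Pt 1 6, Pt 1 5, Pt 1 8, Pt 1 9, Hub, Pt 0 7, Pt 0 6])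
     (Path [Pt 0 9, Pt 0 8, Pt 0 7, Hub, Pt 1 7, Pt 1 8, Pt 1 9])), Clash (Pt 0 8) (Pt 0 9) ]) (Path
     [Pt 0 8, Pt 0 7, Pt 0 6, Pt 0 5, Pt 1 7, Pt 1 6, Pt 1 5]))) ]) (Colour 1 [ Clash (Pt 0 1) (Pt 0 2),
     Split (Inner 1 3) (Triangle (Pt 1 1) (Pt 1 3) (Pt 1 2)) (Split (Cross 1 3) (Path
     [Pt 3 5, Pt 3 4, Pt 2 5, Pt 2 4, Pt 2 3, Pt 0 1, Pt 1 3]) (Split (Inner 1 6) (Path
     [Pt 0 7, Pt 0 6, Pt 0 1, Pt 0 2, Pt 2 4, Pt 1 2, Pt 1 3]) (Path
     [Pt 0 1, Pt 0 2, Pt 0 3, Pt 0 4, Pt 0 5, Pt 0 6, Pt 0 7]))), Split (Spoke 1) (Colour 8 [ Split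
     (Inner 6 8) (Triangle (Pt 1 6) (Pt 1 8) (Pt 1 7)) (Split (Cross 6 8) (Path
     [Hub, Pt 1 7, Pt 1 8, Pt 0 6, Pt 3 8, Pt 2 6, Pt 2 5]) (Split (Inner 3 8) (Path
     [Pt 0 6, Pt 0 7, Hub, Pt 1 7, Pt 1 8, Pt 1 3, Pt 1 2]) (Path
     [Pt 0 8, Pt 0 7, Pt 0 6, Pt 0 5, Pt 0 4, Pt 0 3, Pt 0 2]))), Clash (Pt 0 7) (Pt 0 8), Split
     (Spoke 8) (Triangle Hub (Pt 1 8) (Pt 1 7)) (Split (Inner 5 8) (Split (Inner 2 8) (Path
     [Pt 0 6, Pt 0 7, Pt 0 8, Pt 0 2, Pt 2 4, Pt 1 2, Pt 1 3]) (Colour 9 [ Split (Inner 7 9) (Triangle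
     (Pt 1 7) (Pt 1 9) (Pt 1 8)) (Path [Pt 0 9, Pt 0 8, Pt 0 7, Hub, Pt 0 1, Pt 0 2, Pt 0 3]), Split
     (Inner 5 9) (Triangle (Pt 1 5) (Pt 1 9) (Pt 1 8)) (Split (Spoke 9) (Path
     [Pt 1 6, Pt 1 5, Pt 1 8, Pt 1 9, Hub, Pt 0 7, Pt 0 6]) (Path
     [Pt 0 9, Pt 0 8, Pt 0 7, Hub, Pt 1 7, Pt 1 8, Pt 1 9])), Clash (Pt 0 8) (Pt 0 9) ])) (Path
     [Pt 0 8, Pt 0 7, Pt 0 6, Pt 0 5, Pt 1 4, Pt 1 3, Pt 1 2])) ]) (Path
     [Pt 0 1, Pt 0 2, Pt 0 3, Pt 0 4, Hub, Pt 0 7, Pt 0 6]) ])))) (Path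
     [Pt 0 2, Pt 0 3, Pt 0 4, Hub, Pt 1 4, Pt 1 5, Pt 1 6])), Split (Cross 2 6) (Path
     [Pt 3 5, Pt 3 6, Pt 0 2, Pt 1 6, Pt 1 5, Pt 2 7, Pt 0 5]) (Path
     [Pt 0 2, Pt 0 3, Pt 0 4, Pt 0 5, Pt 2 7, Pt 1 5, Pt 1 6]), Clash (Pt 0 2) (Pt 0 3) ])))))) ])))
     (Split (Cross 6 4) (Path [Pt 3 5, Pt 3 4, Pt 0 6, Pt 1 4, Pt 1 5, Pt 3 7, Pt 2 5]) (Path
     [Pt 1 4, Pt 1 5, Pt 1 6, Pt 1 7, Pt 0 5, Pt 0 6, Pt 0 7]))) (Split (Cross 6 4) (Path
     [Pt 1 4, Pt 0 6, Pt 2 4, Pt 2 5, Pt 3 7, Hub, Pt 2 7]) (Path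
     [Pt 1 4, Pt 1 5, Pt 1 6, Pt 1 7, Hub, Pt 0 7, Pt 0 6]))), Split (Cross 7 4) (Path
     [Pt 1 4, Pt 0 7, Pt 2 4, Pt 2 5, Pt 3 7, Pt 3 6, Pt 3 5]) (Split (Spoke 4) (Split (Cross 5 4)
     (Colour 3 [ Clash Hub (Pt 0 4), Split (Spoke 3) (Triangle Hub (Pt 1 3) (Pt 1 4)) (Split (Inner 3 5)
     (Triangle (Pt 1 3) (Pt 1 5) (Pt 1 4)) (Split (Cross 3 5) (Path
     [Pt 1 3, Pt 3 5, Pt 0 3, Pt 1 5, Pt 2 7, Hub, Pt 0 7]) (Split (Cross 4 3) (Path
     [Pt 0 3, Pt 0 4, Pt 1 3, Pt 1 4, Pt 1 5, Pt 2 4, Pt 2 5]) (Split (Cross 6 3) (Path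
     [Pt 2 5, Pt 3 7, Hub, Pt 1 7, Pt 1 6, Pt 2 3, Pt 0 6]) (Split (Inner 3 6) (Path
     [Pt 1 3, Pt 1 6, Pt 1 5, Pt 2 7, Hub, Pt 0 7, Pt 0 6]) (Split (Cross 3 6) (Path
     [Pt 1 4, Pt 1 5, Pt 2 4, Pt 2 5, Pt 2 6, Pt 0 3, Pt 0 4]) (Colour 2 [ Split (Inner 2 4) (Triangle
     (Pt 1 2) (Pt 1 4) (Pt 1 3)) (Split (Cross 4 2) (Path
     [Pt 2 6, Pt 2 5, Pt 2 4, Pt 1 5, Pt 1 4, Pt 2 2, Pt 0 4]) (Split (Cross 3 2) (Path
     [Pt 2 5, Pt 2 4, Hub, Pt 1 4, Pt 1 3, Pt 3 2, Pt 0 3]) (Split (Cross 2 4) (Split (Cross 6 2) (Path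
     [Pt 1 6, Pt 2 2, Pt 0 6, Pt 0 5, Pt 2 4, Pt 2 5, Pt 2 6]) (Split (Cross 7 2) (Path
     [Pt 3 6, Pt 3 5, Pt 3 4, Pt 1 5, Pt 2 7, Pt 3 2, Pt 0 7]) (Split (Cross 2 7) (Split (Inner 2 7)
     (Colour 8 [ Split (Inner 6 8) (Triangle (Pt 1 6) (Pt 1 8) (Pt 1 7)) (Split (Cross 8 7) (Split
     (Cross 6 8) (Path [Hub, Pt 1 7, Pt 1 8, Pt 0 6, Pt 3 8, Pt 2 6, Pt 2 5]) (Split (Cross 4 8) (Path
     [Pt 1 2, Pt 2 7, Pt 1 5, Pt 1 4, Pt 3 8, Pt 0 4, Pt 0 3]) (Split (Cross 8 4) (Split (Inner 4 8)
     (Colour 9 [ Clash (Pt 0 8) (Pt 0 9), Split (Inner 4 9) (Triangle (Pt 1 4) (Pt 1 9) (Pt 1 8)) (Split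
     (Cross 6 9) (Path [Pt 2 5, Pt 3 7, Hub, Pt 1 7, Pt 1 6, Pt 2 9, Pt 0 6]) (Split (Inner 6 9) (Path
     [Pt 2 9, Pt 2 6, Pt 2 5, Pt 3 7, Pt 0 5, Pt 1 7, Pt 1 6]) (Split (Cross 9 6) (Path
     [Pt 0 9, Pt 2 6, Pt 1 9, Pt 1 8, Pt 1 7, Hub, Pt 0 7]) (Split (Cross 9 5) (Path
     [Pt 0 9, Pt 2 5, Pt 1 9, Pt 1 8, Pt 1 7, Hub, Pt 0 7]) (Split (Cross 4 9) (Path
     [Pt 2 5, Pt 3 7, Pt 1 5, Pt 1 4, Pt 2 9, Pt 0 4, Pt 0 3]) (Colour 10 [ Split (Cross 6 10) (Path
     [Pt 2 5, Pt 2 6, Pt 3 10, Pt 0 6, Pt 0 7, Hub, Pt 1 7]) (Path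
     [Pt 1 10, Pt 1 9, Pt 1 8, Pt 1 7, Hub, Pt 0 7, Pt 0 6]), Clash (Pt 0 9) (Pt 0 10), Split
     (Inner 8 10) (Triangle (Pt 1 8) (Pt 1 10) (Pt 1 9)) (Split (Spoke 10) (Split (Inner 5 10) (Split
     (Inner 2 10) (Colour 1 [ Clash (Pt 0 1) (Pt 0 2), Split (Cross 4 1) (Path
     [Pt 1 1, Pt 0 4, Pt 2 1, Pt 2 2, Pt 3 4, Pt 3 3, Pt 3 2]) (Split (Spoke 1) (Split (Cross 1 5) (Path
     [Pt 3 5, Pt 0 1, Pt 2 5, Pt 2 4, Pt 1 2, Pt 1 3, Pt 1 4]) (Split (Inner 1 6) (Path
     [Pt 0 1, Pt 0 6, Pt 0 7, Pt 0 8, Pt 2 7, Pt 1 2, Pt 1 3]) (Split (Inner 1 5) (Colour 0 [ Clash Hub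
     (Pt 0 1), Clash (Pt 0 0) (Pt 0 1), Split (Spoke 0) (Triangle Hub (Pt 1 0) (Pt 1 1)) (Split
     (Cross 3 0) (Path [Pt 0 4, Pt 0 3, Pt 1 0, Pt 1 1, Pt 1 5, Pt 3 7, Pt 2 5]) (Split (Inner 0 9) (Path
     [Pt 0 0, Pt 0 9, Pt 0 10, Pt 0 5, Pt 2 7, Pt 1 5, Pt 1 6]) (Split (Inner 0 8) (Path
     [Pt 1 0, Pt 1 8, Pt 1 9, Pt 1 10, Hub, Pt 0 4, Pt 0 3]) (Path
     [Pt 0 0, Pt 0 1, Pt 0 5, Pt 0 10, Pt 0 9, Pt 0 8, Pt 0 7])))) ]) (Colour 0 [ Clash Hub (Pt 0 1),
     Clash (Pt 0 0) (Pt 0 1), Split (Inner 0 2) (Triangle (Pt 1 0) (Pt 1 2) (Pt 1 1)) (Path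
     [Pt 0 0, Pt 0 1, Pt 0 2, Pt 0 7, Pt 0 6, Pt 0 5, Pt 0 4]) ])))) (Path
     [Pt 1 1, Pt 1 2, Pt 1 3, Pt 1 4, Hub, Pt 0 4, Pt 0 3])), Split (Inner 1 3) (Triangle (Pt 1 1)
     (Pt 1 3) (Pt 1 2)) (Split (Cross 3 1) (Path
     [Pt 1 1, Pt 0 3, Pt 2 1, Pt 2 2, Pt 3 4, Pt 3 5, Pt 3 6]) (Split (Spoke 1) (Split (Inner 1 9) (Path
     [Pt 0 9, Pt 0 1, Pt 0 2, Pt 0 7, Pt 0 6, Pt 0 5, Pt 0 4]) (Split (Inner 1 8) (Colour 0 [ Clash Hub
     (Pt 0 1), Split (Spoke 0) (Triangle Hub (Pt 1 0) (Pt 1 1)) (Split (Cross 4 0) (Path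
     [Pt 1 0, Pt 0 4, Pt 2 0, Pt 2 1, Pt 2 8, Pt 2 4, Pt 2 3]) (Split (Inner 0 6) (Path
     [Pt 0 0, Pt 0 6, Pt 0 7, Pt 0 8, Pt 1 7, Pt 1 8, Pt 1 9]) (Split (Inner 0 5) (Path
     [Pt 1 0, Pt 1 5, Pt 1 6, Pt 1 7, Hub, Pt 0 4, Pt 0 3]) (Path
     [Pt 0 0, Pt 0 1, Pt 0 8, Pt 0 7, Pt 0 6, Pt 0 5, Pt 0 10])))), Clash (Pt 0 0) (Pt 0 1) ]) (Colour 0
     [ Clash Hub (Pt 0 1), Split (Inner 0 2) (Triangle (Pt 1 0) (Pt 1 2) (Pt 1 1)) (Path
     [Pt 0 0, Pt 0 1, Pt 0 2, Pt 0 10, Pt 0 9, Pt 0 8, Pt 0 4]), Clash (Pt 0 0) (Pt 0 1) ]))) (Path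
     [Pt 1 1, Pt 1 2, Pt 1 3, Pt 1 4, Hub, Pt 0 4, Pt 0 3]))) ]) (Path
     [Pt 0 9, Pt 0 10, Pt 0 5, Pt 0 4, Pt 0 3, Pt 0 2, Pt 0 7])) (Split (Inner 2 10) (Path
     [Pt 0 9, Pt 0 10, Pt 0 2, Pt 0 3, Pt 0 4, Pt 0 5, Pt 0 6]) (Colour 1 [ Clash (Pt 0 1) (Pt 0 2), Path
     [Pt 0 1, Pt 0 2, Pt 0 3, Pt 0 4, Pt 0 8, Pt 0 9, Pt 0 10], Split (Inner 1 3) (Triangle (Pt 1 1)
     (Pt 1 3) (Pt 1 2)) (Split (Cross 3 1) (Path
     [Pt 1 1, Pt 0 3, Pt 2 1, Pt 2 2, Pt 3 4, Pt 3 5, Pt 3 6]) (Split (Spoke 1) (Colour 0 [ Clash Hub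
     (Pt 0 1), Split (Inner 0 2) (Triangle (Pt 1 0) (Pt 1 2) (Pt 1 1)) (Split (Inner 0 6) (Path
     [Pt 0 0, Pt 0 6, Pt 0 7, Pt 0 8, Pt 1 7, Pt 1 8, Pt 1 9]) (Split (Inner 0 5) (Path
     [Pt 0 0, Pt 0 5, Pt 0 6, Pt 0 7, Pt 0 8, Pt 0 9, Pt 0 10]) (Path
     [Pt 0 0, Pt 0 1, Pt 0 2, Pt 0 7, Pt 0 6, Pt 0 5, Pt 0 4]))), Clash (Pt 0 0) (Pt 0 1) ]) (Path
     [Pt 1 1, Pt 1 2, Pt 1 3, Pt 1 4, Hub, Pt 0 4, Pt 0 3]))) ]))) (Path
     [Pt 1 10, Pt 1 9, Pt 1 8, Pt 1 7, Hub, Pt 0 7, Pt 0 6])) ])))))), Split (Inner 7 9) (Triangle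
     (Pt 1 7) (Pt 1 9) (Pt 1 8)) (Split (Cross 9 8) (Path
     [Pt 3 8, Pt 0 9, Pt 2 8, Pt 2 7, Hub, Pt 1 7, Pt 1 6]) (Split (Cross 7 9) (Path
     [Pt 2 6, Pt 2 5, Pt 3 7, Pt 0 5, Pt 1 7, Pt 2 9, Pt 0 7]) (Split (Inner 3 9) (Path
     [Pt 0 9, Pt 0 3, Pt 0 4, Hub, Pt 1 4, Pt 1 5, Pt 1 6]) (Split (Cross 9 3) (Path
     [Pt 3 5, Pt 3 4, Pt 2 5, Pt 2 4, Pt 2 3, Pt 0 9, Pt 1 3]) (Split (Cross 9 2) (Path
     [Pt 3 2, Pt 0 9, Pt 2 2, Pt 3 4, Pt 1 5, Pt 1 6, Pt 1 7]) (Colour 10 [ Split (Cross 7 10) (Path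
     [Pt 1 4, Pt 1 5, Pt 1 6, Pt 1 7, Pt 2 10, Pt 0 7, Pt 0 6]) (Path
     [Pt 1 10, Pt 1 9, Pt 1 8, Pt 1 4, Hub, Pt 0 7, Pt 0 6]), Split (Inner 8 10) (Triangle (Pt 1 8)
     (Pt 1 10) (Pt 1 9)) (Split (Spoke 10) (Split (Cross 10 9) (Path
     [Pt 3 9, Pt 0 10, Pt 2 9, Pt 2 8, Pt 2 4, Pt 1 8, Pt 1 4]) (Split (Cross 10 6) (Path
     [Pt 2 7, Pt 2 8, Pt 3 7, Pt 3 6, Pt 0 10, Pt 1 6, Pt 1 7]) (Split (Cross 10 5) (Path
     [Pt 3 5, Pt 0 10, Pt 2 5, Pt 3 7, Pt 1 8, Pt 1 4, Pt 1 3]) (Split (Cross 10 2) (Path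
     [Pt 3 3, Pt 3 2, Pt 0 10, Pt 2 2, Pt 2 7, Pt 1 8, Pt 1 7]) (Split (Inner 5 10) (Colour 11 [ Split
     (Cross 9 11) (Path [Pt 2 8, Pt 2 9, Pt 3 11, Pt 0 9, Pt 0 8, Pt 1 7, Hub]) (Split (Inner 6 11)
     (Colour 12 [ Clash (Pt 0 11) (Pt 0 12), Split (Inner 6 12) (Triangle (Pt 1 6) (Pt 1 12) (Pt 1 11))
     (Split (Cross 9 12) (Path [Pt 1 12, Pt 0 9, Pt 0 10, Hub, Pt 2 4, Pt 1 2, Pt 1 3]) (Path
     [Pt 1 12, Pt 1 11, Pt 1 6, Pt 1 7, Pt 0 8, Pt 0 9, Pt 0 10])), Split (Cross 10 12) (Path
     [Pt 1 12, Pt 0 10, Pt 0 9, Pt 0 8, Pt 2 7, Pt 1 8, Pt 1 9]) (Split (Inner 7 12) (Path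
     [Pt 0 12, Pt 0 7, Pt 0 6, Pt 0 5, Pt 1 7, Pt 1 6, Pt 1 5]) (Path
     [Pt 1 12, Pt 1 11, Pt 1 6, Pt 1 7, Pt 0 8, Pt 0 9, Pt 0 10])) ]) (Colour 12 [ Clash (Pt 0 11)
     (Pt 0 12), Split (Cross 9 12) (Path [Pt 1 12, Pt 0 9, Pt 0 10, Hub, Pt 2 4, Pt 1 2, Pt 1 3]) (Split
     (Inner 6 12) (Path [Pt 1 12, Pt 1 6, Pt 1 5, Pt 2 7, Pt 0 8, Pt 0 9, Pt 0 10]) (Path
     [Pt 0 12, Pt 0 11, Pt 0 10, Pt 0 5, Pt 0 6, Pt 0 7, Pt 0 8])), Split (Inner 10 12) (Triangle
     (Pt 1 10) (Pt 1 12) (Pt 1 11)) (Split (Inner 7 12) (Path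
     [Pt 0 12, Pt 0 7, Pt 0 6, Pt 0 5, Pt 1 7, Pt 1 6, Pt 1 5]) (Path
     [Pt 0 12, Pt 0 11, Pt 0 10, Pt 0 5, Pt 0 6, Pt 0 7, Pt 0 8])) ])), Clash (Pt 0 10) (Pt 0 11), Split
     (Spoke 11) (Triangle Hub (Pt 1 11) (Pt 1 10)) (Split (Inner 8 11) (Colour 12 [ Split (Cross 10 12)
     (Path [Pt 2 12, Pt 0 10, Pt 0 9, Pt 0 8, Pt 2 4, Pt 1 8, Pt 1 9]) (Path
     [Pt 1 12, Pt 1 11, Pt 1 8, Pt 1 4, Hub, Pt 0 10, Pt 0 9]), Split (Inner 8 12) (Triangle (Pt 1 8)
     (Pt 1 12) (Pt 1 11)) (Split (Spoke 12) (Path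
     [Pt 1 9, Pt 1 8, Pt 1 11, Pt 1 12, Hub, Pt 0 7, Pt 0 6]) (Path
     [Pt 0 12, Pt 0 11, Pt 0 10, Hub, Pt 1 10, Pt 1 11, Pt 1 12])), Clash (Pt 0 11) (Pt 0 12) ]) (Path
     [Pt 0 11, Pt 0 10, Pt 0 9, Pt 0 8, Pt 1 7, Pt 1 6, Pt 1 5])) ]) (Split (Inner 2 10) (Path
     [Pt 0 9, Pt 0 10, Pt 0 2, Pt 0 7, Pt 0 6, Pt 0 5, Pt 0 4]) (Colour 1 [ Clash (Pt 0 1) (Pt 0 2),
     Split (Inner 1 9) (Path [Pt 0 10, Pt 0 9, Pt 0 1, Pt 0 2, Pt 2 4, Pt 1 2, Pt 1 3]) (Path
     [Pt 0 1, Pt 0 2, Pt 0 3, Pt 0 4, Pt 0 8, Pt 0 9, Pt 0 10]), Split (Inner 1 3) (Triangle (Pt 1 1)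
     (Pt 1 3) (Pt 1 2)) (Split (Spoke 1) (Split (Inner 1 8) (Colour 0 [ Clash Hub (Pt 0 1), Split
     (Spoke 0) (Triangle Hub (Pt 1 0) (Pt 1 1)) (Split (Inner 0 2) (Triangle (Pt 1 0) (Pt 1 2) (Pt 1 1))
     (Split (Cross 0 2) (Path [Pt 2 3, Pt 2 2, Pt 0 0, Pt 1 2, Pt 1 3, Pt 1 4, Pt 0 8]) (Split
     (Cross 4 0) (Path [Pt 1 0, Pt 0 4, Pt 2 0, Pt 2 1, Pt 2 8, Pt 2 4, Pt 2 3]) (Split (Inner 0 6) (Path
     [Pt 0 0, Pt 0 6, Pt 0 7, Pt 0 8, Pt 2 7, Pt 1 2, Pt 1 3]) (Split (Inner 0 5) (Path
     [Pt 1 0, Pt 1 5, Pt 1 6, Pt 1 7, Hub, Pt 0 4, Pt 0 3]) (Path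
     [Pt 0 0, Pt 0 1, Pt 0 2, Pt 0 7, Pt 0 6, Pt 0 5, Pt 0 4])))))), Clash (Pt 0 0) (Pt 0 1) ]) (Path
     [Pt 0 1, Pt 0 2, Pt 0 3, Pt 0 4, Pt 0 8, Pt 0 9, Pt 0 10])) (Path
     [Pt 0 1, Pt 0 2, Pt 0 3, Pt 0 4, Hub, Pt 0 10, Pt 0 9])) ]))))))) (Path
     [Pt 1 10, Pt 1 9, Pt 1 8, Pt 2 7, Hub, Pt 0 7, Pt 0 6])), Clash (Pt 0 9) (Pt 0 10) ])))))) ])
     (Colour 9 [ Clash (Pt 0 8) (Pt 0 9), Split (Cross 9 6) (Path
     [Pt 0 9, Pt 2 6, Pt 1 9, Pt 1 8, Pt 1 7, Hub, Pt 0 7]) (Split (Cross 9 5) (Path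
     [Pt 0 9, Pt 2 5, Pt 1 9, Pt 1 8, Pt 1 7, Hub, Pt 0 7]) (Split (Inner 4 9) (Path
     [Pt 0 9, Pt 0 4, Pt 0 3, Pt 0 2, Pt 1 4, Pt 1 5, Pt 1 6]) (Path
     [Pt 0 9, Pt 0 8, Pt 0 7, Pt 0 2, Pt 0 3, Pt 0 4, Pt 0 5]))), Split (Inner 7 9) (Triangle (Pt 1 7)
     (Pt 1 9) (Pt 1 8)) (Split (Inner 3 9) (Path [Pt 0 9, Pt 0 3, Pt 0 4, Hub, Pt 1 4, Pt 1 5, Pt 1 6])
     (Path [Pt 0 9, Pt 0 8, Pt 0 7, Pt 0 2, Pt 0 3, Pt 0 4, Pt 0 5])) ])) (Path
     [Pt 0 8, Pt 0 7, Pt 0 6, Pt 0 5, Pt 1 4, Pt 1 5, Pt 1 6])))) (Path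
     [Pt 0 8, Pt 0 7, Pt 0 6, Pt 0 5, Pt 1 7, Pt 1 6, Pt 1 5])), Clash (Pt 0 7) (Pt 0 8), Split (Spoke 8)
     (Triangle Hub (Pt 1 8) (Pt 1 7)) (Split (Inner 5 8) (Colour 9 [ Split (Cross 7 9) (Path
     [Pt 1 4, Pt 1 5, Pt 1 6, Pt 1 7, Pt 2 9, Pt 0 7, Pt 0 8]) (Path
     [Pt 1 9, Pt 1 8, Pt 1 5, Pt 1 4, Hub, Pt 0 7, Pt 0 8]), Split (Inner 5 9) (Triangle (Pt 1 5)
     (Pt 1 9) (Pt 1 8)) (Split (Spoke 9) (Path [Pt 1 6, Pt 1 5, Pt 1 8, Pt 1 9, Hub, Pt 0 7, Pt 0 6])
     (Path [Pt 0 9, Pt 0 8, Pt 0 7, Hub, Pt 1 7, Pt 1 8, Pt 1 9])), Clash (Pt 0 8) (Pt 0 9) ]) (Path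
     [Pt 0 8, Pt 0 7, Pt 0 6, Pt 0 5, Pt 1 7, Pt 1 6, Pt 1 5])) ]) (Colour 1 [ Clash (Pt 0 1) (Pt 0 2),
     Split (Inner 1 6) (Path [Pt 0 7, Pt 0 6, Pt 0 1, Pt 0 2, Pt 2 4, Pt 1 2, Pt 1 3]) (Split (Inner 1 5)
     (Colour 8 [ Split (Inner 6 8) (Triangle (Pt 1 6) (Pt 1 8) (Pt 1 7)) (Path
     [Pt 0 8, Pt 0 7, Pt 0 6, Pt 0 5, Pt 0 1, Pt 0 2, Pt 0 3]), Clash (Pt 0 7) (Pt 0 8), Split (Spoke 8)
     (Triangle Hub (Pt 1 8) (Pt 1 7)) (Split (Inner 5 8) (Colour 9 [ Split (Cross 7 9) (Path
     [Pt 1 4, Pt 1 5, Pt 1 6, Pt 1 7, Pt 2 9, Pt 0 7, Pt 0 8]) (Path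
     [Pt 1 9, Pt 1 8, Pt 1 5, Pt 1 4, Hub, Pt 0 7, Pt 0 8]), Split (Inner 5 9) (Triangle (Pt 1 5)
     (Pt 1 9) (Pt 1 8)) (Split (Spoke 9) (Path [Pt 1 6, Pt 1 5, Pt 1 8, Pt 1 9, Hub, Pt 0 7, Pt 0 6])
     (Path [Pt 0 9, Pt 0 8, Pt 0 7, Hub, Pt 1 7, Pt 1 8, Pt 1 9])), Clash (Pt 0 8) (Pt 0 9) ]) (Path
     [Pt 0 8, Pt 0 7, Pt 0 6, Pt 0 5, Pt 1 7, Pt 1 6, Pt 1 5])) ]) (Path
     [Pt 0 1, Pt 0 2, Pt 0 3, Pt 0 4, Pt 0 5, Pt 0 6, Pt 0 7])), Split (Inner 1 3) (Triangle (Pt 1 1)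
     (Pt 1 3) (Pt 1 2)) (Path [Pt 0 1, Pt 0 2, Pt 0 3, Pt 0 4, Pt 0 5, Pt 0 6, Pt 0 7]) ])) (Path
     [Pt 0 2, Pt 0 3, Pt 0 4, Hub, Pt 1 7, Pt 1 6, Pt 1 5])))) (Path
     [Pt 0 2, Pt 0 3, Pt 0 4, Hub, Pt 1 4, Pt 1 5, Pt 1 6])))), Clash (Pt 0 2) (Pt 0 3), Path
     [Pt 0 2, Pt 0 3, Pt 0 4, Pt 0 5, Pt 1 4, Pt 1 5, Pt 1 6] ]))))))), Clash (Pt 0 3) (Pt 0 4) ]) (Path
     [Pt 1 4, Pt 1 5, Pt 1 6, Pt 1 7, Pt 0 5, Pt 0 6, Pt 0 7])) (Path
     [Pt 1 4, Pt 1 5, Pt 1 6, Pt 1 7, Hub, Pt 0 7, Pt 0 6])) ]) (Path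
     [Pt 0 5, Pt 0 6, Pt 0 7, Hub, Pt 1 7, Pt 1 6, Pt 1 5])))), Split (Spoke 5) (Split (Cross 6 5)
     (Colour 4 [ Clash Hub (Pt 0 5), Clash (Pt 0 4) (Pt 0 5), Clash (Pt 0 6) (Pt 1 5) ]) (Colour 4 [
     Clash Hub (Pt 0 5), Clash (Pt 0 4) (Pt 0 5), Split (Spoke 4) (Triangle Hub (Pt 1 4) (Pt 1 5)) (Split
     (Cross 5 4) (Split (Cross 7 4) (Split (Inner 3 5) (Triangle (Pt 1 3) (Pt 1 5) (Pt 1 4)) (Split
     (Cross 5 3) (Triangle (Pt 1 5) (Pt 2 3) (Pt 2 4)) (Split (Cross 7 3) (Triangle (Pt 1 7) (Pt 2 3)
     (Pt 2 4)) (Split (Cross 4 3) (Split (Cross 3 5) (Split (Cross 3 6) (Triangle (Pt 1 3) (Pt 2 6)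
     (Pt 2 5)) (Path [Pt 3 6, Pt 3 5, Pt 0 3, Pt 2 5, Pt 2 4, Pt 0 5, Pt 1 4])) (Path
     [Pt 0 3, Pt 0 4, Pt 1 3, Pt 1 4, Pt 1 5, Pt 2 4, Pt 2 5])) (Split (Cross 6 3) (Path
     [Pt 2 6, Pt 3 3, Pt 1 6, Pt 1 5, Pt 1 4, Pt 0 5, Pt 0 4]) (Split (Cross 3 6) (Path
     [Pt 3 4, Pt 0 5, Pt 2 4, Pt 2 3, Pt 3 6, Pt 0 3, Pt 1 6]) (Split (Cross 3 5) (Path
     [Pt 3 6, Pt 3 5, Pt 0 3, Pt 2 5, Pt 2 4, Pt 0 5, Pt 1 4]) (Split (Cross 3 7) (Path
     [Pt 2 3, Pt 3 7, Pt 0 3, Pt 1 7, Pt 3 4, Pt 0 5, Pt 1 4]) (Path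
     [Pt 0 3, Pt 0 4, Pt 0 5, Pt 1 4, Pt 1 5, Pt 1 6, Pt 1 7]))))))))) (Path
     [Pt 1 7, Pt 1 6, Pt 1 5, Pt 1 4, Pt 0 5, Pt 0 6, Pt 0 7])) (Split (Cross 7 4) (Path
     [Pt 0 4, Pt 0 5, Pt 0 6, Pt 0 7, Pt 2 4, Pt 1 7, Pt 1 6]) (Colour 3 [ Split (Inner 3 5) (Triangle
     (Pt 1 3) (Pt 1 5) (Pt 1 4)) (Split (Cross 4 3) (Split (Cross 5 3) (Triangle (Pt 1 5) (Pt 2 3)
     (Pt 1 4)) (Split (Cross 3 5) (Path [Pt 0 5, Hub, Pt 2 5, Pt 1 3, Pt 1 4, Pt 3 3, Pt 3 4]) (Path
     [Pt 0 3, Pt 0 4, Pt 1 3, Pt 1 4, Pt 1 5, Hub, Pt 2 5]))) (Split (Cross 5 3) (Split (Cross 6 3)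
     (Triangle (Pt 1 6) (Pt 2 3) (Pt 1 5)) (Split (Cross 7 3) (Split (Cross 3 5) (Split (Cross 3 6)
     (Triangle (Pt 1 3) (Pt 2 6) (Pt 2 5)) (Split (Inner 3 6) (Split (Inner 3 7) (Triangle (Pt 1 3)
     (Pt 1 7) (Pt 1 6)) (Split (Cross 3 7) (Path
     [Pt 1 4, Pt 1 3, Pt 0 7, Pt 2 3, Pt 1 7, Pt 0 3, Pt 0 4]) (Path
     [Pt 2 7, Pt 2 6, Pt 2 5, Pt 0 3, Pt 1 5, Pt 1 6, Pt 1 7]))) (Path
     [Pt 2 6, Pt 2 5, Pt 0 3, Pt 1 5, Pt 2 3, Pt 0 5, Pt 0 6]))) (Split (Cross 3 6) (Path
     [Pt 2 4, Pt 2 5, Pt 2 6, Pt 0 3, Pt 1 6, Pt 1 5, Pt 1 4]) (Split (Inner 3 6) (Split (Inner 3 7)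
     (Triangle (Pt 1 3) (Pt 1 7) (Pt 1 6)) (Path [Pt 1 4, Pt 1 5, Hub, Pt 0 7, Pt 0 6, Pt 0 3, Pt 0 4]))
     (Path [Pt 0 3, Pt 0 4, Pt 0 5, Pt 1 3, Pt 1 4, Pt 1 5, Pt 1 6])))) (Path
     [Pt 1 7, Pt 1 6, Pt 1 5, Pt 2 3, Pt 0 5, Pt 0 6, Pt 0 7]))) (Split (Cross 3 5) (Split (Cross 6 3)
     (Path [Pt 1 4, Pt 1 5, Pt 1 6, Pt 2 3, Pt 0 6, Pt 0 5, Pt 0 4]) (Split (Inner 3 6) (Split
     (Inner 3 7) (Triangle (Pt 1 3) (Pt 1 7) (Pt 1 6)) (Path
     [Pt 0 4, Pt 0 5, Hub, Pt 1 7, Pt 1 6, Pt 1 3, Pt 1 4])) (Path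
     [Pt 1 3, Pt 1 4, Pt 1 5, Pt 0 3, Pt 0 4, Pt 0 5, Pt 0 6]))) (Path
     [Pt 0 3, Pt 0 4, Pt 0 5, Hub, Pt 1 5, Pt 1 4, Pt 1 3])))), Split (Cross 4 3) (Path
     [Pt 0 3, Pt 0 4, Pt 1 3, Pt 1 4, Pt 1 5, Pt 1 6, Pt 1 7]) (Split (Spoke 3) (Colour 2 [ Clash Hub
     (Pt 0 3), Clash (Pt 0 2) (Pt 0 3), Split (Spoke 2) (Triangle Hub (Pt 1 2) (Pt 1 3)) (Split
     (Cross 3 2) (Path [Pt 0 2, Pt 0 3, Pt 1 2, Pt 1 3, Pt 1 4, Pt 1 5, Pt 1 6]) (Split (Cross 5 2) (Path
     [Pt 0 5, Pt 1 2, Pt 1 3, Pt 1 4, Pt 1 5, Pt 1 6, Pt 1 7]) (Colour 1 [ Split (Inner 1 3) (Triangle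
     (Pt 1 1) (Pt 1 3) (Pt 1 2)) (Split (Cross 2 1) (Split (Cross 3 1) (Triangle (Pt 1 3) (Pt 2 1)
     (Pt 1 2)) (Split (Cross 1 3) (Path [Pt 0 3, Hub, Pt 2 3, Pt 1 1, Pt 1 2, Pt 3 1, Pt 3 2]) (Path
     [Pt 0 1, Pt 0 2, Pt 1 1, Pt 1 2, Pt 1 3, Hub, Pt 2 3]))) (Split (Cross 3 1) (Split (Cross 4 1)
     (Triangle (Pt 1 4) (Pt 2 1) (Pt 1 3)) (Split (Cross 5 1) (Split (Cross 1 3) (Split (Cross 1 4)
     (Triangle (Pt 1 1) (Pt 2 4) (Pt 2 3)) (Split (Inner 1 4) (Split (Inner 1 5) (Triangle (Pt 1 1)
     (Pt 1 5) (Pt 1 4)) (Split (Cross 1 5) (Path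
     [Pt 1 2, Pt 1 1, Pt 0 5, Pt 2 1, Pt 1 5, Pt 0 1, Pt 0 2]) (Path
     [Pt 2 5, Pt 2 4, Pt 2 3, Pt 0 1, Pt 1 3, Pt 1 4, Pt 1 5]))) (Path
     [Pt 2 4, Pt 2 3, Pt 0 1, Pt 1 3, Pt 2 1, Pt 0 3, Pt 0 4]))) (Split (Cross 1 4) (Path
     [Pt 2 2, Pt 2 3, Pt 2 4, Pt 0 1, Pt 1 4, Pt 1 3, Pt 1 2]) (Split (Inner 1 4) (Split (Inner 1 5)
     (Triangle (Pt 1 1) (Pt 1 5) (Pt 1 4)) (Path [Pt 1 2, Pt 1 3, Hub, Pt 0 5, Pt 0 4, Pt 0 1, Pt 0 2]))
     (Path [Pt 0 1, Pt 0 2, Pt 0 3, Pt 1 1, Pt 1 2, Pt 1 3, Pt 1 4])))) (Path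
     [Pt 1 5, Pt 1 4, Pt 1 3, Pt 2 1, Pt 0 3, Pt 0 4, Pt 0 5]))) (Split (Cross 1 3) (Split (Cross 4 1)
     (Path [Pt 1 2, Pt 1 3, Pt 1 4, Pt 2 1, Pt 0 4, Pt 0 3, Pt 0 2]) (Split (Inner 1 4) (Split
     (Inner 1 5) (Triangle (Pt 1 1) (Pt 1 5) (Pt 1 4)) (Path
     [Pt 0 2, Pt 0 3, Hub, Pt 1 5, Pt 1 4, Pt 1 1, Pt 1 2])) (Path
     [Pt 1 1, Pt 1 2, Pt 1 3, Pt 0 1, Pt 0 2, Pt 0 3, Pt 0 4]))) (Path
     [Pt 0 1, Pt 0 2, Pt 0 3, Hub, Pt 1 3, Pt 1 2, Pt 1 1])))), Path
     [Pt 0 1, Pt 0 2, Pt 0 3, Pt 0 4, Pt 0 5, Pt 0 6, Pt 0 7], Clash (Pt 0 1) (Pt 0 2) ]))) ]) (Path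
     [Pt 0 3, Pt 0 4, Pt 0 5, Hub, Pt 1 5, Pt 1 4, Pt 1 3])), Clash (Pt 0 3) (Pt 0 4) ]))) ])) (Split
     (Cross 6 5) (Path [Pt 0 5, Pt 0 6, Pt 1 5, Pt 1 6, Pt 1 7, Hub, Pt 2 7]) (Path
     [Pt 0 5, Pt 0 6, Pt 0 7, Hub, Pt 1 7, Pt 1 6, Pt 1 5])), Clash (Pt 0 5) (Pt 0 6) ]))"

lemma check_7_3: "check 3 7 13 [(Spoke 7, True)] [(7, 1), (6, 2)] cert_7_3"
  by code_simp

section \<open>The five classes contain no infinite coloured path\<close>

context ray begin

lemma infinite_shift: "infinite {n. E u (n + d)}" if "infinite {n. E u n}"
proof
  assume "finite {n. E u (n + d)}"
  then have "finite ((\<lambda>n. n + d) ` {n. E u (n + d)} \<union> {..<d})" by simp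
  moreover have "{n. E u n} \<subseteq> (\<lambda>n. n + d) ` {n. E u (n + d)} \<union> {..<d}"
    by (auto simp: image_iff) (metis le_add_diff_inverse2 not_le)
  ultimately show False using that finite_subset by blast
qed

lemma hub_blocks: "\<exists>u s. blocks u s w \<and> E u (s 0 + b)"
proof -
  obtain u where "infinite {n. E u n}" using hub by blast
  from blocks_exist[OF infinite_shift[OF this, of b], of u w] show ?thesis by blast
qed

text \<open>
  This is used for segments from which a colour has disappeared, to reduce the number of colours.
\<close>

lemma segment_free:
  assumes "\<And>i. i < m \<Longrightarrow> c (N + i) \<in> S'"
  shows "free_path S' t l m (\<lambda>i j. E (N + i) (N + j)) (\<lambda>i. c (N + i))"
proof -
  have "coloured_path S' m (\<lambda>i j. E (N + i) (N + j)) (\<lambda>i. c (N + i))"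
    unfolding coloured_path_def
  proof (intro conjI allI impI)
    fix i j assume "Suc i < j \<and> j < m \<and> E (N + i) (N + j)"
    then show "c (N + i) \<noteq> c (N + (j - 1))" using chord[of "N + i" "N + j"] by simp
  qed (use assms sym proper step in auto)
  moreover have "\<not> embeds h H m (\<lambda>i j. E (N + i) (N + j))"
    if "h = t \<and> H = path_adj \<or> h = l \<and> H = cycle_adj l" for h H
  proof
    assume "embeds h H m (\<lambda>i j. E (N + i) (N + j))"
    then obtain f where "inj_on f {..<h}" "\<forall>i<h. \<forall>j<h. E (N + f i) (N + f j) \<longleftrightarrow> H i j"
      unfolding embeds_def by blast
    then show False using no_embedding[of "\<lambda>i. N + f i" h H] that by (auto simp: inj_on_def)
  qed
  ultimately show ?thesis unfolding free_path_def by blast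
qed

text \<open>
  Two colours allow no chord, so the ray would be an induced path.
\<close>

lemma three_colours: "3 \<le> card S"
proof -
  have "\<exists>i j. Suc i < j \<and> E i j"
  proof (rule ccontr)
    assume no: "\<nexists>i j. Suc i < j \<and> E i j"
    have up: "j = Suc i" if "E i j" "i < j" for i j
      using no that by (metis Suc_lessI)
    have "E i j \<longleftrightarrow> path_adj i j" for i j
      using up[of i j] up[of j i] sym step
      by (cases i j rule: linorder_cases) (auto simp: path_adj_def)
    then show False using no_embedding[of "\<lambda>i. i" t path_adj] by simp
  qed
  then obtain i j where ij: "Suc i < j" "E i j" by blast
  have "c (j - 1) \<noteq> c j" using proper[OF step[of "j - 1"]] ij by simp
  then have "card {c i, c j, c (j - 1)} = 3" using proper[OF ij(2)] chord[OF ij(2,1)] by auto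
  then show ?thesis using card_mono[OF fin, of "{c i, c j, c (j - 1)}"] colour by auto
qed

end

lemma no_ray_5_3: "\<not> free_ray S 5 3 E c" if "finite S" "card S \<le> 5"
proof
  assume "free_ray S 5 3 E c"
  then interpret ray S 5 3 E c using that by unfold_locales
  obtain u s where b: "blocks u s 3" "E u (s 0 + 1)" using hub_blocks[of 3 1] by (elim exE conjE)
  show False by (rule refuted[OF refl b _ that(2) _ check_5_3]) simp_all
qed

lemma no_ray_7_3: "\<not> free_ray S 7 3 E c" if "finite S" "card S \<le> 3"
proof
  assume "free_ray S 7 3 E c"
  then interpret ray S 7 3 E c using that by unfold_locales
  obtain u s where b: "blocks u s 13" "E u (s 0 + 7)" using hub_blocks[of 13 7] by (elim exE conjE)
  show False by (rule refuted[OF refl b _ that(2) _ check_7_3]) simp_all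
qed

lemma embeds_path_mono:
  assumes "embeds t' path_adj n E" "t \<le> t'"
  shows "embeds t path_adj n E"
proof -
  from assms(1)[unfolded embeds_def] obtain f where inj: "inj_on f {..<t'}"
    and im: "f ` {..<t'} \<subseteq> {..<n}" and adj: "\<forall>i<t'. \<forall>j<t'. E (f i) (f j) \<longleftrightarrow> path_adj i j"
    by (elim exE conjE)
  have sub: "{..<t} \<subseteq> {..<t'}" using assms(2) by simp
  show ?thesis
    unfolding embeds_def
  proof (intro exI[of _ f] conjI allI impI)
    show "inj_on f {..<t}" by (rule inj_on_subset[OF inj sub])
    show "f ` {..<t} \<subseteq> {..<n}" by (rule subset_trans[OF image_mono[OF sub] im])
    fix i j assume "i < t" "j < t"
    then have "i < t'" "j < t'" using assms(2) by simp_all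
    then show "E (f i) (f j) \<longleftrightarrow> path_adj i j" using adj by blast
  qed
qed

lemma free_path_longer:
  assumes "free_path S t l n E c" "t \<le> t'"
  shows "free_path S t' l n E c"
  unfolding free_path_def
proof (intro conjI)
  note a = assms(1)[unfolded free_path_def]
  show "coloured_path S n E c" "\<not> embeds l (cycle_adj l) n E" using a by blast+
  show "\<not> embeds t' path_adj n E"
  proof
    assume "embeds t' path_adj n E"
    from embeds_path_mono[OF this assms(2)] a show False by blast
  qed
qed

text \<open>
  Around each neighbour \<open>y\<close> of the hub the certificates leave no edges between different blocks.
  Then the vertex two steps after \<open>y\<close> must be a neighbour of the hub too: otherwise the three
  vertices from \<open>y\<close> on, the hub, and two vertices of another block would form an induced \<open>P\<^sub>6\<close>. So
  the hub sees every second vertex, and its colour is missing on arbitrarily long segments.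
\<close>

lemma no_ray_6_3: "\<not> free_ray S 6 3 E c" if "finite S" "card S \<le> 4"
proof
  assume "free_ray S 6 3 E c"
  then interpret ray S 6 3 E c using that by unfold_locales
  note S4 = that(2)
  obtain u where hu: "infinite {n. E u n}" using hub by blast
  have "\<exists>E' c'. free_path (S - {c u}) 7 3 m E' c'" for m
  proof -
    obtain s where blk: "blocks u s (m + 6)" and s2: "E u (s 0 + 2)"
      using blocks_exist[OF infinite_shift[OF hu, of 2], of u "m + 6"] by blast
    have zero: "\<not> E (s i + (y + a)) (s j + (y + b))"
      if y: "2 \<le> y" "y < m + 2" "E u (s 0 + y)" and ab: "a \<le> 2" "b \<le> 2" and ij: "i \<noteq> j" for y a b i j
    proof -
      obtain d where d: "y = 2 + d" using y(1) le_Suc_ex by blast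
      let ?s = "\<lambda>i. s i + d"
      have b': "blocks u ?s 6" by (rule blocks_shift[OF blk]) (use y d in simp)
      have h: "E u (?s 0 + 2)" using y(3) d by (simp add: add_ac)
      note R = refuted[OF refl b' h _ S4]
      have f1: "\<not> holds u ?s (Cross 3 2)" 
      proof
        assume "holds u ?s (Cross 3 2)"
        then show False using h by (intro R[OF _ _ check_6_3_1]) simp_all
      qed
      have f2: "\<not> holds u ?s (Cross 4 3)" 
      proof
        assume "holds u ?s (Cross 4 3)"
        then show False using f1 by (intro R[OF _ _ check_6_3_2]) simp_all
      qed
      have f3: "\<not> holds u ?s (Cross 2 4)" 
      proof
        assume "holds u ?s (Cross 2 4)"
        then show False using f1 f2 by (intro R[OF _ _ check_6_3_3]) simp_all
      qed
      have f4: "\<not> holds u ?s (Cross 4 2)" 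
      proof
        assume "holds u ?s (Cross 4 2)"
        then show False using f1 f2 f3 by (intro R[OF _ _ check_6_3_4]) simp_all
      qed
      have lv: "s i + d + (2 + a) = s i + (y + a)" for i a using d by simp
      have f: "\<not> E (s 0 + (y + 1)) (s 1 + (y + 0))" "\<not> E (s 0 + (y + 2)) (s 1 + (y + 1))"
        "\<not> E (s 0 + (y + 0)) (s 1 + (y + 2))" "\<not> E (s 0 + (y + 2)) (s 1 + (y + 0))"
        using f1 f2 f3 f4 unfolding lv[symmetric] by simp_all
      have col: "c (s 1 + (y + a)) = c (s 0 + (y + a))" if "a \<le> 2" for a
        by (rule blocks_colour[OF blk]) (use y that in simp)
      have gap: "Suc (s 0 + (y + a)) < s 1 + (y + b)" if "a \<le> 2" "b \<le> 2" for a b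
        using blocks_gap[OF blk, of 0] y that by simp
      \<comment> \<open>The colours exclude edges from a level to the same or to the next level of a later block.\<close>
      have ne: "\<not> E (s 0 + (y + a)) (s 1 + (y + b))" if "a \<le> 2" "b \<le> 2" "b = a \<or> b = a + 1" for a b
        using proper[of "s 0 + (y + a)" "s 1 + (y + b)"] chord[of "s 0 + (y + a)" "s 1 + (y + b)"]
          col[of a] gap[of a b] that by auto
      have "\<not> E (s 0 + (y + a)) (s 1 + (y + b))" if "a \<le> 2" "b \<le> 2" for a b
      proof -
        have "a = 0 \<or> a = 1 \<or> a = 2" "b = 0 \<or> b = 1 \<or> b = 2" using that by auto
        then show ?thesis using f ne[of a b] by (elim disjE) simp_all
      qed
      note z = this
      have cr: "E (s i + (y + a)) (s j + (y + b)) \<longleftrightarrow> E (s 0 + (y + a)) (s 1 + (y + b))" if "i < j" "a \<le> 2" "b \<le> 2" for i j a b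
        by (rule blocks_cross[OF blk]) (use y that in simp_all)
      show ?thesis
      proof (cases "i < j")
        case True
        then show ?thesis using cr[OF True ab] z[OF ab] by simp
      next
        case False
        then have "\<not> E (s j + (y + b)) (s i + (y + a))" using cr[of j i b a] z[of b a] ab ij by simp
        then show ?thesis using sym by blast
      qed
    qed
    have next_nbr: "E u (s 0 + (y + 2))" if y: "2 \<le> y" "y < m + 2" "E u (s 0 + y)" for y
    proof (rule ccontr)
      assume far: "\<not> E u (s 0 + (y + 2))"
      note z = zero[OF y]
      have st: "E (s i + y) (s i + (y + 1))" "E (s i + (y + 1)) (s i + (y + 2))" for i
        using step[of "s i + y"] step[of "s i + (y + 1)"] by simp_all
      have sp: "E u (s i + y)" for i using blocks_spoke[OF blk, of y i] y by simp
      have n1: "\<not> E u (s i + (y + 1))" for i using no_triangle[OF refl sp[of i] st(1)[of i]] by blast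
      have n2: "\<not> E (s i + y) (s i + (y + 2))" for i using no_triangle[OF refl st(1)[of i] st(2)[of i]] by blast
      have u: "u < s i" for i using blocks_above[OF blk, of i] by simp
      have "s 0 + (m + 6) < s 1" using blocks_gap[OF blk, of 0] by simp
      moreover have "\<not> E (s 0 + (y + 1)) u" "\<not> E (s 0 + (y + 2)) u" "\<not> E (s 0 + (y + 2)) (s 0 + y)"
        using n1[of 0] far n2[of 0] sym by blast+
      moreover have "u < s 0" "u < s 1" using u by blast+
      ultimately have "ind_path [s 0 + (y + 2), s 0 + (y + 1), s 0 + y, u, s 1 + y, s 1 + (y + 1)]"
        using z[of 2 0 0 1] z[of 2 1 0 1] z[of 1 0 0 1] z[of 1 1 0 1] z[of 0 0 0 1] z[of 0 1 0 1]
          st(1)[of 1] st[of 0, THEN sym] sp[of 1] sp[of 0, THEN sym] n1[of 1] y(2)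
        by simp
      from no_ind_path[OF this] show False by simp
    qed
    have even: "2 * i < m + 2 \<Longrightarrow> E u (s 0 + (2 + 2 * i))" for i
    proof (induction i)
      case 0 then show ?case using s2 by simp
    next
      case (Suc i) then show ?case using next_nbr[of "2 + 2 * i"] by (simp add: add.assoc)
    qed
    have "c (s 0 + 2 + i) \<in> S - {c u}" if "i < m" for i
    proof (cases "even i")
      case True
      then obtain h where "i = 2 * h" by blast
      then show ?thesis using proper[OF even[of h]] colour that by (simp add: add.assoc)
    next
      case False
      then obtain h where h: "i = 2 * h + 1" by (rule oddE)
      then have E: "E u (s 0 + (2 + 2 * Suc h))" using even[of "Suc h"] that by simp
      have "Suc u < s 0" using blocks_above[OF blk] .
      then have "c u \<noteq> c (s 0 + (2 + 2 * Suc h) - 1)" using chord[OF E] by simp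
      then show ?thesis using h colour by (simp add: numeral_eq_Suc)
    qed
    from segment_free[of m "s 0 + 2" "S - {c u}", OF this]
    have "free_path (S - {c u}) 6 3 m (\<lambda>i j. E (s 0 + 2 + i) (s 0 + 2 + j)) (\<lambda>i. c (s 0 + 2 + i))" .
    then have "free_path (S - {c u}) 7 3 m (\<lambda>i j. E (s 0 + 2 + i) (s 0 + 2 + j)) (\<lambda>i. c (s 0 + 2 + i))"
      by (rule free_path_longer) simp
    then show ?thesis by (intro exI)
  qed
  from free_ray_exists[OF finite_Diff[OF that(1)] this]
  obtain E' c' where "free_ray (S - {c u}) 7 3 E' c'" by (elim exE)
  moreover have "card (S - {c u}) \<le> 3" using that colour by simp
  ultimately show False using no_ray_7_3[of "S - {c u}"] that by simp
qed

context ray begin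

text \<open>
  An edge between two blocks is repeated between all pairs of blocks, so two vertices on one level
  and two vertices on the other, all in different blocks, would form an induced 4-cycle: vertices on
  the same level have the same colour.
\<close>

lemma cross_square_free:
  assumes l: "l = 4" and blk: "blocks u s w" and ab: "a < w" "b < w" and ij: "i \<noteq> j"
  shows "\<not> E (s i + a) (s j + b)"
proof -
  have no: "\<not> E (s 0 + a) (s 1 + b)" if ab: "a < w" "b < w" for a b
  proof
    assume E: "E (s 0 + a) (s 1 + b)"
    have cr: "E (s i + a) (s j + b)" if "i < j" for i j
      using blocks_cross[OF blk ab that] E by blast
    have same: "\<not> E (s i + x) (s j + x)" if "x < w" for i j x
      using proper[of "s i + x" "s j + x"] blocks_colour[OF blk that, of i] blocks_colour[OF blk that, of j]
      by metis
    have sep: "s i + x \<noteq> s j + x" if "i < j" for i j x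
      using blocks_separate[OF blk that] by simp
    show False
      using no_square[OF l cr[of 0 2] cr[of 1 2, THEN sym] cr[of 1 3] cr[of 0 3, THEN sym]
          same[OF ab(1)] same[OF ab(2)] sep[of 0 1] sep[of 2 3]] by simp
  qed
  show ?thesis
  proof (cases "i < j")
    case True
    then show ?thesis using blocks_cross[OF blk ab True] no[OF ab] by blast
  next
    case False
    then have "j < i" using ij by simp
    then show ?thesis using blocks_cross[OF blk ab(2,1)] no[OF ab(2,1)] sym by blast
  qed
qed

text \<open>
  If \<open>u\<close> changes from a non-neighbour to a neighbour only finitely often along the ray, then it is
  adjacent to all vertices from some point on, and its colour no longer occurs there.
\<close>

lemma hub_tail:
  assumes "infinite {n. E u n}" "finite {n. E u (Suc n) \<and> \<not> E u n}"
  shows "\<exists>N. free_ray (S - {c u}) t l (\<lambda>i j. E (N + i) (N + j)) (\<lambda>i. c (N + i))"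
proof -
  obtain M where M: "\<And>n. E u (Suc n) \<Longrightarrow> \<not> E u n \<Longrightarrow> n < M"
    using assms(2) unfolding finite_nat_set_iff_bounded by blast
  have all: "E u (M + i)" for i
  proof (rule ccontr)
    assume no: "\<not> E u (M + i)"
    have "\<not> E u (M + i + k)" for k
    proof (induction k)
      case (Suc k) then show ?case using M[of "M + i + k"] by auto
    qed (use no in simp)
    then have "{n. E u n} \<subseteq> {..M + i}" by (auto simp: not_le[symmetric]) (metis le_add_diff_inverse nat_le_linear)
    then show False using assms(1) finite_subset by blast
  qed
  then have "c (M + i) \<in> S - {c u}" for i using proper[OF all[of i]] colour by simp
  then show ?thesis unfolding free_ray_def using segment_free by blast
qed

end

text \<open>
  By induction on the number of colours the hub has infinitely many neighbours whose predecessor is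
  not its neighbour. Two of these neighbours with their predecessors and the hub form an induced
  \<open>P\<^sub>5\<close>.
\<close>

lemma no_ray_5_4: "finite S \<Longrightarrow> \<not> free_ray S 5 4 E c"
proof (induction "card S" arbitrary: S E c rule: less_induct)
  case less
  show ?case
  proof
    assume "free_ray S 5 4 E c"
    then interpret ray S 5 4 E c using less.prems by unfold_locales
    obtain u where hu: "infinite {n. E u n}" using hub by blast
    have "card (S - {c u}) < card S" using colour[of u] less.prems by (intro psubset_card_mono) auto
    then have "infinite {n. E u (Suc n) \<and> \<not> E u n}"
      using hub_tail[OF hu] less.hyps[of "S - {c u}"] less.prems by blast
    from blocks_exist[OF this, of u 2] obtain s where blk: "blocks u s 2"
      and rs: "range s \<subseteq> {n. E u (Suc n) \<and> \<not> E u n}" by blast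
    have s: "E u (Suc (s i))" "\<not> E u (s i)" "Suc u < s i" for i
      using rs blocks_above[OF blk] by blast+
    have z: "\<not> E (s 0 + a) (s 1 + b)" if "a < 2" "b < 2" for a b
      using cross_square_free[OF refl blk that] by simp
    have "s 0 + 2 < s 1" using blocks_gap[OF blk, of 0] by simp
    then have "ind_path [s 0, Suc (s 0), u, Suc (s 1), s 1]"
      using s[of 0] s[of 1] z[of 0 0] z[of 0 1] z[of 1 0] z[of 1 1] sym[of u "Suc (s 0)"] sym[of "s 0" u]
        sym[OF step[of "s 1"]] by auto
    from no_ind_path[OF this] show False by simp
  qed
qed

text \<open>
  The hub has infinitely many neighbours, here on level 3, whose predecessor is not its neighbour.
  It suffices to find inside a block an induced path of three vertices that starts on level 3 and is
  otherwise not adjacent to the hub; two copies of it and the hub form an induced \<open>P\<^sub>7\<close>. The path goes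
  through the levels 3, 2, 1, or, if 3 and 1 are adjacent, through the levels 3, 1, 0. The other
  edges that could spoil this would need a fourth colour or complete an induced 4-cycle.
\<close>

lemma no_ray_7_4: "\<not> free_ray S 7 4 E c" if S: "finite S" "card S \<le> 3"
proof
  assume "free_ray S 7 4 E c"
  then interpret ray S 7 4 E c using that by unfold_locales
  have four: False if "c i \<noteq> c j" "c i \<noteq> c k" "c i \<noteq> c h" "c j \<noteq> c k" "c j \<noteq> c h" "c k \<noteq> c h" for i j k h
  proof -
    have "card {c i, c j, c k, c h} = 4" using that by simp
    moreover have "{c i, c j, c k, c h} \<subseteq> S" using colour by blast
    ultimately show False using card_mono[OF S(1), of "{c i, c j, c k, c h}"] S(2) by simp
  qed
  obtain u where hu: "infinite {n. E u n}" using hub by blast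
  have "infinite {n. E u (Suc n) \<and> \<not> E u n}"
  proof
    assume "finite {n. E u (Suc n) \<and> \<not> E u n}"
    then obtain N where "free_ray (S - {c u}) 7 4 (\<lambda>i j. E (N + i) (N + j)) (\<lambda>i. c (N + i))"
      using hub_tail[OF hu] by blast
    then interpret R: ray "S - {c u}" 7 4 "\<lambda>i j. E (N + i) (N + j)" "\<lambda>i. c (N + i)"
      using S by unfold_locales auto
    show False using R.three_colours S colour[of u] by simp
  qed
  then have inf: "infinite {n. E u (n + 3) \<and> \<not> E u (n + 2)}"
  proof (rule contrapos_nn)
    assume fin: "finite {n. E u (n + 3) \<and> \<not> E u (n + 2)}"
    have "{n. E u (Suc n) \<and> \<not> E u n} \<subseteq> (\<lambda>n. n + 2) ` {n. E u (n + 3) \<and> \<not> E u (n + 2)} \<union> {..<2}"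
    proof
      fix n assume n: "n \<in> {n. E u (Suc n) \<and> \<not> E u n}"
      show "n \<in> (\<lambda>n. n + 2) ` {n. E u (n + 3) \<and> \<not> E u (n + 2)} \<union> {..<2}"
      proof (cases "n < 2")
        case False
        then obtain k where "n = k + 2" using le_Suc_ex[of 2 n] by (auto simp: add.commute)
        then show ?thesis using n by (simp add: numeral_eq_Suc)
      qed simp
    qed
    then show "finite {n. E u (Suc n) \<and> \<not> E u n}" using fin finite_subset by blast
  qed
  from blocks_exist[OF inf, of u 4] obtain s where blk: "blocks u s 4"
    and rs: "range s \<subseteq> {n. E u (n + 3) \<and> \<not> E u (n + 2)}" by blast
  have u3: "E u (s i + 3)" and u2: "\<not> E u (s i + 2)" and us: "Suc u < s i" for i
    using rs blocks_above[OF blk] by blast+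
  have z: "\<not> E (s 0 + a) (s 1 + b)" if "a < 4" "b < 4" for a b
    using cross_square_free[OF refl blk that] by simp
  have sep: "s 0 + 4 < s 1" using blocks_gap[OF blk, of 0] by simp
  have st: "E (s i + 1) (s i)" "E (s i + 2) (s i + 1)" "E (s i + 3) (s i + 2)" for i
    using step[of "s i", THEN sym] step[of "s i + 1", THEN sym] step[of "s i + 2", THEN sym]
    by (simp_all add: numeral_eq_Suc)
  have c01: "c (s i) \<noteq> c (s i + 1)" and c23: "c (s i + 2) \<noteq> c (s i + 3)" for i
    using proper[OF st(1)[of i]] proper[OF st(3)[of i]] by auto
  have cu: "c u \<noteq> c (s i + 3)" "c u \<noteq> c (s i + 2)" for i
    using proper[OF u3[of i]] chord[OF u3[of i]] us[of i] by (simp_all add: numeral_eq_Suc)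
  \<comment> \<open>The colours of the hub, of level 2 and of level 3 differ, so a chord from level 1 leaves only
    the colour of the hub for level 1.\<close>
  have c1: "c (s i + 1) = c u" if "E (s i + 1) (s i + 3)" for i
  proof (rule ccontr)
    assume ne: "c (s i + 1) \<noteq> c u"
    have "c (s i + 1) \<noteq> c (s i + 3)" "c (s i + 1) \<noteq> c (s i + 2)"
      using proper[OF that] chord[OF that] by (simp_all add: numeral_eq_Suc)
    then show False using four[of "s i + 1" u "s i + 2" "s i + 3"] ne cu[of i] c23[of i] by simp
  qed
  have u1: "\<not> E u (s i + 1)" for i
  proof
    assume E: "E u (s i + 1)"
    then have "c (s i + 1) \<noteq> c u" using proper by metis
    then have "\<not> E (s i + 3) (s i + 1)" using c1[of i] sym by blast
    then show False
      using no_square[OF refl u3[of i] st(3)[of i] st(2)[of i] sym[OF E] u2[of i]] us[of i] by simp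
  qed
  have tri: "E (s 1 + a) (s 1 + b) \<longleftrightarrow> E (s 0 + a) (s 0 + b)" if "a < 4" "b < 4" for a b
    by (rule blocks_inner[OF blk that])
  show False
  proof (cases "E (s 0 + 1) (s 0 + 3)")
    case False
    have "\<not> E (s i + 3) (s i + 1)" if "i = 0 \<or> i = 1" for i
      using that False tri[of 1 3] sym by auto
    then have "ind_path [s 0 + 1, s 0 + 2, s 0 + 3, u, s 1 + 3, s 1 + 2, s 1 + 1]"
      using st(2,3)[of 0, THEN sym] st(2,3)[of 1] False u3[of 0, THEN sym] u3[of 1] u1 u1[of 0] u2 u2[of 0] sep us[of 0] us[of 1]
        z[of 1 1] z[of 1 2] z[of 1 3] z[of 2 1] z[of 2 2] z[of 2 3] z[of 3 1] z[of 3 2] z[of 3 3]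
      by (auto dest: sym)
    from no_ind_path[OF this] show False by simp
  next
    case True
    have T: "E (s i + 1) (s i + 3)" if "i = 0 \<or> i = 1" for i using that True tri[of 1 3] by auto
    have n03: "\<not> E (s i) (s i + 3)" if "i = 0 \<or> i = 1" for i
    proof
      assume E: "E (s i) (s i + 3)"
      have "c (s i) \<noteq> c (s i + 3)" "c (s i) \<noteq> c (s i + 2)"
        using proper[OF E] chord[OF E] by (simp_all add: numeral_eq_Suc)
      then show False using four[of "s i" u "s i + 2" "s i + 3"] c01[of i] c1[OF T[OF that]] cu[of i] c23[of i] by simp
    qed
    have n0: "\<not> E u (s i)" if "i = 0 \<or> i = 1" for i
    proof
      assume E: "E u (s i)"
      have "\<not> E (s i + 3) (s i)" using n03[OF that] sym by blast
      then show False
        using no_square[OF refl u3[of i] sym[OF T[OF that]] st(1)[of i] sym[OF E] u1[of i]] us[of i] by simp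
    qed
    have "ind_path [s 0, s 0 + 1, s 0 + 3, u, s 1 + 3, s 1 + 1, s 1]"
      using st(1)[of 0, THEN sym] st(1)[of 1] T[of 0] T[of 1, THEN sym] u3[of 0, THEN sym] u3[of 1] u1 u1[of 0]
        n0[of 0] n0[of 1] n03[of 0] n03[of 1] sep us[of 0] us[of 1]
        z[of 0 0] z[of 0 1] z[of 0 3] z[of 1 0] z[of 1 1] z[of 1 3] z[of 3 0] z[of 3 1] z[of 3 3]
      by (auto dest: sym)
    from no_ind_path[OF this] show False by simp
  qed
qed

section \<open>Propagation paths in critical list colouring instances\<close>

definition colourable_on :: "('a \<Rightarrow> 'a \<Rightarrow> bool) \<Rightarrow> ('a \<Rightarrow> nat set) \<Rightarrow> 'a set \<Rightarrow> bool" where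
  "colourable_on E L W \<longleftrightarrow> (\<exists>f. (\<forall>v\<in>W. f v \<in> L v) \<and> (\<forall>v\<in>W. \<forall>w\<in>W. E v w \<longrightarrow> f v \<noteq> f w))"

text \<open>
  Minimality refers to vertex sets, which is the same as minimality among induced subgraphs.
\<close>

definition critical :: "('a \<Rightarrow> 'a \<Rightarrow> bool) \<Rightarrow> ('a \<Rightarrow> nat set) \<Rightarrow> 'a set \<Rightarrow> bool" where
  "critical E L W \<longleftrightarrow> \<not> colourable_on E L W \<and> (\<forall>U. U \<subset> W \<longrightarrow> colourable_on E L U)"

definition reduce :: "('a \<Rightarrow> 'a \<Rightarrow> bool) \<Rightarrow> 'a \<Rightarrow> nat \<Rightarrow> ('a \<Rightarrow> nat set) \<Rightarrow> 'a \<Rightarrow> nat set" where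
  "reduce E v x L = (\<lambda>w. if E v w then L w - {x} else L w)"

text \<open>
  A path on which each vertex is coloured in turn and each next vertex thereby loses a colour of its
  current list.
\<close>

fun propagation :: "('a \<Rightarrow> 'a \<Rightarrow> bool) \<Rightarrow> ('a \<Rightarrow> nat set) \<Rightarrow> ('a \<times> nat) list \<Rightarrow> bool" where
  "propagation E L [] = True"
| "propagation E L [(v, x)] \<longleftrightarrow> x \<in> L v"
| "propagation E L ((v, x) # (w, y) # p) \<longleftrightarrow> x \<in> L v \<and> E v w \<and> x \<in> L w \<and>
     v \<notin> fst ` set ((w, y) # p) \<and> propagation E (reduce E v x L) ((w, y) # p)"

lemma exists_critical:
  assumes "finite W" "\<not> colourable_on E L W"
  shows "\<exists>U\<subseteq>W. critical E L U"
  using assms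
proof (induction W rule: finite_psubset_induct)
  case (psubset W)
  show ?case
  proof (cases "critical E L W")
    case False
    then obtain U where "U \<subset> W" "\<not> colourable_on E L U" using psubset.prems unfolding critical_def by blast
    then show ?thesis using psubset.IH[of U] by blast
  qed blast
qed

text \<open>
  For each colour \<open>x\<close> of \<open>v\<close> there is a critical set \<open>H x\<close> in the rest for the reduced lists. It meets
  the neighbours of \<open>v\<close> that lost \<open>x\<close>, which extends propagation paths by one vertex, and by
  criticality the sets \<open>H x\<close> and \<open>v\<close> exhaust \<open>W\<close>. So the bounds obey \<open>f (r + 1) \<le> 1 + k * f r\<close>.
\<close>

lemma critical_card_le:
  assumes "finite W" "critical E L W" "v \<in> W" "\<And>a b. E a b \<Longrightarrow> E b a \<and> a \<noteq> b" "\<And>w. w \<in> W \<Longrightarrow> L w \<subseteq> {1..k}"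
    "\<And>p. propagation E L p \<Longrightarrow> p \<noteq> [] \<Longrightarrow> fst (hd p) = v \<Longrightarrow> fst ` set p \<subseteq> W \<Longrightarrow> length p \<le> r"
  shows "card W \<le> Suc k ^ r"
  using assms
proof (induction r arbitrary: W L v)
  case 0
  have "L v = {}"
  proof (rule ccontr)
    assume "L v \<noteq> {}"
    then obtain x where "x \<in> L v" by blast
    then have "propagation E L [(v, x)]" by simp
    then show False using "0.prems"(6)[of "[(v, x)]"] "0.prems"(3) by simp
  qed
  then have "\<not> colourable_on E L {v}" unfolding colourable_on_def by simp
  then have "W = {v}" using "0.prems"(2,3) unfolding critical_def by blast
  then show ?case by simp
next
  case (Suc r)
  let ?H = "\<lambda>x H. H \<subseteq> W - {v} \<and> critical E (reduce E v x L) H"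
  have ex: "\<exists>H. ?H x H" if "x \<in> L v" for x
  proof -
    have "\<not> colourable_on E (reduce E v x L) (W - {v})"
    proof
      assume "colourable_on E (reduce E v x L) (W - {v})"
      then obtain f where f: "\<And>w. w \<in> W - {v} \<Longrightarrow> f w \<in> reduce E v x L w"
        "\<And>u w. u \<in> W - {v} \<Longrightarrow> w \<in> W - {v} \<Longrightarrow> E u w \<Longrightarrow> f u \<noteq> f w"
        unfolding colourable_on_def by blast
      have ne: "f w \<noteq> x" if "w \<in> W - {v}" "E v w" for w
        using f(1)[OF that(1)] that(2) unfolding reduce_def by simp
      have "colourable_on E L W"
        unfolding colourable_on_def
      proof (intro exI[of _ "f(v := x)"] conjI ballI impI)
        show "(f(v := x)) w \<in> L w" if "w \<in> W" for w
          using that f(1)[of w] \<open>x \<in> L v\<close> unfolding reduce_def by (auto split: if_splits)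
        show "(f(v := x)) a \<noteq> (f(v := x)) b" if ab: "a \<in> W" "b \<in> W" "E a b" for a b
          using f(2)[of a b] ne[of a] ne[of b] ab Suc.prems(4)[OF ab(3)] by auto
      qed
      then show False using Suc.prems(2) unfolding critical_def by blast
    qed
    from exists_critical[OF _ this] show ?thesis using Suc.prems(1) by blast
  qed
  then obtain H where H: "\<And>x. x \<in> L v \<Longrightarrow> H x \<subseteq> W - {v}"
    "\<And>x. x \<in> L v \<Longrightarrow> critical E (reduce E v x L) (H x)" by metis
  have card_H: "card (H x) \<le> Suc k ^ r" if x: "x \<in> L v" for x
  proof -
    \<comment> \<open>Otherwise \<open>H x\<close> would be uncolourable for the original lists.\<close>
    have "\<exists>w\<in>H x. E v w \<and> x \<in> L w"
    proof (rule ccontr)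
      assume "\<not> ?thesis"
      then have same: "reduce E v x L w = L w" if "w \<in> H x" for w
        using that unfolding reduce_def by auto
      have "H x \<subset> W" using H(1)[OF x] Suc.prems(3) by blast
      then have "colourable_on E L (H x)" using Suc.prems(2) unfolding critical_def by blast
      then have "colourable_on E (reduce E v x L) (H x)" unfolding colourable_on_def using same by metis
      then show False using H(2)[OF x] unfolding critical_def by blast
    qed
    then obtain w where w: "w \<in> H x" "E v w" "x \<in> L w" by blast
    show ?thesis
    proof (rule Suc.IH[OF _ H(2)[OF x] w(1) Suc.prems(4)])
      show "finite (H x)" using H(1)[OF x] Suc.prems(1) by (meson finite_Diff finite_subset)
      show "reduce E v x L u \<subseteq> {1..k}" if "u \<in> H x" for u
        using Suc.prems(5)[of u] H(1)[OF x] that unfolding reduce_def by auto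
      fix p assume p: "propagation E (reduce E v x L) p" "p \<noteq> []" "fst (hd p) = w" "fst ` set p \<subseteq> H x"
      obtain y q where q: "p = (w, y) # q" using p(2,3) by (cases p) auto
      have "propagation E L ((v, x) # p)" using p(1,4) H(1)[OF x] w x unfolding q by auto
      moreover have "fst ` set ((v, x) # p) \<subseteq> W" using p(4) H(1)[OF x] Suc.prems(3) by auto
      ultimately show "length p \<le> r" using Suc.prems(6)[of "(v, x) # p"] by simp
    qed
  qed
  have fin: "finite (L v)" using Suc.prems(5)[OF Suc.prems(3)] finite_subset by blast
  \<comment> \<open>A colouring of the union would give \<open>v\<close> some colour \<open>f v\<close> and thereby colour \<open>H (f v)\<close>.\<close>
  have W: "W = insert v (\<Union>x\<in>L v. H x)"
  proof (rule ccontr)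
    assume ne: "W \<noteq> insert v (\<Union>x\<in>L v. H x)"
    have "insert v (\<Union>x\<in>L v. H x) \<subset> W" using H(1) Suc.prems(3) ne by blast
    then have "colourable_on E L (insert v (\<Union>x\<in>L v. H x))" using Suc.prems(2) unfolding critical_def by blast
    then obtain f where f: "\<And>w. w \<in> insert v (\<Union>x\<in>L v. H x) \<Longrightarrow> f w \<in> L w"
      "\<And>a b. a \<in> insert v (\<Union>x\<in>L v. H x) \<Longrightarrow> b \<in> insert v (\<Union>x\<in>L v. H x) \<Longrightarrow> E a b \<Longrightarrow> f a \<noteq> f b"
      unfolding colourable_on_def by blast
    have fv: "f v \<in> L v" using f(1) by blast
    have "colourable_on E (reduce E v (f v) L) (H (f v))"
      unfolding colourable_on_def
    proof (intro exI[of _ f] conjI ballI impI)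
      fix w assume w: "w \<in> H (f v)"
      have "w \<in> insert v (\<Union>x\<in>L v. H x)" using w fv by blast
      then show "f w \<in> reduce E v (f v) L w" using f(1)[of w] f(2)[of v w] unfolding reduce_def by auto
    next
      fix a b assume "a \<in> H (f v)" "b \<in> H (f v)" "E a b"
      then show "f a \<noteq> f b" using f(2)[of a b] fv by blast
    qed
    then show False using H(2)[OF fv] unfolding critical_def by blast
  qed
  have "(\<Union>x\<in>L v. H x) \<subseteq> W" using H(1) by blast
  then have "finite (\<Union>x\<in>L v. H x)" using Suc.prems(1) finite_subset by blast
  then have "card W \<le> Suc (card (\<Union>x\<in>L v. H x))" by (subst W) (simp add: card_insert_if)
  also have "\<dots> \<le> Suc (\<Sum>x\<in>L v. card (H x))" using card_UN_le[OF fin, of H] by simp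
  also have "\<dots> \<le> Suc (card (L v) * Suc k ^ r)" using sum_bounded_above[of "L v" "\<lambda>x. card (H x)" "Suc k ^ r"] card_H by simp
  also have "\<dots> \<le> Suc (k * Suc k ^ r)"
    using card_mono[OF _ Suc.prems(5)[OF Suc.prems(3)]] by simp
  also have "\<dots> \<le> Suc k ^ Suc r" by simp
  finally show ?case .
qed

lemma reduce_subset: "reduce E v x L w \<subseteq> L w"
  unfolding reduce_def by auto

lemma propagation_mem:
  "propagation E L p \<Longrightarrow> j < length p \<Longrightarrow> snd (p ! j) \<in> L (fst (p ! j))"
proof (induction E L p arbitrary: j rule: propagation.induct)
  case (3 E L v x w y p)
  then show ?case using 3(1)[of "j - 1"] reduce_subset[of E v x L] by (cases j) auto
qed auto

lemma propagation_next:
  "propagation E L p \<Longrightarrow> Suc j < length p \<Longrightarrow> snd (p ! j) \<in> L (fst (p ! Suc j))"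
proof (induction E L p arbitrary: j rule: propagation.induct)
  case (3 E L v x w y p)
  then show ?case using 3(1)[of "j - 1"] reduce_subset[of E v x L] by (cases j) auto
qed auto

lemma propagation_step:
  "propagation E L p \<Longrightarrow> Suc j < length p \<Longrightarrow> E (fst (p ! j)) (fst (p ! Suc j))"
proof (induction E L p arbitrary: j rule: propagation.induct)
  case (3 E L v x w y p)
  then show ?case using 3(1)[of "j - 1"] by (cases j) auto
qed auto

lemma propagation_distinct: "propagation E L p \<Longrightarrow> distinct (map fst p)"
  by (induction E L p rule: propagation.induct) auto

text \<open>
  Just before the vertex on position \<open>j - 1\<close> is coloured, the current list of the vertex on position
  \<open>j\<close> contains the colours on both positions, and it has lost the colours of all neighbours of that
  vertex that come earlier on the path.
\<close>

lemma propagation_chord: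
  assumes "propagation E L p" "i < j" "j < length p" "E (fst (p ! i)) (fst (p ! j))"
  shows "snd (p ! i) \<noteq> snd (p ! j)" and "Suc i < j \<Longrightarrow> snd (p ! i) \<noteq> snd (p ! (j - 1))"
proof -
  have "snd (p ! i) \<noteq> snd (p ! j) \<and> (Suc i < j \<longrightarrow> snd (p ! i) \<noteq> snd (p ! (j - 1)))"
    using assms
  proof (induction E L p arbitrary: i j rule: propagation.induct)
    case (3 E L v x w y p)
    show ?case
    proof (cases i)
      case 0
      let ?q = "(w, y) # p"
      have q: "propagation E (reduce E v x L) ?q" "j - 1 < length ?q" "E v (fst (?q ! (j - 1)))"
        using 3(2-) 0 by auto
      have "snd (?q ! (j - 1)) \<noteq> x" using propagation_mem[OF q(1,2)] q(3) unfolding reduce_def by auto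
      moreover have "snd (?q ! (j - 2)) \<noteq> x" if "Suc 0 < j"
      proof -
        have "Suc (j - 2) < length ?q" "Suc (j - 2) = j - 1" using that q(2) by auto
        then show ?thesis using propagation_next[OF q(1), of "j - 2"] q(3) unfolding reduce_def by auto
      qed
      moreover have "((v, x) # ?q) ! j = ?q ! (j - 1)" "Suc 0 < j \<Longrightarrow> ((v, x) # ?q) ! (j - 1) = ?q ! (j - 2)"
        using 3(3) 0 by (auto simp: nth_Cons' numeral_2_eq_2)
      ultimately show ?thesis using 0 by auto
    next
      case (Suc i')
      have j: "j = Suc (j - 1)" using 3(3) by simp
      have "propagation E (reduce E v x L) ((w, y) # p)" using 3(2) by simp
      moreover have "i' < j - 1" "j - 1 < length ((w, y) # p)" using 3(3,4) Suc by auto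
      moreover have "E (fst (((w, y) # p) ! i')) (fst (((w, y) # p) ! (j - 1)))"
        using 3(5) Suc j by (metis nth_Cons_Suc)
      ultimately have "snd (((w, y) # p) ! i') \<noteq> snd (((w, y) # p) ! (j - 1)) \<and>
          (Suc i' < j - 1 \<longrightarrow> snd (((w, y) # p) ! i') \<noteq> snd (((w, y) # p) ! (j - 1 - 1)))"
        using 3(1) by blast
      moreover have "((v, x) # (w, y) # p) ! i = ((w, y) # p) ! i'" using Suc by simp
      moreover have "((v, x) # (w, y) # p) ! j = ((w, y) # p) ! (j - 1)" by (subst j) simp
      moreover have "((v, x) # (w, y) # p) ! (j - 1) = ((w, y) # p) ! (j - 1 - 1)" if "Suc i' < j - 1"
        using that by (auto simp: nth_Cons')
      ultimately show ?thesis using Suc by auto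
    qed
  qed auto
  then show "snd (p ! i) \<noteq> snd (p ! j)" "Suc i < j \<Longrightarrow> snd (p ! i) \<noteq> snd (p ! (j - 1))" by auto
qed

lemma propagation_free_path:
  assumes p: "propagation E L p" and L: "\<And>v. v \<in> fst ` set p \<Longrightarrow> L v \<subseteq> {1..k}"
    and E: "\<And>a b. E a b \<Longrightarrow> E b a \<and> a \<noteq> b"
    and free: "\<And>h H f. h = t \<and> H = path_adj \<or> h = l \<and> H = cycle_adj l \<Longrightarrow> inj_on f {..<h} \<Longrightarrow>
      f ` {..<h} \<subseteq> fst ` set p \<Longrightarrow> (\<And>i j. i < h \<Longrightarrow> j < h \<Longrightarrow> E (f i) (f j) \<longleftrightarrow> H i j) \<Longrightarrow> False"
  shows "free_path {1..k} t l (length p) (\<lambda>i j. E (fst (p ! i)) (fst (p ! j))) (\<lambda>i. snd (p ! i))"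
proof -
  have "coloured_path {1..k} (length p) (\<lambda>i j. E (fst (p ! i)) (fst (p ! j))) (\<lambda>i. snd (p ! i))"
    unfolding coloured_path_def
  proof (intro conjI allI impI)
    fix i assume "i < length p"
    then show "snd (p ! i) \<in> {1..k}" using propagation_mem[OF p, of i] L[of "fst (p ! i)"] by auto
  next
    fix i j assume ij: "i < length p" "j < length p" "E (fst (p ! i)) (fst (p ! j))"
    show "E (fst (p ! j)) (fst (p ! i))" using E[OF ij(3)] by blast
    show "snd (p ! i) \<noteq> snd (p ! j)"
      using propagation_chord(1)[OF p, of i j] propagation_chord(1)[OF p, of j i] ij E[OF ij(3)]
      by (cases i j rule: linorder_cases) auto
  next
    fix i assume "Suc i < length p"
    then show "E (fst (p ! i)) (fst (p ! Suc i))" by (rule propagation_step[OF p])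
  next
    fix i j assume "Suc i < j \<and> j < length p \<and> E (fst (p ! i)) (fst (p ! j))"
    then show "snd (p ! i) \<noteq> snd (p ! (j - 1))" using propagation_chord(2)[OF p, of i j] by simp
  qed
  moreover have "\<not> embeds h H (length p) (\<lambda>i j. E (fst (p ! i)) (fst (p ! j)))"
    if hH: "h = t \<and> H = path_adj \<or> h = l \<and> H = cycle_adj l" for h H
  proof
    assume "embeds h H (length p) (\<lambda>i j. E (fst (p ! i)) (fst (p ! j)))"
    then obtain f where inj: "inj_on f {..<h}" and im: "f ` {..<h} \<subseteq> {..<length p}"
      and adj: "\<forall>i<h. \<forall>j<h. E (fst (p ! f i)) (fst (p ! f j)) \<longleftrightarrow> H i j"
      unfolding embeds_def by (elim exE conjE)
    have lt: "f i < length p" if "i < h" for i using im that by blast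
    show False
    proof (rule free[OF hH, of "\<lambda>i. fst (p ! f i)"])
      show "inj_on (\<lambda>i. fst (p ! f i)) {..<h}"
      proof (rule inj_onI)
        fix i j assume ij: "i \<in> {..<h}" "j \<in> {..<h}" "fst (p ! f i) = fst (p ! f j)"
        then have "map fst p ! f i = map fst p ! f j" using lt by simp
        then have "f i = f j"
          using nth_eq_iff_index_eq[OF propagation_distinct[OF p], of "f i" "f j"] lt ij(1,2) by simp
        then show "i = j" using inj ij unfolding inj_on_def by blast
      qed
      show "(\<lambda>i. fst (p ! f i)) ` {..<h} \<subseteq> fst ` set p" using lt by auto
      show "E (fst (p ! f i)) (fst (p ! f j)) \<longleftrightarrow> H i j" if "i < h" "j < h" for i j
        using adj that by blast
    qed
  qed
  ultimately show ?thesis unfolding free_path_def by blast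
qed

section \<open>Graphs, isomorphism classes and induced subgraphs\<close>

text \<open>
  On a graph without parallel arcs an isomorphism of digraphs is determined by its action on the
  vertices.
\<close>

definition graph_map :: "('a \<Rightarrow> 'b) \<Rightarrow> 'a pair_pre_digraph \<Rightarrow> 'b pair_pre_digraph \<Rightarrow> bool" where
  "graph_map h G H \<longleftrightarrow> inj_on h (pverts G) \<and> pverts H = h ` pverts G \<and> parcs H = map_prod h h ` parcs G"

lemma arcs_in_verts: "parcs G \<subseteq> pverts G \<times> pverts G" if "pair_graph G"
proof -
  interpret pair_graph G by fact
  show ?thesis using in_arcsD1 in_arcsD2 by fastforce
qed

lemma wf_with_proj: "wf_digraph (with_proj G)" if "pair_graph G"
proof -
  interpret pair_graph G by fact
  show ?thesis by (rule wf_digraph_axioms)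
qed

lemma graph_mapI:
  assumes "pre_digraph.digraph_isomorphism (with_proj G) f" "with_proj H = app_iso f (with_proj G)"
  shows "graph_map (iso_verts f) G H"
proof -
  have H: "pverts H = iso_verts f ` pverts G" "parcs H = iso_arcs f ` parcs G" "iso_tail f = fst" "iso_head f = snd"
    using arg_cong[OF assms(2), of verts] arg_cong[OF assms(2), of arcs]
      arg_cong[OF assms(2), of tail] arg_cong[OF assms(2), of head]
    by (simp_all add: app_iso_def)
  have iso: "inj_on (iso_verts f) (pverts G)"
    "\<forall>a\<in>parcs G. iso_verts f (fst a) = fst (iso_arcs f a) \<and> iso_verts f (snd a) = snd (iso_arcs f a)"
    using assms(1) H(3,4) unfolding pre_digraph.digraph_isomorphism_def by simp_all
  then have "iso_arcs f a = map_prod (iso_verts f) (iso_verts f) a" if "a \<in> parcs G" for a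
    using that by (metis map_prod_simp prod.collapse)
  then have "iso_arcs f ` parcs G = map_prod (iso_verts f) (iso_verts f) ` parcs G"
    by (rule image_cong[OF refl])
  then show ?thesis using H iso unfolding graph_map_def by simp
qed

lemma graph_mapD:
  assumes "pair_graph G" "graph_map h G H"
  shows "\<exists>f. iso_verts f = h \<and> pre_digraph.digraph_isomorphism (with_proj G) f \<and>
    with_proj H = app_iso f (with_proj G)"
proof -
  define f where "f = \<lparr>iso_verts = h, iso_arcs = map_prod h h, iso_head = snd, iso_tail = fst\<rparr>"
  have inj: "inj_on (map_prod h h) (parcs G)"
    using inj_on_subset[OF map_prod_inj_on arcs_in_verts[OF assms(1)]] assms(2)
    unfolding graph_map_def by blast
  then have "pre_digraph.digraph_isomorphism (with_proj G) f"
    using assms wf_with_proj[OF assms(1)] unfolding pre_digraph.digraph_isomorphism_def graph_map_def f_def by simp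
  moreover have "with_proj H = app_iso f (with_proj G)"
    using assms(2) unfolding graph_map_def app_iso_def f_def with_proj_def by simp
  moreover have "iso_verts f = h" unfolding f_def by simp
  ultimately show ?thesis by blast
qed

lemma graph_map_comp: "graph_map g G K" if "graph_map h G H" "graph_map h' H K" "g = h' \<circ> h"
  using that unfolding graph_map_def by (auto simp: comp_inj_on image_comp map_prod.comp)

lemma induced_subgraph_on:
  assumes "pair_graph G" "W \<subseteq> pverts G"
  shows "induced_subgraph (with_proj \<lparr>pverts = W, parcs = parcs G \<inter> W \<times> W\<rparr>) (with_proj G)"
proof -
  have "wf_digraph (with_proj \<lparr>pverts = W, parcs = parcs G \<inter> W \<times> W\<rparr>)" by unfold_locales auto
  then show ?thesis
    using assms wf_with_proj[OF assms(1)]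
    unfolding induced_subgraph_def subgraph_def compatible_def by auto
qed

lemma induced_free_no_copy:
  assumes G: "pair_graph G" and free: "induced_free \<H> G" and H: "H \<in> \<H>" "pair_graph H"
    and f: "inj_on f (pverts H)" "f ` pverts H \<subseteq> pverts G"
      "\<And>i j. i \<in> pverts H \<Longrightarrow> j \<in> pverts H \<Longrightarrow> (f i, f j) \<in> parcs G \<longleftrightarrow> (i, j) \<in> parcs H"
  shows False
proof -
  let ?W = "f ` pverts H"
  let ?S = "\<lparr>pverts = ?W, parcs = parcs G \<inter> ?W \<times> ?W\<rparr>"
  have "parcs G \<inter> ?W \<times> ?W = map_prod f f ` parcs H"
    using f(3) arcs_in_verts[OF H(2)] by fastforce
  then have "graph_map f H ?S" using f(1) unfolding graph_map_def by simp
  then have "digraph_iso (with_proj H) (with_proj ?S)"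
    using graph_mapD[OF H(2)] unfolding digraph_iso_def by blast
  then show False using free H(1) induced_subgraph_on[OF G f(2)] unfolding induced_free_def by blast
qed

lemma finite_up_toI:
  assumes "finite (\<phi> ` S)" "\<And>x y z. x \<in> S \<Longrightarrow> y \<in> S \<Longrightarrow> z \<in> S \<Longrightarrow> \<phi> x = \<phi> y \<Longrightarrow> R x z \<Longrightarrow> R y z"
  shows "finite_up_to R S"
proof -
  let ?cls = "\<lambda>x. {z \<in> S. R x z}"
  have cong: "?cls x = ?cls y" if "x \<in> S" "y \<in> S" "\<phi> x = \<phi> y" for x y
    using assms(2)[OF that(1,2)] assms(2)[OF that(2,1)] that(3) by auto
  have "S // {(x, y) \<in> S \<times> S. R x y} = ?cls ` S"
    unfolding quotient_def by auto
  also have "\<dots> = (\<lambda>y. ?cls (inv_into S \<phi> y)) ` \<phi> ` S"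
    unfolding image_image
    by (intro image_cong refl cong) (auto simp: inv_into_into f_inv_into_f)
  finally show ?thesis unfolding finite_up_to_def using assms(1) by simp
qed

text \<open>
  A graph with lists, of bounded order, is determined up to isomorphism by a copy on \<open>{0..<n}\<close> with
  lists in \<open>{1..k}\<close>, and there are finitely many such copies.
\<close>

lemma finite_up_to_bounded:
  fixes gr :: "'x \<Rightarrow> 'a pair_pre_digraph" and li :: "'x \<Rightarrow> 'a \<Rightarrow> nat set"
  assumes gr: "\<And>x. x \<in> S \<Longrightarrow> pair_graph (gr x)" and card: "\<And>x. x \<in> S \<Longrightarrow> card (pverts (gr x)) \<le> N"
    and li: "\<And>x v. x \<in> S \<Longrightarrow> v \<in> pverts (gr x) \<Longrightarrow> li x v \<subseteq> {1..k}"
    and R: "\<And>x y. x \<in> S \<Longrightarrow> y \<in> S \<Longrightarrow>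
      R x y \<longleftrightarrow> (\<exists>h. graph_map h (gr x) (gr y) \<and> (\<forall>v\<in>pverts (gr x). li y (h v) = li x v))"
  shows "finite_up_to R S"
proof -
  have finV: "finite (pverts (gr x))" if "x \<in> S" for x
  proof -
    interpret pair_graph "gr x" using gr[OF that] .
    show ?thesis by simp
  qed
  have "\<exists>e. bij_betw e (pverts (gr x)) {0..<card (pverts (gr x))}" if "x \<in> S" for x
    using ex_bij_betw_finite_nat[OF finV[OF that]] .
  then obtain e where e: "\<And>x. x \<in> S \<Longrightarrow> bij_betw (e x) (pverts (gr x)) {0..<card (pverts (gr x))}" by metis
  define num where "num x = inv_into (pverts (gr x)) (e x)" for x
  define \<phi> where "\<phi> x = (card (pverts (gr x)), map_prod (e x) (e x) ` parcs (gr x),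
    map (\<lambda>i. li x (num x i)) [0..<card (pverts (gr x))])" for x
  have num: "num x (e x v) = v" if "x \<in> S" "v \<in> pverts (gr x)" for x v
    unfolding num_def using bij_betw_imp_inj_on[OF e[OF that(1)]] that(2) by simp
  have numV: "num x i \<in> pverts (gr x)" "e x (num x i) = i" if "x \<in> S" "i < card (pverts (gr x))" for x i
    unfolding num_def using bij_betw_imp_surj_on[OF e[OF that(1)]] that(2)
    by (auto intro!: inv_into_into f_inv_into_f)
  have evl: "e x v < card (pverts (gr x))" if "x \<in> S" "v \<in> pverts (gr x)" for x v
    using bij_betwE[OF e[OF that(1)]] that(2) by auto
  have "finite (\<phi> ` S)"
  proof (rule finite_subset)
    show "\<phi> ` S \<subseteq> {..N} \<times> Pow ({..<N} \<times> {..<N}) \<times> {xs. set xs \<subseteq> Pow {1..k} \<and> length xs \<le> N}"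
    proof
      fix y assume "y \<in> \<phi> ` S"
      then obtain x where x: "x \<in> S" and y: "y = \<phi> x" by blast
      have "map_prod (e x) (e x) ` parcs (gr x) \<subseteq> {..<N} \<times> {..<N}"
        using evl[OF x] card[OF x] arcs_in_verts[OF gr[OF x]] by fastforce
      moreover have "set (map (\<lambda>i. li x (num x i)) [0..<card (pverts (gr x))]) \<subseteq> Pow {1..k}"
      proof -
        have "li x (num x i) \<in> Pow {1..k}" if "i < card (pverts (gr x))" for i
          using li[OF x numV(1)[OF x that]] by simp
        then show ?thesis unfolding set_map by (intro image_subsetI) simp
      qed
      ultimately show "y \<in> {..N} \<times> Pow ({..<N} \<times> {..<N}) \<times> {xs. set xs \<subseteq> Pow {1..k} \<and> length xs \<le> N}"
        unfolding y \<phi>_def using card[OF x] by simp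
    qed
    show "finite ({..N} \<times> Pow ({..<N} \<times> {..<N}) \<times> {xs. set xs \<subseteq> Pow {1..k :: nat} \<and> length xs \<le> N})"
      by (intro finite_cartesian_product finite_lists_length_le) auto
  qed
  moreover have "R y z" if S: "x \<in> S" "y \<in> S" "z \<in> S" and eq: "\<phi> x = \<phi> y" and xz: "R x z" for x y z
  proof -
    have cd: "card (pverts (gr x)) = card (pverts (gr y))"
      and ar: "map_prod (e x) (e x) ` parcs (gr x) = map_prod (e y) (e y) ` parcs (gr y)"
      and ls: "map (\<lambda>i. li x (num x i)) [0..<card (pverts (gr x))] = map (\<lambda>i. li y (num y i)) [0..<card (pverts (gr y))]"
      using eq unfolding \<phi>_def prod.inject by blast+
    define g where "g v = num x (e y v)" for v
    have "inj_on g (pverts (gr y))"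
    proof (rule inj_onI)
      fix v w assume v: "v \<in> pverts (gr y)" "w \<in> pverts (gr y)" "g v = g w"
      then have "e y v = e y w"
        using numV(2)[OF S(1)] evl[OF S(2)] cd unfolding g_def by metis
      then show "v = w" using num[OF S(2)] v by metis
    qed
    moreover have "g ` pverts (gr y) = pverts (gr x)"
    proof
      show "g ` pverts (gr y) \<subseteq> pverts (gr x)" using numV(1)[OF S(1)] evl[OF S(2)] cd unfolding g_def by auto
      show "pverts (gr x) \<subseteq> g ` pverts (gr y)"
      proof
        fix v assume v: "v \<in> pverts (gr x)"
        have i: "e x v < card (pverts (gr y))" using evl[OF S(1) v] cd by simp
        have "g (num y (e x v)) = v" unfolding g_def using numV(2)[OF S(2) i] num[OF S(1) v] by simp
        then show "v \<in> g ` pverts (gr y)" using numV(1)[OF S(2) i] by (metis imageI)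
      qed
    qed
    moreover have "map_prod g g ` parcs (gr y) = parcs (gr x)"
    proof -
      have "map_prod g g ` parcs (gr y) = map_prod (num x) (num x) ` map_prod (e y) (e y) ` parcs (gr y)"
        unfolding image_image g_def by (intro image_cong refl) auto
      also have "\<dots> = map_prod (num x) (num x) ` map_prod (e x) (e x) ` parcs (gr x)" using ar by simp
      also have "\<dots> = id ` parcs (gr x)"
        unfolding image_image using arcs_in_verts[OF gr[OF S(1)]] num[OF S(1)] by (intro image_cong refl) auto
      finally show ?thesis by simp
    qed
    ultimately have g: "graph_map g (gr y) (gr x)" unfolding graph_map_def by simp
    have lg: "li x (g v) = li y v" if v: "v \<in> pverts (gr y)" for v
    proof -
      have i: "e y v < card (pverts (gr y))" using evl[OF S(2) v] .
      have "li x (num x (e y v)) = li y (num y (e y v))"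
        using arg_cong[OF ls, of "\<lambda>xs. xs ! e y v"] i cd by simp
      then show ?thesis unfolding g_def using num[OF S(2) v] by simp
    qed
    obtain h where h: "graph_map h (gr x) (gr z)" "\<forall>v\<in>pverts (gr x). li z (h v) = li x v"
      using xz R[OF S(1,3)] by blast
    have "graph_map (h \<circ> g) (gr y) (gr z)" using graph_map_comp[OF g h(1) refl] .
    moreover have "\<forall>v\<in>pverts (gr y). li z ((h \<circ> g) v) = li y v"
      using h(2) lg g unfolding graph_map_def by auto
    ultimately show "R y z" using R[OF S(2,3)] by blast
  qed
  ultimately show ?thesis by (rule finite_up_toI)
qed

lemma list_instance_iso_iff:
  assumes "pair_graph G"
  shows "list_instance_iso (G, L) (G', L') \<longleftrightarrow>
    (\<exists>h. graph_map h G G' \<and> (\<forall>v\<in>pverts G. L' (h v) = L v))"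
  unfolding list_instance_iso_def using graph_mapI graph_mapD[OF assms] by fastforce

lemma graph_iso_iff:
  assumes "pair_graph G"
  shows "graph_iso G H \<longleftrightarrow> (\<exists>h. graph_map h G H)"
  unfolding graph_iso_def digraph_iso_def using graph_mapI graph_mapD[OF assms] by blast

lemma list_obstruction_critical:
  assumes "minimal_list_obstruction k (G, L)"
  shows "pair_graph G" "critical (\<lambda>v w. (v, w) \<in> parcs G) L (pverts G)"
    "\<And>v. v \<in> pverts G \<Longrightarrow> L v \<subseteq> {1..k}"
proof -
  have ob: "list_coloring_instance k (G, L)" "\<not> list_colorable (G, L)"
    "\<And>H :: 'a pair_pre_digraph. induced_subgraph (with_proj H) (with_proj G) \<Longrightarrow> H \<noteq> G \<Longrightarrow>
      list_colorable (H, restrict L (pverts H))"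
    using assms unfolding minimal_list_obstruction_def by auto
  show G: "pair_graph G" and "\<And>v. v \<in> pverts G \<Longrightarrow> L v \<subseteq> {1..k}"
    using ob(1) unfolding list_coloring_instance_def by (auto dest: PiE_mem)
  show "critical (\<lambda>v w. (v, w) \<in> parcs G) L (pverts G)"
    unfolding critical_def
  proof (intro conjI allI impI)
    show "\<not> colourable_on (\<lambda>v w. (v, w) \<in> parcs G) L (pverts G)"
      using ob(2) arcs_in_verts[OF G] unfolding list_colorable_def colourable_on_def by fastforce
    fix U assume U: "U \<subset> pverts G"
    let ?H = "\<lparr>pverts = U, parcs = parcs G \<inter> U \<times> U\<rparr>"
    have "?H \<noteq> G" using U by (metis pair_pre_digraph.select_convs(1) psubset_eq)
    then have "list_colorable (?H, restrict L U)"
      using ob(3)[OF induced_subgraph_on[OF G]] U by auto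
    then show "colourable_on (\<lambda>v w. (v, w) \<in> parcs G) L U"
      unfolding list_colorable_def colourable_on_def by fastforce
  qed
qed

lemma obstruction_critical:
  assumes "minimal_obstruction k G"
  shows "pair_graph G" "critical (\<lambda>v w. (v, w) \<in> parcs G) (\<lambda>_. {1..k}) (pverts G)"
proof -
  show G: "pair_graph G" using assms unfolding minimal_obstruction_def by blast
  show "critical (\<lambda>v w. (v, w) \<in> parcs G) (\<lambda>_. {1..k}) (pverts G)"
    unfolding critical_def
  proof (intro conjI allI impI)
    show "\<not> colourable_on (\<lambda>v w. (v, w) \<in> parcs G) (\<lambda>_. {1..k}) (pverts G)"
      using assms arcs_in_verts[OF G] unfolding minimal_obstruction_def colorable_def colourable_on_def by fastforce
    fix U assume U: "U \<subset> pverts G"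
    let ?H = "\<lparr>pverts = U, parcs = parcs G \<inter> U \<times> U\<rparr>"
    have "?H \<noteq> G" using U by (metis pair_pre_digraph.select_convs(1) psubset_eq)
    then have "colorable k ?H"
      using assms induced_subgraph_on[OF G] U unfolding minimal_obstruction_def by blast
    then show "colourable_on (\<lambda>v w. (v, w) \<in> parcs G) (\<lambda>_. {1..k}) U"
      unfolding colorable_def colourable_on_def by fastforce
  qed
qed

lemma graph_adj:
  assumes "pair_graph G" "(a, b) \<in> parcs G"
  shows "(b, a) \<in> parcs G \<and> a \<noteq> b"
proof -
  interpret pair_graph G by fact
  show ?thesis using arcs_symmetric[OF assms(2)] no_loops[OF assms(2)] by simp
qed

lemma critical_graph_card_le:
  assumes G: "pair_graph G" and crit: "critical (\<lambda>v w. (v, w) \<in> parcs G) L (pverts G)"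
    and L: "\<And>v. v \<in> pverts G \<Longrightarrow> L v \<subseteq> {1..k}"
    and short: "\<And>p. propagation (\<lambda>v w. (v, w) \<in> parcs G) L p \<Longrightarrow> p \<noteq> [] \<Longrightarrow> fst ` set p \<subseteq> pverts G \<Longrightarrow> length p \<le> R"
  shows "card (pverts G) \<le> Suc k ^ R"
proof -
  interpret pair_graph G by (rule G)
  have "pverts G \<noteq> {}" using crit unfolding critical_def colourable_on_def by auto
  then obtain v where "v \<in> pverts G" by blast
  from critical_card_le[OF _ crit this graph_adj[OF G] L short] show ?thesis by simp
qed

lemma finite_free_list_obstructions:
  assumes l: "l = 3 \<or> l = 4" and no: "\<And>E c. \<not> free_ray {1..k} t l E c"
  shows "finite_up_to list_instance_iso (free_list_obstructions k t l :: 'a list_instance set)"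
proof -
  obtain R where R: "\<And>n E c. free_path {1..k} t l n E c \<Longrightarrow> n < R"
    using free_path_bound[OF _ no] by auto
  let ?S = "free_list_obstructions k t l :: 'a list_instance set"
  show ?thesis
  proof (rule finite_up_to_bounded[where gr = fst and li = snd and N = "Suc k ^ R" and k = k])
    fix x assume "x \<in> ?S"
    then obtain G L where x: "x = (G, L)" and ob: "minimal_list_obstruction k (G, L)"
      and fr: "induced_free {path_graph t, cycle_graph l} G"
      unfolding free_list_obstructions_def by auto
    note G = list_obstruction_critical[OF ob]
    show "pair_graph (fst x)" using G(1) x by simp
    show "snd x v \<subseteq> {1..k}" if "v \<in> pverts (fst x)" for v using G(3) x that by simp
    have "card (pverts G) \<le> Suc k ^ R"
    proof (rule critical_graph_card_le[OF G])
      fix p assume p: "propagation (\<lambda>v w. (v, w) \<in> parcs G) L p" "fst ` set p \<subseteq> pverts G"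
      have "free_path {1..k} t l (length p)
          (\<lambda>i j. (fst (p ! i), fst (p ! j)) \<in> parcs G) (\<lambda>i. snd (p ! i))"
      proof (rule propagation_free_path[OF p(1) _ graph_adj[OF G(1)]])
        show "L v \<subseteq> {1..k}" if "v \<in> fst ` set p" for v using G(3) p(2) that by blast
        fix h H and f :: "nat \<Rightarrow> 'a"
        assume h: "h = t \<and> H = path_adj \<or> h = l \<and> H = cycle_adj l" and inj: "inj_on f {..<h}"
          and im: "f ` {..<h} \<subseteq> fst ` set p"
          and adj: "\<And>i j. i < h \<Longrightarrow> j < h \<Longrightarrow> (f i, f j) \<in> parcs G \<longleftrightarrow> H i j"
        have im': "f ` {..<h} \<subseteq> pverts G" using im p(2) by blast
        from h show False
        proof
          assume h: "h = t \<and> H = path_adj"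
          show False
            by (rule induced_free_no_copy[OF G(1) fr _ pair_graph_path_graph[of t], of f])
              (use h inj im' adj in \<open>auto simp: path_graph_def path_adj_def\<close>)
        next
          assume h: "h = l \<and> H = cycle_adj l"
          have "3 \<le> l" using l by auto
          then have cyc: "pair_graph (cycle_graph l)" by (rule pair_graph_cycle_graph)
          show False
            by (rule induced_free_no_copy[OF G(1) fr _ cyc, of f])
              (use h inj im' adj in \<open>auto simp: cycle_graph_def cycle_adj_def\<close>)
        qed
      qed
      then show "length p \<le> R" using R by (meson less_imp_le)
    qed
    then show "card (pverts (fst x)) \<le> Suc k ^ R" using x by simp
  next
    fix x y assume "x \<in> ?S" "y \<in> ?S"
    then obtain G L G' L' where x: "x = (G, L)" "y = (G', L')" and "minimal_list_obstruction k (G, L)"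
      unfolding free_list_obstructions_def by auto
    then have "pair_graph G" using list_obstruction_critical(1) by blast
    then show "list_instance_iso x y \<longleftrightarrow>
        (\<exists>h. graph_map h (fst x) (fst y) \<and> (\<forall>v\<in>pverts (fst x). snd y (h v) = snd x v))"
      unfolding x fst_conv snd_conv by (rule list_instance_iso_iff)
  qed
qed

lemma propagation_vpath:
  assumes "propagation (\<lambda>v w. (v, w) \<in> parcs G) L p" "p \<noteq> []" "fst ` set p \<subseteq> pverts G"
  shows "vpath (map fst p) (with_proj G)"
proof -
  have walk: "set (vwalk_arcs q) \<subseteq> A" if "\<And>i. Suc i < length q \<Longrightarrow> (q ! i, q ! Suc i) \<in> A" for q :: "'a list" and A
    using that
  proof (induction q rule: vwalk_arcs.induct)
    case (3 x y q)
    have "(x, y) \<in> A" using 3(2)[of 0] by simp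
    moreover have "set (vwalk_arcs (y # q)) \<subseteq> A" using 3(1) 3(2)[of "Suc _"] by simp
    ultimately show ?case by simp
  qed auto
  have "set (vwalk_arcs (map fst p)) \<subseteq> parcs G"
    by (rule walk) (simp add: propagation_step[OF assms(1)])
  then show ?thesis
    using assms(2,3) propagation_distinct[OF assms(1)] unfolding vpath_def vwalk_def by simp
qed

text \<open>
  For two chords from consecutive vertices \<open>i\<close> and \<open>i + 1\<close> to \<open>j\<close>, the colours on the positions \<open>i\<close>,
  \<open>i + 1\<close>, \<open>j - 1\<close> and \<open>j\<close> would be four different ones among three. So propagation paths are short.
\<close>

lemma finite_chord_pair_obstructions:
  fixes \<C> :: "'a pair_pre_digraph set"
  assumes "long_paths_have_chord_pair \<C>"
  shows "finite_up_to graph_iso {G \<in> \<C>. minimal_obstruction 3 G}"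
proof -
  obtain R where R: "\<And>G p. G \<in> \<C> \<Longrightarrow> vpath p (with_proj G) \<Longrightarrow> R \<le> length p \<Longrightarrow>
      \<exists>i j. i + 2 < length p \<and> i + 1 < j \<and> chord G p i j \<and> chord G p (i + 1) j"
    using assms unfolding long_paths_have_chord_pair_def by blast
  show ?thesis
  proof (rule finite_up_to_bounded[where gr = id and li = "\<lambda>_ _. {}" and N = "Suc 3 ^ R" and k = 0])
    fix G assume "G \<in> {G \<in> \<C>. minimal_obstruction 3 G}"
    then have GC: "G \<in> \<C>" and ob: "minimal_obstruction 3 G" by auto
    note G = obstruction_critical[OF ob]
    show "pair_graph (id G)" using G(1) by simp
    have "card (pverts G) \<le> Suc 3 ^ R"
    proof (rule critical_graph_card_le[OF G])
      fix p assume p: "propagation (\<lambda>v w. (v, w) \<in> parcs G) (\<lambda>_. {1..3}) p" "p \<noteq> []" "fst ` set p \<subseteq> pverts G"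
      show "length p \<le> R"
      proof (rule ccontr)
        assume "\<not> length p \<le> R"
        then obtain i j where ij: "i + 2 < length p" "i + 1 < j" and ch: "chord G (map fst p) i j" "chord G (map fst p) (i + 1) j"
          using R[OF GC propagation_vpath[OF p]] by auto
        define c where "c i = snd (p ! i)" for i
        have j: "j < length p" "j \<noteq> i + 2" and a: "(fst (p ! i), fst (p ! j)) \<in> parcs G"
          "(fst (p ! (i + 1)), fst (p ! j)) \<in> parcs G"
          using ch ij unfolding chord_def by auto
        have n: "c i \<noteq> c j" "c i \<noteq> c (j - 1)" "c (i + 1) \<noteq> c j" "c (i + 1) \<noteq> c (j - 1)"
          using propagation_chord[OF p(1) _ j(1) a(1)] propagation_chord[OF p(1) _ j(1) a(2)] ij j(2)
          unfolding c_def by auto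
        have "c i \<noteq> c (i + 1)" "c (j - 1) \<noteq> c j"
          using propagation_chord(1)[OF p(1), of i "i + 1"] propagation_step[OF p(1), of i]
            propagation_chord(1)[OF p(1), of "j - 1" j] propagation_step[OF p(1), of "j - 1"] ij j
          unfolding c_def by auto
        then have "card {c i, c (i + 1), c (j - 1), c j} = 4" using n by auto
        moreover have "{c i, c (i + 1), c (j - 1), c j} \<subseteq> {1..3}"
          using propagation_mem[OF p(1), of i] propagation_mem[OF p(1), of "i + 1"]
            propagation_mem[OF p(1), of "j - 1"] propagation_mem[OF p(1), of j] ij j unfolding c_def by auto
        ultimately show False using card_mono[of "{1..3 :: nat}" "{c i, c (i + 1), c (j - 1), c j}"] by simp
      qed
    qed simp
    then show "card (pverts (id G)) \<le> Suc 3 ^ R" by simp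
  next
    fix G H assume "G \<in> {G \<in> \<C>. minimal_obstruction 3 G}"
    then have "pair_graph G" using obstruction_critical(1) by blast
    then show "graph_iso G H \<longleftrightarrow> (\<exists>h. graph_map h (id G) (id H) \<and> (\<forall>v\<in>pverts (id G). {} = {}))"
      using graph_iso_iff by auto
  qed simp
qed

section \<open>Finiteness of the sets of minimal obstructions\<close>

theorem theorem1p5:
  shows
    "(\<forall>(k, t, l) \<in> {(3, 7, 3), (3, 7, 4), (4, 6, 3), (4, 5, 4), (5, 5, 3)}.
        finite_up_to list_instance_iso (free_list_obstructions k t l :: 'a list_instance set)) \<and>
     (\<forall>\<C> :: 'a pair_pre_digraph set.
        (\<forall>G\<in>\<C>. pair_graph G) \<and> hereditary \<C> \<and> long_paths_have_chord_pair \<C> \<longrightarrow>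
        finite_up_to graph_iso {G \<in> \<C>. minimal_obstruction 3 G})"
proof (intro conjI allI impI)
  have "finite_up_to list_instance_iso (free_list_obstructions k t l :: 'a list_instance set)"
    if "(k, t, l) \<in> {(3, 7, 3), (3, 7, 4), (4, 6, 3), (4, 5, 4), (5, 5, 3)}" for k t l
  proof (rule finite_free_list_obstructions)
    show "l = 3 \<or> l = 4" using that by auto
    show "\<not> free_ray {1..k} t l E c" for E c
      using that no_ray_7_3[of "{1..k}"] no_ray_7_4[of "{1..k}"] no_ray_6_3[of "{1..k}"]
        no_ray_5_4[of "{1..k}"] no_ray_5_3[of "{1..k}"] by auto
  qed
  then show "\<forall>(k, t, l) \<in> {(3, 7, 3), (3, 7, 4), (4, 6, 3), (4, 5, 4), (5, 5, 3)}.
      finite_up_to list_instance_iso (free_list_obstructions k t l :: 'a list_instance set)"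
    by blast
next
  fix \<C> :: "'a pair_pre_digraph set"
  assume "(\<forall>G\<in>\<C>. pair_graph G) \<and> hereditary \<C> \<and> long_paths_have_chord_pair \<C>"
  then show "finite_up_to graph_iso {G \<in> \<C>. minimal_obstruction 3 G}"
    using finite_chord_pair_obstructions by blast
qed

end
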